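(* Given $d \in \mathbb{N}$, a real-analytic function $f : \mathbb{T}^d \to \mathbb{R}$, and $\alpha \in \mathbb{T}^d$ Diophantine, there exists $c_1 > 0$ such that for every $c$ with $0 \le c < c_1$ the following holds. There is $\lambda_0 > 0$ such that for every compactly supported Borel probability measure $\nu$ on $\mathbb{R}$ with $\# \mathrm{supp}\,\nu \ge 2$ and $$\inf \{ |E - \tilde E| : E, \tilde E \in \mathrm{supp}\,\nu, \; E \neq \tilde E \} < \lambda_0,$$ the almost sure spectrum $\Sigma_\nu$ associated with the operators $$[H_\omega \psi](n) = \psi(n+1) + \psi(n-1) + \big(c f(\theta + n\alpha) + \omega_n\big)\psi(n)$$ on $\ell^2(\mathbb{Z})$ contains an interval (of positive length).
   Context: $\mathbb{T} = \mathbb{R}/\mathbb{Z}$. $\alpha \in \mathbb{T}^d$ is called Diophantine if there exist constants $\tau, K > 0$ such that $\mathrm{dist}(m \cdot \alpha, \mathbb{Z}) \ge K/|m|^{\tau}$ for every $m \in \mathbb{Z}^d \setminus \{0\}$. $\mathrm{supp}\,\nu$ denotes the topological support of $\nu$. Here $\theta \in \mathbb{T}^d$ and $\omega = (\omega_n)_{n \in \mathbb{Z}}$ is a sequence of i.i.d. random variables with common distribution $\nu$, i.e. $\omega$ is distributed according to $\nu^{\mathbb{Z}}$. The almost sure spectrum $\Sigma_\nu$ is the (existing and unique) compact subset of $\mathbb{R}$ such that for every $\theta \in \mathbb{T}^d$ and $\nu^{\mathbb{Z}}$-almost every $\omega$, $\sigma(H_\omega) = \Sigma_\nu$ (it depends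 on $c, f, \alpha, \nu$, but not on $\theta$ or $\omega$). *)

theory Defs
  imports "HOL-Probability.Probability"
begin

text \<open>Points of the torus \<open>\<real>\<^sup>d / \<int>\<^sup>d\<close> are represented by arbitrary lifts in \<open>real ^ 'd\<close>, functions on
  the torus by \<open>\<int>\<^sup>d\<close>-periodic functions on \<open>real ^ 'd\<close>; the dimension is \<open>d = CARD('d) \<ge> 1\<close>.\<close>

definition of_int_vec :: "int ^ 'd \<Rightarrow> real ^ 'd" where
  "of_int_vec m = (\<chi> i. of_int (m $ i))"

definition torus_function :: "(real ^ 'd \<Rightarrow> 'b) \<Rightarrow> bool" where
  "torus_function f \<longleftrightarrow> (\<forall>x m. f (x + of_int_vec m) = f x)"

text \<open>Near every point the function is the sum of an (unconditionally convergent) power series in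
  \<open>d\<close> variables, indexed by the multi-indices \<open>k :: 'd \<Rightarrow> nat\<close>.\<close>

definition real_analytic :: "(real ^ 'd \<Rightarrow> real) \<Rightarrow> bool" where
  "real_analytic f \<longleftrightarrow>
     (\<forall>x. \<exists>r>0. \<exists>a :: ('d \<Rightarrow> nat) \<Rightarrow> real. \<forall>y\<in>ball x r.
        ((\<lambda>k. a k * (\<Prod>i\<in>UNIV. (y $ i - x $ i) ^ k i)) has_sum f y) UNIV)"

definition diophantine :: "real ^ 'd \<Rightarrow> bool" where
  "diophantine \<alpha> \<longleftrightarrow>
     (\<exists>\<tau>>0. \<exists>K>0. \<forall>m :: int ^ 'd. m \<noteq> 0 \<longrightarrow>
        infdist (of_int_vec m \<bullet> \<alpha>) \<int> \<ge> K / norm (of_int_vec m) powr \<tau>)"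

definition topological_support :: "real measure \<Rightarrow> real set" where
  "topological_support \<nu> = {x. \<forall>U. open U \<and> x \<in> U \<longrightarrow> measure \<nu> U > 0}"

definition ell2 :: "(int \<Rightarrow> complex) set" where
  "ell2 = {\<psi>. (\<lambda>n. (cmod (\<psi> n))\<^sup>2) summable_on UNIV}"

definition ell2_norm :: "(int \<Rightarrow> complex) \<Rightarrow> real" where
  "ell2_norm \<psi> = sqrt (\<Sum>\<^sub>\<infinity>n. (cmod (\<psi> n))\<^sup>2)"

definition ell2_boundedly_invertible :: "((int \<Rightarrow> complex) \<Rightarrow> (int \<Rightarrow> complex)) \<Rightarrow> bool" where
  "ell2_boundedly_invertible T \<longleftrightarrow>
     bij_betw T ell2 ell2 \<and>
     (\<exists>C. \<forall>\<phi>\<in>ell2. ell2_norm (inv_into ell2 T \<phi>) \<le> C * ell2_norm \<phi>)"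

text \<open>Meaningful only for operators that map \<open>ell2\<close> boundedly into itself.\<close>

definition ell2_spectrum :: "((int \<Rightarrow> complex) \<Rightarrow> (int \<Rightarrow> complex)) \<Rightarrow> complex set" where
  "ell2_spectrum T = {z. \<not> ell2_boundedly_invertible (\<lambda>\<psi> n. T \<psi> n - z * \<psi> n)}"

definition schroedinger_op ::
  "real \<Rightarrow> (real ^ 'd \<Rightarrow> real) \<Rightarrow> real ^ 'd \<Rightarrow> real ^ 'd \<Rightarrow> (int \<Rightarrow> real)
    \<Rightarrow> (int \<Rightarrow> complex) \<Rightarrow> (int \<Rightarrow> complex)" where
  "schroedinger_op c f \<alpha> \<theta> \<omega> \<psi> n =
     \<psi> (n + 1) + \<psi> (n - 1)
       + complex_of_real (c * f (\<theta> + of_int n *\<^sub>R \<alpha>) + \<omega> n) * \<psi> n"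

definition is_almost_sure_spectrum ::
  "real \<Rightarrow> (real ^ 'd \<Rightarrow> real) \<Rightarrow> real ^ 'd \<Rightarrow> real measure \<Rightarrow> real set \<Rightarrow> bool" where
  "is_almost_sure_spectrum c f \<alpha> \<nu> S \<longleftrightarrow>
     compact S \<and>
     (\<forall>\<theta>. AE \<omega> in Pi\<^sub>M (UNIV :: int set) (\<lambda>_. \<nu>).
        ell2_spectrum (schroedinger_op c f \<alpha> \<theta> \<omega>) = complex_of_real ` S)"

definition almost_sure_spectrum ::
  "real \<Rightarrow> (real ^ 'd \<Rightarrow> real) \<Rightarrow> real ^ 'd \<Rightarrow> real measure \<Rightarrow> real set" where
  "almost_sure_spectrum c f \<alpha> \<nu> = (THE S. is_almost_sure_spectrum c f \<alpha> \<nu> S)"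

end

theory Submission
  imports Defs "HOL-Analysis.Kronecker_Approximation_Theorem" "HOL-Complex_Analysis.Great_Picard"
begin

text \<open>
  The spectrum is shown to contain an interval by exhibiting, for every energy in it, one potential
  in the support of the random ensemble with a solution that stays between two positive constants on
  a half-line.

  The almost sure spectrum is the set of approximate eigenvalues of all operators whose phase is
  arbitrary and whose random potential has arbitrary values in the support of \<open>\<nu>\<close>
  (\<open>almost_sure_spectrum_eq_hull_spectrum\<close>). Indeed the orbit of the rotation by \<open>\<alpha>\<close> is dense and
  recurrent, and an independent sequence almost surely contains approximate copies of every finite
  pattern over the support, at sites where the phase is as desired. It therefore suffices to find
  approximate eigenfunctions for suitable sequences \<open>\<omega>\<close> with two nearby values \<open>e\<close> and \<open>e + l\<close> of
  the support.

  For small \<open>c\<close>, the quasi-periodic operator has a ground state: an energy \<open>E\<close> and a solution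
  \<open>P\<close> with values close to 1 (\<open>quasiperiodic_ground_state\<close>). It is found by a Newton
  iteration in spaces of analytic quasi-periodic sequences. The linearised equation has divergence
  form and is solved by two cohomological equations, whose small divisors are controlled by the
  Diophantine condition on \<open>\<alpha>\<close> alone. The iteration needs exponentially decaying
  Fourier coefficients of \<open>f\<close> (\<open>real_analytic_fourier_series\<close>), which are obtained from discrete Fourier
  coefficients on fine grids and Cauchy estimates for finite differences.

  At an energy \<open>E + e + \<epsilon>\<close> with \<open>0 < \<epsilon> < l\<close>, a solution divided by \<open>P\<close> is a discrete
  particle that is pushed up or down according to the value of \<open>\<omega>\<close> at each site. Choosing the values
  one after the other, always against the current deviation, keeps the quotient between \<open>1 / 2\<close> and
  \<open>3 / 2\<close> forever, provided that \<open>l\<close> is small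
  (\<open>controlled_half_line_solution\<close>). Truncations of this solution are the required approximate
  eigenfunctions, and \<open>\<epsilon>\<close> ranges over an interval.
\<close>

section \<open>Almost periodic sequences with exponentially small coefficients\<close>

text \<open>The bound \<open>B\<close> controls the coefficient norm in which a term of frequency \<open>m\<close> has weight \<open>exp (r |m|)\<close>;
  it is the norm of an analytic function on the torus in a strip of width proportional to \<open>r\<close>, read
  along one orbit of the rotation. The frequencies \<open>m j\<close> may repeat: a product of two series is then
  just a series over pairs of indices, without collecting equal frequencies, and uniqueness of the
  coefficients is never at issue. Amplitudes and phases are real so that real sequences stay real in
  the Newton iteration.\<close>

definition wiener :: "real ^ 'd \<Rightarrow> real \<Rightarrow> real \<Rightarrow> (int \<Rightarrow> real) \<Rightarrow> bool" where
  "wiener \<alpha> r B u \<longleftrightarrow> (\<exists>(a :: nat \<Rightarrow> real) \<phi> m N. N \<le> B \<and>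
     ((\<lambda>j. \<bar>a j\<bar> * exp (r * norm (of_int_vec (m j)))) has_sum N) UNIV \<and>
     (\<forall>n. ((\<lambda>j. a j * cos (2 * pi * of_int n * (of_int_vec (m j) \<bullet> \<alpha>) + \<phi> j)) has_sum u n) UNIV))"

lemma of_int_vec_zero [simp]: "of_int_vec 0 = 0"
  and of_int_vec_add: "of_int_vec (m + m') = of_int_vec m + of_int_vec m'"
  and of_int_vec_diff: "of_int_vec (m - m') = of_int_vec m - of_int_vec m'"
  by (simp_all add: of_int_vec_def vec_eq_iff)

lemma has_sum_to_nat:
  fixes f :: "nat \<Rightarrow> 'a :: {topological_comm_monoid_add,t2_space}"
  assumes "\<And>j. j \<notin> range (to_nat :: 'i::countable \<Rightarrow> nat) \<Longrightarrow> f j = 0"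
  shows "(f has_sum S) UNIV \<longleftrightarrow> ((\<lambda>i :: 'i. f (to_nat i)) has_sum S) UNIV"
proof -
  have "(f has_sum S) UNIV \<longleftrightarrow> (f has_sum S) (range (to_nat :: 'i \<Rightarrow> nat))"
    by (rule has_sum_cong_neutral) (use assms in auto)
  also have "\<dots> \<longleftrightarrow> (f \<circ> to_nat has_sum S) (UNIV :: 'i set)"
    by (rule has_sum_reindex) simp
  finally show ?thesis by (simp add: o_def)
qed

text \<open>A series may be given over any countable index type; this is what makes sums and products of series
  again series of the same kind.\<close>

lemma wienerI:
  fixes a :: "'i::countable \<Rightarrow> real"
  assumes W: "((\<lambda>j. \<bar>a j\<bar> * exp (r * norm (of_int_vec (m j)))) has_sum N) UNIV" and "N \<le> B"
    and u: "\<And>n. ((\<lambda>j. a j * cos (2 * pi * of_int n * (of_int_vec (m j) \<bullet> \<alpha>) + \<phi> j)) has_sum u n) UNIV"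
  shows "wiener \<alpha> r B u"
proof -
  define a' where "a' j = (if j \<in> range (to_nat :: 'i \<Rightarrow> nat) then a (from_nat j) else 0)" for j
  define m' where "m' j = m (from_nat j)" for j
  define \<phi>' where "\<phi>' j = \<phi> (from_nat j)" for j
  have 1: "((\<lambda>j. \<bar>a' j\<bar> * exp (r * norm (of_int_vec (m' j)))) has_sum N) UNIV"
    by (subst has_sum_to_nat[where 'i='i]) (use W in \<open>auto simp: a'_def m'_def\<close>)
  have 2: "((\<lambda>j. a' j * cos (2 * pi * of_int n * (of_int_vec (m' j) \<bullet> \<alpha>) + \<phi>' j)) has_sum u n) UNIV" for n
    by (subst has_sum_to_nat[where 'i='i]) (use u in \<open>auto simp: a'_def m'_def \<phi>'_def\<close>)
  show ?thesis unfolding wiener_def using 1 2 \<open>N \<le> B\<close> by blast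
qed

lemma summable_cos_series:
  fixes a :: "'i \<Rightarrow> real"
  assumes "(\<lambda>j. \<bar>a j\<bar> * exp (r * norm (of_int_vec (m j)))) summable_on UNIV" and "r \<ge> 0"
  shows "(\<lambda>j. a j * cos (t j)) summable_on UNIV"
proof (rule abs_summable_summable, rule summable_on_comparison_test[OF assms(1)])
  fix j
  have "\<bar>a j\<bar> * \<bar>cos (t j)\<bar> \<le> \<bar>a j\<bar> * exp (r * norm (of_int_vec (m j)))"
    using assms(2) by (intro mult_left_mono order.trans[OF abs_cos_le_one]) auto
  then show "norm (a j * cos (t j)) \<le> \<bar>a j\<bar> * exp (r * norm (of_int_vec (m j)))"
    by (simp add: abs_mult)
qed auto

lemma wiener_bounded:
  assumes "wiener \<alpha> r B u" "r \<ge> 0"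
  shows "\<bar>u n\<bar> \<le> B"
proof -
  obtain a :: "nat \<Rightarrow> real" and \<phi> m N where "N \<le> B"
    and W: "((\<lambda>j. \<bar>a j\<bar> * exp (r * norm (of_int_vec (m j)))) has_sum N) UNIV"
    and u: "\<And>n. ((\<lambda>j. a j * cos (2 * pi * of_int n * (of_int_vec (m j) \<bullet> \<alpha>) + \<phi> j)) has_sum u n) UNIV"
    using assms(1) unfolding wiener_def by blast
  have "\<bar>u n\<bar> \<le> N"
    unfolding real_norm_def[symmetric]
  proof (rule norm_infsum_le[OF u[of n] W])
    fix j
    show "norm (a j * cos (2 * pi * of_int n * (of_int_vec (m j) \<bullet> \<alpha>) + \<phi> j)) \<le> \<bar>a j\<bar> * exp (r * norm (of_int_vec (m j)))"
      unfolding real_norm_def abs_mult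
      using assms(2) by (intro mult_left_mono order.trans[OF abs_cos_le_one]) auto
  qed
  then show ?thesis using \<open>N \<le> B\<close> by simp
qed

lemma wiener_nonneg: "wiener \<alpha> r B u \<Longrightarrow> r \<ge> 0 \<Longrightarrow> B \<ge> 0"
  using wiener_bounded[of \<alpha> r B u 0] by linarith

lemma wiener_mono:
  assumes "wiener \<alpha> r B u" "r' \<le> r" "B \<le> B'"
  shows "wiener \<alpha> r' B' u"
proof -
  obtain a :: "nat \<Rightarrow> real" and \<phi> m N where "N \<le> B"
    and W: "((\<lambda>j. \<bar>a j\<bar> * exp (r * norm (of_int_vec (m j)))) has_sum N) UNIV"
    and u: "\<And>n. ((\<lambda>j. a j * cos (2 * pi * of_int n * (of_int_vec (m j) \<bullet> \<alpha>) + \<phi> j)) has_sum u n) UNIV"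
    using assms(1) unfolding wiener_def by blast
  have le: "\<bar>a j\<bar> * exp (r' * norm (of_int_vec (m j))) \<le> \<bar>a j\<bar> * exp (r * norm (of_int_vec (m j)))" for j
    using assms(2) by (intro mult_left_mono) (auto intro: mult_right_mono)
  have s: "(\<lambda>j. \<bar>a j\<bar> * exp (r' * norm (of_int_vec (m j)))) summable_on UNIV"
    by (rule summable_on_comparison_test[OF has_sum_imp_summable[OF W]]) (use le in auto)
  have "infsum (\<lambda>j. \<bar>a j\<bar> * exp (r' * norm (of_int_vec (m j)))) UNIV \<le> N"
    using has_sum_mono[OF has_sum_infsum[OF s] W] le by blast
  then show ?thesis
    using u \<open>N \<le> B\<close> assms(3) by (intro wienerI[OF has_sum_infsum[OF s]]) auto
qed

text \<open>The double family of terms is absolutely summable because the weights are nonnegative and the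
  inner sums are dominated by the summable bounds \<open>B k\<close>.\<close>

lemma wiener_sum:
  fixes u :: "'k::countable \<Rightarrow> int \<Rightarrow> real"
  assumes "r \<ge> 0" and W: "\<And>k. wiener \<alpha> r (B k) (u k)" and B: "(B has_sum S) UNIV"
    and v: "\<And>n. ((\<lambda>k. u k n) has_sum v n) UNIV"
  shows "wiener \<alpha> r S v"
proof -
  have "\<forall>k. \<exists>(a :: nat \<Rightarrow> real) \<phi> m N. N \<le> B k \<and>
     ((\<lambda>j. \<bar>a j\<bar> * exp (r * norm (of_int_vec (m j)))) has_sum N) UNIV \<and>
     (\<forall>n. ((\<lambda>j. a j * cos (2 * pi * of_int n * (of_int_vec (m j) \<bullet> \<alpha>) + \<phi> j)) has_sum u k n) UNIV)"
    using W unfolding wiener_def by blast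
  then obtain a :: "'k \<Rightarrow> nat \<Rightarrow> real" and \<phi> m N where NB: "\<And>k. N k \<le> B k"
    and N: "\<And>k. ((\<lambda>j. \<bar>a k j\<bar> * exp (r * norm (of_int_vec (m k j)))) has_sum N k) UNIV"
    and u: "\<And>k n. ((\<lambda>j. a k j * cos (2 * pi * of_int n * (of_int_vec (m k j) \<bullet> \<alpha>) + \<phi> k j)) has_sum u k n) UNIV"
    unfolding choice_iff by blast
  have N0: "N k \<ge> 0" for k by (rule has_sum_nonneg[OF N]) auto
  have Ns: "N summable_on UNIV"
    by (rule summable_on_comparison_test[OF has_sum_imp_summable[OF B]]) (use NB N0 in auto)
  define w where "w = (\<lambda>x. \<bar>a (fst x) (snd x)\<bar> * exp (r * norm (of_int_vec (m (fst x) (snd x)))))"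
  have ws: "w summable_on (UNIV \<times> UNIV)"
    by (rule summable_on_SigmaI[where g=N]) (use N Ns in \<open>auto simp: w_def\<close>)
  have wN: "(w has_sum infsum N UNIV) (UNIV \<times> UNIV)"
    by (rule has_sum_SigmaI[where g=N]) (use N Ns ws in \<open>auto simp: w_def\<close>)
  have NS: "infsum N UNIV \<le> S"
    using has_sum_mono[OF has_sum_infsum[OF Ns] B] NB by blast
  have "((\<lambda>x. a (fst x) (snd x) * cos (2 * pi * of_int n * (of_int_vec (m (fst x) (snd x)) \<bullet> \<alpha>) + \<phi> (fst x) (snd x))) 
      has_sum v n) (UNIV \<times> UNIV)" for n
  proof (rule has_sum_SigmaI[where g="\<lambda>k. u k n"])
    show "(\<lambda>x. a (fst x) (snd x) * cos (2 * pi * of_int n * (of_int_vec (m (fst x) (snd x)) \<bullet> \<alpha>) + \<phi> (fst x) (snd x)))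
      summable_on UNIV \<times> UNIV"
      using ws \<open>r \<ge> 0\<close> unfolding w_def UNIV_Times_UNIV
      by (intro summable_cos_series[where r=r and m="\<lambda>x. m (fst x) (snd x)"]) auto
  qed (use u v in auto)
  then show ?thesis
    using wN NS unfolding w_def UNIV_Times_UNIV by (intro wienerI) auto
qed

lemma wiener_const: "\<bar>c\<bar> \<le> B \<Longrightarrow> wiener \<alpha> r B (\<lambda>_. c)"
  by (rule wienerI[where a="\<lambda>_::unit. c" and m="\<lambda>_. 0" and \<phi>="\<lambda>_. 0" and N="\<bar>c\<bar>"])
     (auto simp: has_sum_finite_iff)

lemma wiener_add:
  assumes "wiener \<alpha> r B u" "wiener \<alpha> r C v" "r \<ge> 0"
  shows "wiener \<alpha> r (B + C) (\<lambda>n. u n + v n)"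
  by (rule wiener_sum[where u="\<lambda>b. if b then u else v" and B="\<lambda>b. if b then B else C"])
     (use assms in \<open>auto simp: has_sum_finite_iff UNIV_bool\<close>)

lemma wiener_cmult:
  assumes "wiener \<alpha> r B u"
  shows "wiener \<alpha> r (\<bar>c\<bar> * B) (\<lambda>n. c * u n)"
proof -
  obtain a :: "nat \<Rightarrow> real" and \<phi> m N where "N \<le> B"
    and W: "((\<lambda>j. \<bar>a j\<bar> * exp (r * norm (of_int_vec (m j)))) has_sum N) UNIV"
    and u: "\<And>n. ((\<lambda>j. a j * cos (2 * pi * of_int n * (of_int_vec (m j) \<bullet> \<alpha>) + \<phi> j)) has_sum u n) UNIV"
    using assms(1) unfolding wiener_def by blast
  show ?thesis
    by (rule wienerI[where a="\<lambda>j. c * a j" and N="\<bar>c\<bar> * N" and m=m and \<phi>=\<phi>])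
       (use has_sum_cmult_right[OF W, of "\<bar>c\<bar>"] has_sum_cmult_right[OF u, of c] \<open>N \<le> B\<close>
        in \<open>auto simp: abs_mult mult.assoc intro: mult_left_mono\<close>)
qed

lemma wiener_diff:
  assumes "wiener \<alpha> r B u" "wiener \<alpha> r C v" "r \<ge> 0"
  shows "wiener \<alpha> r (B + C) (\<lambda>n. u n - v n)"
  using wiener_add[OF assms(1) wiener_cmult[OF assms(2), of "-1"] assms(3)] by simp

lemma wiener_shift:
  assumes "wiener \<alpha> r B u"
  shows "wiener \<alpha> r B (\<lambda>n. u (n + k))"
proof -
  obtain a :: "nat \<Rightarrow> real" and \<phi> m N where "N \<le> B"
    and W: "((\<lambda>j. \<bar>a j\<bar> * exp (r * norm (of_int_vec (m j)))) has_sum N) UNIV"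
    and u: "\<And>n. ((\<lambda>j. a j * cos (2 * pi * of_int n * (of_int_vec (m j) \<bullet> \<alpha>) + \<phi> j)) has_sum u n) UNIV"
    using assms(1) unfolding wiener_def by blast
  show ?thesis
    by (rule wienerI[where a=a and N=N and m=m and \<phi>="\<lambda>j. \<phi> j + 2 * pi * of_int k * (of_int_vec (m j) \<bullet> \<alpha>)"])
       (use W u[of "_ + k"] \<open>N \<le> B\<close> in \<open>auto simp: algebra_simps\<close>)
qed

text \<open>The product-to-sum formula \<open>2 cos A cos B = cos (A + B) + cos (A - B)\<close> turns a product into two
  series with frequencies \<open>m \<plusminus> l\<close>, and the weights are submultiplicative by the triangle inequality.\<close>

lemma wiener_mult:
  fixes \<alpha> :: "real ^ 'd"
  assumes "wiener \<alpha> r B u" "wiener \<alpha> r C v" and r: "r \<ge> 0"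
  shows "wiener \<alpha> r (B * C) (\<lambda>n. u n * v n)"
proof -
  obtain a :: "nat \<Rightarrow> real" and \<phi> m N where NB: "N \<le> B"
    and W: "((\<lambda>j. \<bar>a j\<bar> * exp (r * norm (of_int_vec (m j)))) has_sum N) UNIV"
    and u: "\<And>n. ((\<lambda>j. a j * cos (2 * pi * of_int n * (of_int_vec (m j) \<bullet> \<alpha>) + \<phi> j)) has_sum u n) UNIV"
    using assms(1) unfolding wiener_def by blast
  obtain b :: "nat \<Rightarrow> real" and \<psi> l M where MC: "M \<le> C"
    and X: "((\<lambda>j. \<bar>b j\<bar> * exp (r * norm (of_int_vec (l j)))) has_sum M) UNIV"
    and v: "\<And>n. ((\<lambda>j. b j * cos (2 * pi * of_int n * (of_int_vec (l j) \<bullet> \<alpha>) + \<psi> j)) has_sum v n) UNIV"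
    using assms(2) unfolding wiener_def by blast
  have N0: "N \<ge> 0" by (rule has_sum_nonneg[OF W]) auto
  have M0: "M \<ge> 0" by (rule has_sum_nonneg[OF X]) auto
  define w where "w = (\<lambda>x. (\<bar>a (fst x)\<bar> * exp (r * norm (of_int_vec (m (fst x))))) * 
      (\<bar>b (snd x)\<bar> * exp (r * norm (of_int_vec (l (snd x))))))"
  have ws: "w summable_on (UNIV \<times> UNIV)"
    by (rule summable_on_SigmaI[where g="\<lambda>j. (\<bar>a j\<bar> * exp (r * norm (of_int_vec (m j)))) * M"])
       (auto simp: w_def intro!: has_sum_cmult_right X summable_on_cmult_left has_sum_imp_summable[OF W])
  have wN: "(w has_sum N * M) (UNIV \<times> UNIV)"
    by (rule has_sum_SigmaI[where g="\<lambda>j. (\<bar>a j\<bar> * exp (r * norm (of_int_vec (m j)))) * M"])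
       (use ws in \<open>auto simp: w_def intro!: has_sum_cmult_right has_sum_cmult_left W X\<close>)
  define A where "A n j = 2 * pi * of_int n * (of_int_vec (m j) \<bullet> \<alpha>) + \<phi> j" for n j
  define B' where "B' n j = 2 * pi * of_int n * (of_int_vec (l j) \<bullet> \<alpha>) + \<psi> j" for n j
  define c where "c x = a (fst x) * b (snd x) / 2" for x
  have half: "\<exists>z. wiener \<alpha> r (N * M / 2) z \<and> (\<forall>n. ((\<lambda>x. c x * cos (A n (fst x) + \<sigma> * B' n (snd x))) has_sum z n) UNIV)"
    if \<sigma>: "\<sigma> = 1 \<or> \<sigma> = -1" for \<sigma> :: real
  proof -
    define f :: "nat \<times> nat \<Rightarrow> int ^ 'd"
      where "f x = (if \<sigma> = 1 then m (fst x) + l (snd x) else m (fst x) - l (snd x))" for x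
    have f: "of_int_vec (f x) = of_int_vec (m (fst x)) + \<sigma> *\<^sub>R of_int_vec (l (snd x))" for x
      using \<sigma> by (auto simp: f_def of_int_vec_add of_int_vec_diff)
    have nf: "norm (of_int_vec (f x)) \<le> norm (of_int_vec (m (fst x))) + norm (of_int_vec (l (snd x)))" for x
      unfolding f by (rule order.trans[OF norm_triangle_ineq]) (use \<sigma> in auto)
    have le: "\<bar>c x\<bar> * exp (r * norm (of_int_vec (f x))) \<le> w x / 2" for x
    proof -
      have "exp (r * norm (of_int_vec (f x))) \<le> exp (r * norm (of_int_vec (m (fst x)))) * exp (r * norm (of_int_vec (l (snd x))))"
        using mult_left_mono[OF nf r] by (simp add: exp_add[symmetric] algebra_simps)
      then have "(\<bar>a (fst x)\<bar> * \<bar>b (snd x)\<bar>) * exp (r * norm (of_int_vec (f x))) \<le> (\<bar>a (fst x)\<bar> * \<bar>b (snd x)\<bar>) * (exp (r * norm (of_int_vec (m (fst x)))) * exp (r * norm (of_int_vec (l (snd x)))))"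
        by (rule mult_left_mono) auto
      then show ?thesis by (simp add: c_def w_def abs_mult mult_ac)
    qed
    have w2: "((\<lambda>x. w x / 2) has_sum (N * M / 2)) UNIV"
      using has_sum_divide_const[OF wN] by simp
    have s: "(\<lambda>x. \<bar>c x\<bar> * exp (r * norm (of_int_vec (f x)))) summable_on UNIV"
      by (rule summable_on_comparison_test[OF has_sum_imp_summable[OF w2]]) (use le in auto)
    have "infsum (\<lambda>x. \<bar>c x\<bar> * exp (r * norm (of_int_vec (f x)))) UNIV \<le> N * M / 2"
      using has_sum_mono[OF has_sum_infsum[OF s] w2] le by blast
    moreover define z where "z n = infsum (\<lambda>x. c x * cos (A n (fst x) + \<sigma> * B' n (snd x))) UNIV" for n
    moreover have z: "((\<lambda>x. c x * cos (A n (fst x) + \<sigma> * B' n (snd x))) has_sum z n) UNIV" for n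
      unfolding z_def by (intro has_sum_infsum summable_cos_series[OF s r])
    moreover have "A n (fst x) + \<sigma> * B' n (snd x) = 2 * pi * of_int n * (of_int_vec (f x) \<bullet> \<alpha>) + (\<phi> (fst x) + \<sigma> * \<psi> (snd x))" for n x
      unfolding A_def B'_def f by (simp add: inner_add_left algebra_simps)
    ultimately have "wiener \<alpha> r (N * M / 2) z"
      using has_sum_infsum[OF s] by (intro wienerI[where a=c and m=f and \<phi>="\<lambda>x. \<phi> (fst x) + \<sigma> * \<psi> (snd x)"]) auto
    then show ?thesis using z by blast
  qed
  obtain y z where y: "wiener \<alpha> r (N * M / 2) y" "\<And>n. ((\<lambda>x. c x * cos (A n (fst x) + B' n (snd x))) has_sum y n) UNIV"
    and z: "wiener \<alpha> r (N * M / 2) z" "\<And>n. ((\<lambda>x. c x * cos (A n (fst x) - B' n (snd x))) has_sum z n) UNIV"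
    using half[of 1] half[of "-1"] by auto
  have "y n + z n = u n * v n" for n
  proof -
    have "((\<lambda>x. c x * cos (A n (fst x) + B' n (snd x)) + c x * cos (A n (fst x) - B' n (snd x))) has_sum y n + z n) UNIV"
      by (rule has_sum_add[OF y(2) z(2)])
    then have *: "((\<lambda>x. (a (fst x) * cos (A n (fst x))) * (b (snd x) * cos (B' n (snd x)))) has_sum y n + z n) (UNIV \<times> UNIV)"
      by (simp add: c_def cos_add cos_diff algebra_simps)
    have "((\<lambda>j. (a j * cos (A n j)) * v n) has_sum y n + z n) UNIV"
      by (rule has_sum_SigmaD[OF *]) (auto intro!: has_sum_cmult_right simp: B'_def v)
    moreover have "((\<lambda>j. (a j * cos (A n j)) * v n) has_sum u n * v n) UNIV"
      unfolding A_def by (intro has_sum_cmult_left u)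
    ultimately show ?thesis by (rule has_sum_unique)
  qed
  then have "wiener \<alpha> r (N * M) (\<lambda>n. u n * v n)"
    using wiener_add[OF y(1) z(1) r] by (simp add: field_simps)
  moreover have "N * M \<le> B * C" using NB MC N0 M0 by (intro mult_mono) auto
  ultimately show ?thesis using wiener_mono by blast
qed

lemma wiener_power:
  assumes "wiener \<alpha> r B u" "r \<ge> 0"
  shows "wiener \<alpha> r (B ^ k) (\<lambda>n. u n ^ k)"
  by (induction k) (auto intro: wiener_const wiener_mult assms)

text \<open>A geometric series in the Banach algebra of these sequences.\<close>

lemma wiener_inverse:
  assumes W: "wiener \<alpha> r B u" and r: "r \<ge> 0" and B: "B \<le> 1 / 2"
  shows "wiener \<alpha> r 2 (\<lambda>n. 1 / (1 + u n))"
proof -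
  have B0: "B \<ge> 0" using wiener_nonneg[OF W r] .
  have W': "wiener \<alpha> r B (\<lambda>n. - u n)" using wiener_cmult[OF W, of "-1"] by simp
  have u: "\<bar>u n\<bar> \<le> 1 / 2" for n using wiener_bounded[OF W r, of n] B by simp
  have geo: "((\<lambda>k. x ^ k) has_sum 1 / (1 - x)) UNIV" if "\<bar>x\<bar> \<le> 1 / 2" for x :: real
  proof (rule norm_summable_imp_has_sum)
    show "summable (\<lambda>k. norm (x ^ k))" using that by (auto simp: norm_power power_abs intro!: summable_geometric)
    show "(\<lambda>k. x ^ k) sums (1 / (1 - x))" by (rule geometric_sums) (use that in auto)
  qed
  have "wiener \<alpha> r (1 / (1 - B)) (\<lambda>n. 1 / (1 + u n))"
    by (rule wiener_sum[OF r wiener_power[OF W' r]]) (use geo[of B] geo[of "- u _"] u B0 B in auto)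
  moreover have "1 / (1 - B) \<le> 2" using B by (simp add: field_simps)
  ultimately show ?thesis using wiener_mono by blast
qed

section \<open>Small divisors and the cohomological equation\<close>

lemma norm_of_int_vec_ge_1:
  fixes m :: "int ^ 'd"
  assumes "m \<noteq> 0"
  shows "norm (of_int_vec m) \<ge> 1"
proof -
  obtain i where i: "m $ i \<noteq> 0" using assms by (auto simp: vec_eq_iff)
  have "1 \<le> \<bar>(of_int_vec m :: real ^ 'd) $ i\<bar>" using i by (simp add: of_int_vec_def)
  also have "\<dots> \<le> norm (of_int_vec m)" by (rule component_le_norm_cart)
  finally show ?thesis .
qed

text \<open>The Diophantine condition in the form in which it is used: a lower bound on the moduli
  \<open>2 |sin (pi m \<bullet> \<alpha>)|\<close> of the divisors \<open>exp (2 pi i m \<bullet> \<alpha>) - 1\<close>, with an integer exponent.\<close>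

definition small_divisors :: "real ^ 'd \<Rightarrow> nat \<Rightarrow> real \<Rightarrow> bool" where
  "small_divisors \<alpha> p G \<longleftrightarrow> G \<ge> 1 \<and> (\<forall>m :: int ^ 'd. m \<noteq> 0 \<longrightarrow>
     1 \<le> 2 * G * norm (of_int_vec m) ^ p * \<bar>sin (pi * (of_int_vec m \<bullet> \<alpha>))\<bar>)"

text \<open>The polynomial loss from the small divisors is paid for by a small part \<open>\<delta>\<close> of the exponential weight.\<close>

lemma power_exp_le: "x ^ p * exp (- \<delta> * x) \<le> fact p / \<delta> ^ p" if "x \<ge> 0" "\<delta> > 0" for x \<delta> :: real
proof -
  have "(\<Sum>k\<in>{p}. (\<delta> * x) ^ k /\<^sub>R fact k) \<le> (\<Sum>k. (\<delta> * x) ^ k /\<^sub>R fact k)"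
    by (rule sum_le_suminf[OF summable_exp_generic]) (use that in auto)
  then have "(\<delta> * x) ^ p / fact p \<le> exp (\<delta> * x)"
    by (simp add: exp_def divide_inverse mult.commute)
  then have "\<delta> ^ p * x ^ p \<le> fact p * exp (\<delta> * x)" by (simp add: field_simps power_mult_distrib)
  then show ?thesis using that by (simp add: exp_minus field_simps)
qed

lemma inner_of_int_vec_not_int:
  fixes \<alpha> :: "real ^ 'd"
  assumes "diophantine \<alpha>" "m \<noteq> 0"
  shows "of_int_vec m \<bullet> \<alpha> \<notin> \<int>"
proof
  assume "of_int_vec m \<bullet> \<alpha> \<in> \<int>"
  then have "infdist (of_int_vec m \<bullet> \<alpha>) \<int> = 0" by simp
  moreover have "norm (of_int_vec m :: real ^ 'd) > 0" using norm_of_int_vec_ge_1[OF assms(2)] by linarith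
  ultimately show False using assms unfolding diophantine_def
    by (metis divide_pos_pos leD powr_gt_zero less_irrefl)
qed

text \<open>Concavity of the sine on \<open>{0..pi}\<close>: the graph lies above its chord.\<close>

lemma twice_le_sin_pi: "2 * y \<le> sin (pi * y)" if y: "0 \<le> y" "y \<le> 1 / 2" for y :: real
proof -
  have conv: "convex_on {0..pi} (\<lambda>x. - sin x)"
  proof (rule f''_ge0_imp_convex)
    show "((\<lambda>x. - sin x) has_real_derivative - cos x) (at x)" for x :: real
      by (auto intro!: derivative_eq_intros)
    show "((\<lambda>x. - cos x) has_real_derivative sin x) (at x)" for x :: real
      by (auto intro!: derivative_eq_intros)
  qed (auto intro: sin_ge_zero)
  have "- sin ((1 - 2 * y) *\<^sub>R 0 + (2 * y) *\<^sub>R (pi / 2)) \<le> (1 - 2 * y) * (- sin 0) + (2 * y) * (- sin (pi / 2))"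
    by (rule convex_onD[OF conv]) (use y in auto)
  then show ?thesis by (simp add: mult.commute)
qed

lemma abs_sin_pi_ge: "2 * infdist x \<int> \<le> \<bar>sin (pi * x)\<bar>" for x :: real
proof -
  define k where "k = round x"
  define y where "y = \<bar>x - of_int k\<bar>"
  have y: "0 \<le> y" "y \<le> 1 / 2" using of_int_round_abs_le[of x] by (auto simp: y_def k_def abs_minus_commute)
  have "infdist x \<int> \<le> dist x (of_int k)" by (rule infdist_le) auto
  then have 1: "infdist x \<int> \<le> y" by (simp add: y_def dist_real_def)
  have "\<bar>sin (pi * x)\<bar> = \<bar>sin (pi * (x - of_int k))\<bar>"
  proof -
    have s: "sin (pi * of_int k) = 0" by (auto simp: sin_zero_iff_int2 mult.commute)
    then have "\<bar>cos (pi * of_int k)\<bar> = 1"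
      using sin_cos_squared_add[of "pi * of_int k"] by (simp add: power2_eq_1_iff)
    then show ?thesis using s by (simp add: right_diff_distrib sin_diff abs_mult)
  qed
  also have "\<dots> = sin (pi * y)"
  proof -
    have "sin (pi * y) \<ge> 0" using y by (intro sin_ge_zero) (auto simp: mult_le_cancel_left1)
    then show ?thesis unfolding y_def by (cases "x \<ge> of_int k") (auto simp: abs_if right_diff_distrib sin_diff)
  qed
  finally have 2: "\<bar>sin (pi * x)\<bar> = sin (pi * y)" .
  have "2 * y \<le> sin (pi * y)" by (rule twice_le_sin_pi[OF y])
  then show ?thesis using 1 2 by linarith
qed

text \<open>Since nonzero integer vectors have norm at least 1, the real exponent \<open>\<tau>\<close> may be rounded up.\<close>

lemma diophantine_small_divisors:
  fixes \<alpha> :: "real ^ 'd"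
  assumes "diophantine \<alpha>"
  obtains p G where "small_divisors \<alpha> p G"
proof -
  obtain \<tau> K where \<tau>: "\<tau> > 0" and K: "K > 0"
    and dio: "\<And>m :: int ^ 'd. m \<noteq> 0 \<Longrightarrow> infdist (of_int_vec m \<bullet> \<alpha>) \<int> \<ge> K / norm (of_int_vec m) powr \<tau>"
    using assms unfolding diophantine_def by blast
  define p where "p = nat \<lceil>\<tau>\<rceil>"
  define G where "G = max 1 (1 / (4 * K))"
  have GK: "1 \<le> 4 * G * K" using K by (simp add: G_def max_def field_simps)
  have "1 \<le> 2 * G * norm (of_int_vec m :: real ^ 'd) ^ p * \<bar>sin (pi * (of_int_vec m \<bullet> \<alpha>))\<bar>" if "m \<noteq> 0" for m :: "int ^ 'd"
  proof -
    define x where "x = norm (of_int_vec m :: real ^ 'd)"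
    have x: "x \<ge> 1" using norm_of_int_vec_ge_1[OF that] by (simp add: x_def)
    have "x powr \<tau> \<le> x powr (real p)" using x \<tau> by (intro powr_mono) (auto simp: p_def le_nat_iff)
    then have xp: "x powr \<tau> \<le> x ^ p" using x by (simp add: powr_realpow)
    have "K / x ^ p \<le> K / x powr \<tau>" using xp K x by (intro divide_left_mono) auto
    then have "2 * (K / x ^ p) \<le> \<bar>sin (pi * (of_int_vec m \<bullet> \<alpha>))\<bar>"
      using dio[OF that] abs_sin_pi_ge[of "of_int_vec m \<bullet> \<alpha>"] by (simp add: x_def)
    then have "2 * G * x ^ p * (2 * (K / x ^ p)) \<le> 2 * G * x ^ p * \<bar>sin (pi * (of_int_vec m \<bullet> \<alpha>))\<bar>"
      by (rule mult_left_mono) (use x in \<open>auto simp: G_def\<close>)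
    moreover have "2 * G * x ^ p * (2 * (K / x ^ p)) = 4 * G * K" using x by simp
    ultimately show ?thesis using GK by (simp add: x_def)
  qed
  then have "small_divisors \<alpha> p G" unfolding small_divisors_def by (simp add: G_def)
  then show ?thesis by (rule that)
qed

lemma has_sum_difference:
  fixes f g :: "'a \<Rightarrow> real"
  assumes "(f has_sum a) A" "(g has_sum b) A"
  shows "((\<lambda>x. f x - g x) has_sum (a - b)) A"
  using has_sum_add[OF assms(1) has_sum_uminusI[OF assms(2)]] by simp

text \<open>The equation \<open>v (n + 1) - v n = u n - \<mu>\<close> is solved term by term: the sequence
  \<open>sin (b n + t - b / 2) / (2 sin (b / 2))\<close> has increments \<open>cos (b n + t)\<close>. The terms with
  frequency zero cannot be solved for; they are constant and make up the mean \<open>\<mu>\<close>.\<close>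

lemma wiener_cohomological:
  fixes \<alpha> :: "real ^ 'd"
  assumes sd: "small_divisors \<alpha> p G" and W: "wiener \<alpha> r B u" and \<delta>: "0 < \<delta>" "\<delta> \<le> r"
  obtains \<mu> v where "\<bar>\<mu>\<bar> \<le> B" "wiener \<alpha> (r - \<delta>) (G * fact p / \<delta> ^ p * B) v" 
    "\<And>n. v (n + 1) - v n = u n - \<mu>"
proof -
  obtain a :: "nat \<Rightarrow> real" and \<phi> m N where NB: "N \<le> B"
    and W: "((\<lambda>j. \<bar>a j\<bar> * exp (r * norm (of_int_vec (m j)))) has_sum N) UNIV"
    and u: "\<And>n. ((\<lambda>j. a j * cos (2 * pi * of_int n * (of_int_vec (m j) \<bullet> \<alpha>) + \<phi> j)) has_sum u n) UNIV"
    using W unfolding wiener_def by blast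
  have G: "G \<ge> 1" using sd by (simp add: small_divisors_def)
  define D where "D = G * fact p / \<delta> ^ p"
  have D0: "D > 0" using G \<delta> by (simp add: D_def)
  define t where "t j = of_int_vec (m j) \<bullet> \<alpha>" for j
  define a' where "a' j = (if m j = 0 then 0 else a j / (2 * sin (pi * t j)))" for j
  define \<psi> where "\<psi> j = \<phi> j - pi * t j - pi / 2" for j
  define b where "b j = (if m j = 0 then a j * cos (\<phi> j) else 0)" for j
  have r0: "r \<ge> 0" "r - \<delta> \<ge> 0" using \<delta> by auto
  have bb: "norm (b j) \<le> \<bar>a j\<bar> * exp (r * norm (of_int_vec (m j)))" for j
  proof -
    have "\<bar>a j\<bar> * \<bar>cos (\<phi> j)\<bar> \<le> \<bar>a j\<bar> * exp (r * norm (of_int_vec (m j)))"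
      using r0 by (intro mult_left_mono order.trans[OF abs_cos_le_one]) auto
    then show ?thesis by (auto simp: b_def abs_mult)
  qed
  have bs: "b summable_on UNIV"
    by (rule abs_summable_summable, rule summable_on_comparison_test[OF has_sum_imp_summable[OF W]]) (use bb in auto)
  define \<mu> where "\<mu> = infsum b UNIV"
  have b: "(b has_sum \<mu>) UNIV" unfolding \<mu>_def by (rule has_sum_infsum[OF bs])
  have \<mu>: "\<bar>\<mu>\<bar> \<le> B" using norm_infsum_le[OF b W bb] NB by simp
  have wle: "\<bar>a' j\<bar> * exp ((r - \<delta>) * norm (of_int_vec (m j))) \<le> D * (\<bar>a j\<bar> * exp (r * norm (of_int_vec (m j))))" for j
  proof (cases "m j = 0")
    case True
    then show ?thesis using D0 by (simp add: a'_def)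
  next
    case False
    define x where "x = norm (of_int_vec (m j) :: real ^ 'd)"
    have "1 \<le> 2 * G * x ^ p * \<bar>sin (pi * t j)\<bar>"
      using sd False by (auto simp: small_divisors_def x_def t_def)
    then have "1 / (2 * \<bar>sin (pi * t j)\<bar>) \<le> G * x ^ p"
      by (cases "sin (pi * t j) = 0") (auto simp: field_simps)
    then have "\<bar>a j\<bar> * (1 / (2 * \<bar>sin (pi * t j)\<bar>)) \<le> \<bar>a j\<bar> * (G * x ^ p)"
      by (rule mult_left_mono) auto
    then have "\<bar>a' j\<bar> \<le> \<bar>a j\<bar> * (G * x ^ p)"
      using False by (simp add: a'_def abs_mult)
    then have "\<bar>a' j\<bar> * exp ((r - \<delta>) * x) \<le> \<bar>a j\<bar> * (G * x ^ p) * exp ((r - \<delta>) * x)"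
      by (rule mult_right_mono) auto
    also have "\<dots> = \<bar>a j\<bar> * exp (r * x) * G * (x ^ p * exp (- \<delta> * x))"
      by (simp add: algebra_simps exp_diff exp_minus exp_add field_simps)
    also have "\<dots> \<le> \<bar>a j\<bar> * exp (r * x) * G * (fact p / \<delta> ^ p)"
      using power_exp_le[of x \<delta> p] \<delta> G by (intro mult_left_mono) (auto simp: x_def)
    finally show ?thesis by (simp add: D_def x_def mult_ac)
  qed
  have DW: "((\<lambda>j. D * (\<bar>a j\<bar> * exp (r * norm (of_int_vec (m j))))) has_sum (D * N)) UNIV"
    by (rule has_sum_cmult_right[OF W])
  have s: "(\<lambda>j. \<bar>a' j\<bar> * exp ((r - \<delta>) * norm (of_int_vec (m j)))) summable_on UNIV"
    by (rule summable_on_comparison_test[OF has_sum_imp_summable[OF DW]]) (use wle in auto)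
  have "infsum (\<lambda>j. \<bar>a' j\<bar> * exp ((r - \<delta>) * norm (of_int_vec (m j)))) UNIV \<le> D * N"
    using has_sum_mono[OF has_sum_infsum[OF s] DW] wle by blast
  also have "\<dots> \<le> D * B" using NB D0 by simp
  finally have le: "infsum (\<lambda>j. \<bar>a' j\<bar> * exp ((r - \<delta>) * norm (of_int_vec (m j)))) UNIV \<le> D * B" .
  define v where "v n = infsum (\<lambda>j. a' j * cos (2 * pi * of_int n * t j + \<psi> j)) UNIV" for n
  have v: "((\<lambda>j. a' j * cos (2 * pi * of_int n * t j + \<psi> j)) has_sum v n) UNIV" for n
    unfolding v_def by (intro has_sum_infsum summable_cos_series[OF s r0(2)])
  have Wv: "wiener \<alpha> (r - \<delta>) (D * B) v"
    by (rule wienerI[OF has_sum_infsum[OF s] le]) (use v in \<open>simp add: t_def\<close>)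
  have "v (n + 1) - v n = u n - \<mu>" for n
  proof -
    have cos_shift: "cos (x - pi / 2) = sin x" for x :: real by (simp add: cos_diff)
    have eq: "a' j * cos (2 * pi * of_int (n + 1) * t j + \<psi> j) - a' j * cos (2 * pi * of_int n * t j + \<psi> j) = a j * cos (2 * pi * of_int n * t j + \<phi> j) - b j" for j
    proof (cases "m j = 0")
      case True
      then show ?thesis by (simp add: a'_def b_def t_def)
    next
      case False
      have s0: "sin (pi * t j) \<noteq> 0"
        using sd False unfolding small_divisors_def t_def by fastforce
      define y where "y = 2 * pi * of_int n * t j + \<phi> j"
      have c1: "cos (2 * pi * of_int (n + 1) * t j + \<psi> j) = sin (y + pi * t j)"
        using cos_shift[of "y + pi * t j"] by (simp add: y_def \<psi>_def algebra_simps)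
      have c2: "cos (2 * pi * of_int n * t j + \<psi> j) = sin (y - pi * t j)"
        using cos_shift[of "y - pi * t j"] by (simp add: y_def \<psi>_def algebra_simps)
      have c3: "sin (y + pi * t j) - sin (y - pi * t j) = 2 * sin (pi * t j) * cos y"
        by (simp add: sin_add sin_diff)
      show ?thesis
        unfolding c1 c2 right_diff_distrib[symmetric] c3 using False s0
        by (simp add: a'_def b_def y_def[symmetric])
    qed
    have "((\<lambda>j. a j * cos (2 * pi * of_int n * t j + \<phi> j) - b j) has_sum (v (n + 1) - v n)) UNIV"
      unfolding eq[symmetric] by (intro has_sum_difference v)
    moreover have "((\<lambda>j. a j * cos (2 * pi * of_int n * t j + \<phi> j) - b j) has_sum (u n - \<mu>)) UNIV"
      unfolding t_def by (intro has_sum_difference u b)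
    ultimately show ?thesis by (rule has_sum_unique)
  qed
  then show ?thesis using that \<mu> Wv unfolding D_def by blast
qed

section \<open>Newton iteration for a quasi-periodic ground state\<close>

text \<open>The residual of the eigenvalue equation \<open>P (n + 1) + P (n - 1) + V n P n = E P n\<close>, multiplied by
  \<open>P n\<close>. With this factor the linearised equation is in divergence form.\<close>

definition ground_state_defect :: "(int \<Rightarrow> real) \<Rightarrow> real \<Rightarrow> (int \<Rightarrow> real) \<Rightarrow> int \<Rightarrow> real" where
  "ground_state_defect V E P n = P n * (P (n + 1) + P (n - 1) + (V n - E) * P n)"

text \<open>Writing the new approximation as \<open>P (1 + h)\<close>, the part of the residual that is linear in \<open>h\<close> is
  the discrete divergence of \<open>P n P (n + 1) (h (n + 1) - h n)\<close> plus a multiple of the old residual.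
  If \<open>h\<close> cancels the old residual up to the change \<open>\<eta>\<close> of the energy, only terms quadratic in the
  residual survive.\<close>

lemma newton_step_identity:
  fixes P h V :: "int \<Rightarrow> real"
  assumes "P n * P (n + 1) * (h (n + 1) - h n) - P (n - 1) * P n * (h n - h (n - 1))
     = - ground_state_defect V E P n + \<eta> * (P n)\<^sup>2"
  shows "ground_state_defect V (E + \<eta>) (\<lambda>n. P n * (1 + h n)) n
     = (1 + h n) * (h n * (ground_state_defect V E P n - \<eta> * (P n)\<^sup>2))"
proof -
  have "ground_state_defect V (E + \<eta>) (\<lambda>n. P n * (1 + h n)) n = 
    (1 + h n) * (ground_state_defect V E P n * (1 + h n)
      + (P n * P (n + 1) * (h (n + 1) - h n) - P (n - 1) * P n * (h n - h (n - 1))) - \<eta> * (P n)\<^sup>2 * (1 + h n))"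
    unfolding ground_state_defect_def by (simp add: algebra_simps power2_eq_square)
  also have "\<dots> = (1 + h n) * (h n * (ground_state_defect V E P n - \<eta> * (P n)\<^sup>2))"
    unfolding assms by (simp add: algebra_simps)
  finally show ?thesis .
qed

text \<open>The linearised equation is solved exactly by two cohomological equations: one for the flux
  \<open>P n P (n + 1) (h (n + 1) - h n)\<close> and, after division by \<open>P n P (n + 1)\<close>, one for \<open>h\<close>. Each has a
  free constant, \<open>\<eta>\<close> and \<open>\<kappa>\<close>, which makes the mean of its right-hand side vanish. Each costs a part
  \<open>\<delta>\<close> of the exponential weight and a factor \<open>D\<close>. The distance \<open>1 / 16\<close> of \<open>P\<close> from 1 keeps the
  sequences whose means are divided by within \<open>1 / 2\<close> of 1.\<close>

lemma newton_step:
  fixes \<alpha> :: "real ^ 'd"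
  assumes sd: "small_divisors \<alpha> p G" and \<delta>: "0 < \<delta>" "2 * \<delta> \<le> r"
  defines "D \<equiv> G * fact p / \<delta> ^ p"
  assumes P: "wiener \<alpha> r (1 / 16) (\<lambda>n. P n - 1)"
    and e: "wiener \<alpha> r \<epsilon> (ground_state_defect V E P)" and small: "8 * D\<^sup>2 * \<epsilon> \<le> 1"
  obtains P' E' where "wiener \<alpha> (r - 2 * \<delta>) (9 * D\<^sup>2 * \<epsilon>) (\<lambda>n. P' n - P n)" "\<bar>E' - E\<bar> \<le> 2 * \<epsilon>"
    "wiener \<alpha> (r - 2 * \<delta>) (64 * D\<^sup>2 * \<epsilon>\<^sup>2) (ground_state_defect V E' P')"
proof -
  have r: "r \<ge> 0" "r - \<delta> \<ge> 0" "r - 2 * \<delta> \<ge> 0" "\<delta> \<le> r" "\<delta> \<le> r - \<delta>" using \<delta> by auto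
  have G: "G \<ge> 1" using sd by (simp add: small_divisors_def)
  have D0: "D > 0" using G \<delta> by (simp add: D_def)
  have \<epsilon>0: "\<epsilon> \<ge> 0" using wiener_nonneg[OF e r(1)] .
  let ?e = "ground_state_defect V E P"
  \<comment> \<open>\<open>P\<^sup>2\<close> and \<open>1 / a\<close> stay within \<open>1 / 2\<close> of 1, so the means by which one divides are at least \<open>1 / 2\<close>.\<close>
  have P2: "wiener \<alpha> r (1 / 2) (\<lambda>n. (P n)\<^sup>2 - 1)"
  proof (rule wiener_mono)
    have "wiener \<alpha> r (2 * (1 / 16) + (1 / 16)\<^sup>2) (\<lambda>n. 2 * (P n - 1) + (P n - 1)\<^sup>2)"
      by (rule wiener_add[OF _ wiener_power[OF P r(1)] r(1)]) (use wiener_cmult[OF P, of 2] in simp)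
    then show "wiener \<alpha> r (33 / 256) (\<lambda>n. (P n)\<^sup>2 - 1)"
      by (simp add: power2_eq_square algebra_simps)
  qed auto
  define a where "a n = P n * P (n + 1)" for n
  have a: "wiener \<alpha> r (1 / 4) (\<lambda>n. a n - 1)"
  proof (rule wiener_mono)
    have "wiener \<alpha> r (1 / 16 + 1 / 16 + 1 / 16 * (1 / 16)) (\<lambda>n. (P n - 1) + (P (n + 1) - 1) + (P n - 1) * (P (n + 1) - 1))"
      by (intro wiener_add wiener_mult wiener_shift[of \<alpha> r _ "\<lambda>n. P n - 1" 1] P r)
    then show "wiener \<alpha> r (33 / 256) (\<lambda>n. a n - 1)"
      by (simp add: a_def algebra_simps)
  qed auto
  have a0: "a n \<noteq> 0" for n using wiener_bounded[OF a r(1), of n] by auto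
  have A: "wiener \<alpha> r 2 (\<lambda>n. 1 / a n)"
    using wiener_inverse[OF a r(1)] by simp
  have A1: "wiener \<alpha> r (1 / 2) (\<lambda>n. 1 / a n - 1)"
  proof -
    have eq: "1 / a n - 1 = - 1 * ((a n - 1) * (1 / a n))" for n using a0[of n] by (simp add: field_simps)
    show ?thesis unfolding eq using wiener_cmult[OF wiener_mult[OF a A r(1)], of "-1"] by simp
  qed
  \<comment> \<open>The flux \<open>q\<close> must have divergence \<open>- e + \<eta> P\<^sup>2\<close>; \<open>\<eta>\<close> is the quotient of the two means.\<close>
  obtain \<mu>e ve where ve: "\<bar>\<mu>e\<bar> \<le> \<epsilon>" "wiener \<alpha> (r - \<delta>) (D * \<epsilon>) ve" "\<And>n. ve (n + 1) - ve n = ?e n - \<mu>e"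
    using wiener_cohomological[OF sd e \<delta>(1) r(4)] unfolding D_def by blast
  obtain \<mu>P vP where vP: "\<bar>\<mu>P\<bar> \<le> 1 / 2" "wiener \<alpha> (r - \<delta>) (D * (1 / 2)) vP" "\<And>n. vP (n + 1) - vP n = (P n)\<^sup>2 - 1 - \<mu>P"
    using wiener_cohomological[OF sd P2 \<delta>(1) r(4)] unfolding D_def by blast
  define \<eta> where "\<eta> = \<mu>e / (1 + \<mu>P)"
  have \<mu>P: "1 + \<mu>P \<ge> 1 / 2" using vP(1) by linarith
  have \<eta>: "\<bar>\<eta>\<bar> \<le> 2 * \<epsilon>"
  proof -
    have "\<bar>\<mu>e\<bar> / \<bar>1 + \<mu>P\<bar> \<le> \<epsilon> / (1 / 2)" using ve(1) \<mu>P \<epsilon>0 by (intro frac_le) auto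
    then show ?thesis by (simp add: \<eta>_def)
  qed
  define q where "q n = \<eta> * vP (n + 1) - ve (n + 1)" for n
  have q: "wiener \<alpha> (r - \<delta>) (2 * D * \<epsilon>) q"
  proof (rule wiener_mono)
    show "wiener \<alpha> (r - \<delta>) (\<bar>\<eta>\<bar> * (D * (1 / 2)) + D * \<epsilon>) q"
      unfolding q_def by (intro wiener_diff wiener_cmult wiener_shift vP ve r)
    have "\<bar>\<eta>\<bar> * (D * (1 / 2)) \<le> (2 * \<epsilon>) * (D * (1 / 2))" using \<eta> D0 by (intro mult_right_mono) auto
    then show "\<bar>\<eta>\<bar> * (D * (1 / 2)) + D * \<epsilon> \<le> 2 * D * \<epsilon>" by (simp add: mult_ac)
  qed auto
  have Dq: "q n - q (n - 1) = - ?e n + \<eta> * (P n)\<^sup>2" for n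
  proof -
    have "q n - q (n - 1) = \<eta> * (vP (n + 1) - vP n) - (ve (n + 1) - ve n)" by (simp add: q_def algebra_simps)
    also have "\<dots> = - ?e n + \<eta> * (P n)\<^sup>2 - (\<eta> * (1 + \<mu>P) - \<mu>e)" unfolding ve vP by (simp add: algebra_simps)
    also have "\<eta> * (1 + \<mu>P) - \<mu>e = 0" using \<mu>P by (simp add: \<eta>_def)
    finally show ?thesis by simp
  qed
  \<comment> \<open>Now \<open>h\<close> must have increments \<open>(q + \<kappa>) / a\<close>; the integration constant \<open>\<kappa>\<close> of the flux removes the mean.\<close>
  have qA: "wiener \<alpha> (r - \<delta>) (2 * D * \<epsilon> * 2) (\<lambda>n. q n * (1 / a n))"
    by (rule wiener_mult[OF q _ r(2)]) (rule wiener_mono[OF A], use \<delta> in auto)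
  obtain \<mu>1 v1 where v1: "\<bar>\<mu>1\<bar> \<le> 2 * D * \<epsilon> * 2" "wiener \<alpha> (r - \<delta> - \<delta>) (D * (2 * D * \<epsilon> * 2)) v1" "\<And>n. v1 (n + 1) - v1 n = q n * (1 / a n) - \<mu>1"
    using wiener_cohomological[OF sd qA \<delta>(1) r(5)] unfolding D_def by blast
  have A1': "wiener \<alpha> (r - \<delta>) (1 / 2) (\<lambda>n. 1 / a n - 1)"
    by (rule wiener_mono[OF A1]) (use \<delta> in auto)
  obtain \<mu>2 v2 where v2: "\<bar>\<mu>2\<bar> \<le> 1 / 2" "wiener \<alpha> (r - \<delta> - \<delta>) (D * (1 / 2)) v2" "\<And>n. v2 (n + 1) - v2 n = 1 / a n - 1 - \<mu>2"
    using wiener_cohomological[OF sd A1' \<delta>(1) r(5)] unfolding D_def by blast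
  define \<kappa> where "\<kappa> = - \<mu>1 / (1 + \<mu>2)"
  have \<mu>2: "1 + \<mu>2 \<ge> 1 / 2" using v2(1) by linarith
  have \<kappa>: "\<bar>\<kappa>\<bar> \<le> 8 * D * \<epsilon>"
  proof -
    have "\<bar>\<mu>1\<bar> / \<bar>1 + \<mu>2\<bar> \<le> (2 * D * \<epsilon> * 2) / (1 / 2)" using v1(1) \<mu>2 by (intro frac_le) auto
    then show ?thesis by (simp add: \<kappa>_def)
  qed
  define h where "h n = v1 n + \<kappa> * v2 n" for n
  define H where "H = 8 * D\<^sup>2 * \<epsilon>"
  have h: "wiener \<alpha> (r - 2 * \<delta>) H h"
  proof (rule wiener_mono)
    show "wiener \<alpha> (r - \<delta> - \<delta>) (D * (2 * D * \<epsilon> * 2) + \<bar>\<kappa>\<bar> * (D * (1 / 2))) h"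
      unfolding h_def by (intro wiener_add wiener_cmult v1 v2) (use r in auto)
    have "\<bar>\<kappa>\<bar> * (D * (1 / 2)) \<le> 8 * D * \<epsilon> * (D * (1 / 2))" using \<kappa> D0 by (intro mult_right_mono) auto
    then show "D * (2 * D * \<epsilon> * 2) + \<bar>\<kappa>\<bar> * (D * (1 / 2)) \<le> H" by (simp add: H_def power2_eq_square)
  qed auto
  have Dh: "a n * (h (n + 1) - h n) = q n + \<kappa>" for n
  proof -
    have "h (n + 1) - h n = (v1 (n + 1) - v1 n) + \<kappa> * (v2 (n + 1) - v2 n)" by (simp add: h_def algebra_simps)
    also have "\<dots> = (q n + \<kappa>) * (1 / a n) - (\<mu>1 + \<kappa> * (1 + \<mu>2))" unfolding v1 v2 by (simp add: algebra_simps add_divide_distrib)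
    also have "\<mu>1 + \<kappa> * (1 + \<mu>2) = 0" using \<mu>2 by (simp add: \<kappa>_def)
    finally show ?thesis using a0[of n] by (simp add: field_simps)
  qed
  have lin: "P n * P (n + 1) * (h (n + 1) - h n) - P (n - 1) * P n * (h n - h (n - 1)) = - ?e n + \<eta> * (P n)\<^sup>2" for n
    using Dh[of n] Dh[of "n - 1"] Dq[of n] by (simp add: a_def)
  define P' where "P' n = P n * (1 + h n)" for n
  have new: "ground_state_defect V (E + \<eta>) P' n = (1 + h n) * (h n * (?e n - \<eta> * (P n)\<^sup>2))" for n
    unfolding P'_def by (rule newton_step_identity[OF lin])
  have H0: "H \<ge> 0" "H \<le> 1" using \<epsilon>0 small by (auto simp: H_def)
  note lower = wiener_mono[where r'="r - 2 * \<delta>", OF _ _ order.refl]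
  have one: "wiener \<alpha> (r - 2 * \<delta>) 2 (\<lambda>n. 1 + h n)"
    by (rule wiener_mono[OF wiener_add[OF wiener_const[of 1 1] h r(3)]]) (use H0 in auto)
  have b: "wiener \<alpha> (r - 2 * \<delta>) (4 * \<epsilon>) (\<lambda>n. ?e n - \<eta> * (P n)\<^sup>2)"
  proof (rule wiener_mono)
    have "wiener \<alpha> r (\<epsilon> + \<bar>\<eta>\<bar> * (1 + 1 / 2)) (\<lambda>n. ?e n - \<eta> * (1 + ((P n)\<^sup>2 - 1)))"
      by (intro wiener_diff wiener_cmult wiener_add[of _ _ 1 "\<lambda>_. 1"] wiener_const e P2 r) auto
    then show "wiener \<alpha> r (\<epsilon> + \<bar>\<eta>\<bar> * (1 + 1 / 2)) (\<lambda>n. ?e n - \<eta> * (P n)\<^sup>2)" by simp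
    show "\<epsilon> + \<bar>\<eta>\<bar> * (1 + 1 / 2) \<le> 4 * \<epsilon>" using \<eta> by simp
  qed (use \<delta> in auto)
  have "wiener \<alpha> (r - 2 * \<delta>) (2 * (H * (4 * \<epsilon>))) (ground_state_defect V (E + \<eta>) P')"
    unfolding new[abs_def] by (intro wiener_mult one h b r)
  moreover have "2 * (H * (4 * \<epsilon>)) = 64 * D\<^sup>2 * \<epsilon>\<^sup>2" by (simp add: H_def power2_eq_square)
  moreover have "wiener \<alpha> (r - 2 * \<delta>) (9 * D\<^sup>2 * \<epsilon>) (\<lambda>n. P' n - P n)"
  proof (rule wiener_mono)
    have "wiener \<alpha> (r - 2 * \<delta>) ((1 + 1 / 16) * H) (\<lambda>n. (1 + (P n - 1)) * h n)"
      by (intro wiener_mult wiener_add[of _ _ 1 "\<lambda>_. 1"] wiener_const h r lower[OF P]) (use \<delta> in auto)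
    then show "wiener \<alpha> (r - 2 * \<delta>) ((1 + 1 / 16) * H) (\<lambda>n. P' n - P n)" by (simp add: P'_def algebra_simps)
    show "(1 + 1 / 16) * H \<le> 9 * D\<^sup>2 * \<epsilon>" using H0 by (simp add: H_def)
  qed auto
  ultimately show ?thesis using that[of P' "E + \<eta>"] \<eta> by simp
qed

lemma geometric_Cauchy_limit:
  fixes x :: "nat \<Rightarrow> real"
  assumes "\<And>k. \<bar>x (Suc k) - x k\<bar> \<le> C * (1 / 2) ^ k"
  shows "convergent x"
proof -
  have "summable (\<lambda>k. x (Suc k) - x k)"
    by (rule summable_comparison_test'[where g="\<lambda>k. C * (1 / 2) ^ k" and N=0])
       (use assms in \<open>auto intro!: summable_mult summable_geometric\<close>)
  then have "summable (\<lambda>k. x (Suc k) - x k)" .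
  then have "convergent (\<lambda>n. \<Sum>k<n. x (Suc k) - x k)" by (simp add: summable_iff_convergent)
  then have "convergent (\<lambda>n. x n - x 0)" by (simp add: sum_lessThan_telescope)
  then have "convergent (\<lambda>n. (x n - x 0) + x 0)" by (intro convergent_add convergent_const)
  then show ?thesis by simp
qed

text \<open>The rate of the exponential weight is halved in every Newton step, so the loss factors \<open>D k\<close> grow
  geometrically. The quadratic gain is far more than needed: it suffices that the defects decrease
  geometrically, at a rate that beats the growth of \<open>(D k)\<^sup>2\<close>. The rates tend to zero, so the
  limit need not be analytic; it is taken pointwise.\<close>

theorem quasiperiodic_ground_state:
  fixes \<alpha> :: "real ^ 'd"
  assumes sd: "small_divisors \<alpha> p G" and r: "r > 0"
  obtains \<kappa> where "\<kappa> > 0" "\<And>V. wiener \<alpha> r \<kappa> V \<Longrightarrow> \<exists>E P. \<forall>n. \<bar>P n - 1\<bar> \<le> 1 / 16 \<and>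
    P (n + 1) + P (n - 1) + V n * P n = E * P n"
proof -
  have G: "G \<ge> 1" using sd by (simp add: small_divisors_def)
  \<comment> \<open>\<open>s\<close> is the growth factor of \<open>(D k)\<^sup>2\<close> when the rate \<open>\<rho> k\<close> is halved.\<close>
  define s :: real where "s = 4 ^ p"
  have s: "s \<ge> 1" by (simp add: s_def)
  define \<rho> where "\<rho> k = r / 2 ^ k" for k :: nat
  have \<rho>: "\<rho> k > 0" "\<rho> (Suc k) = \<rho> k - 2 * (\<rho> k / 4)" for k using r by (simp_all add: \<rho>_def)
  define D where "D k = G * fact p / (\<rho> k / 4) ^ p" for k
  have D0: "D 0 > 0" using G r by (simp add: D_def \<rho>_def)
  have D: "(D k)\<^sup>2 = (D 0)\<^sup>2 * s ^ k" for k
    using r by (simp add: D_def \<rho>_def s_def power_divide power_mult_distrib power2_eq_square field_simps)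
      (simp flip: power_mult power_mult_distrib add: mult.commute)
  \<comment> \<open>The constant 288 makes the corrections of step \<open>k\<close> at most \<open>(1 / 2) ^ k / 32\<close>, which add up to \<open>1 / 16\<close>.\<close>
  define \<kappa> where "\<kappa> = 1 / (288 * s * ((D 0)\<^sup>2 + 1))"
  have D1: "(D 0)\<^sup>2 + 1 > 0" by (rule add_nonneg_pos) auto
  have \<kappa>: "\<kappa> > 0" using s D1 by (simp add: \<kappa>_def)
  have \<kappa>_prod: "288 * s * ((D 0)\<^sup>2 + 1) * \<kappa> = 1" using s D1 by (simp add: \<kappa>_def)
  have s\<kappa>: "288 * s * (D 0)\<^sup>2 * \<kappa> \<le> 1" and \<kappa>1: "288 * \<kappa> \<le> 1"
  proof -
    have "288 * s * (D 0)\<^sup>2 * \<kappa> + 288 * s * \<kappa> = 1" using \<kappa>_prod by (simp add: algebra_simps)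
    moreover have "288 * s * (D 0)\<^sup>2 * \<kappa> \<ge> 0" "288 * s * \<kappa> \<ge> 0" "288 * \<kappa> \<le> 288 * s * \<kappa>" using s \<kappa> by auto
    ultimately show "288 * s * (D 0)\<^sup>2 * \<kappa> \<le> 1" "288 * \<kappa> \<le> 1" by linarith+
  qed
  have D0\<kappa>: "288 * (D 0)\<^sup>2 * \<kappa> \<le> 1"
  proof -
    have "(D 0)\<^sup>2 * \<kappa> * 1 \<le> (D 0)\<^sup>2 * \<kappa> * s" using s \<kappa> by (intro mult_left_mono) auto
    then show ?thesis using s\<kappa> by (simp add: mult_ac)
  qed
  define \<epsilon> where "\<epsilon> k = \<kappa> / (2 * s) ^ k" for k
  have DE: "(D k)\<^sup>2 * \<epsilon> k = (D 0)\<^sup>2 * \<kappa> / 2 ^ k" for k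
    unfolding D[of k] using s by (simp add: \<epsilon>_def field_simps power_mult_distrib)
  have \<epsilon>0: "\<epsilon> k \<ge> 0" for k using s \<kappa> by (simp add: \<epsilon>_def)
  have half: "1 / 2 ^ k \<le> (1 :: real)" for k :: nat by (simp add: field_simps)
  have \<epsilon>le: "\<epsilon> k \<le> \<kappa> * (1 / 2) ^ k" for k
  proof -
    have "(2 :: real) ^ k \<le> (2 * s) ^ k" using s by (intro power_mono) auto
    then have "\<kappa> / (2 * s) ^ k \<le> \<kappa> / 2 ^ k" using s \<kappa> by (intro divide_left_mono) auto
    then show ?thesis by (simp add: \<epsilon>_def power_one_over)
  qed
  have "\<exists>E P. \<forall>n. \<bar>P n - 1\<bar> \<le> 1 / 16 \<and> P (n + 1) + P (n - 1) + V n * P n = E * P n"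
    if V: "wiener \<alpha> r \<kappa> V" for V
  proof -
    define good where "good k x \<longleftrightarrow> wiener \<alpha> (\<rho> k) (1 / 16 * (1 - (1 / 2) ^ k)) (\<lambda>n. fst x n - 1) \<and>
        wiener \<alpha> (\<rho> k) (\<epsilon> k) (ground_state_defect V (snd x) (fst x))" for k x
    define close where "close k x y \<longleftrightarrow> wiener \<alpha> (\<rho> (Suc k)) (1 / 32 * (1 / 2) ^ k) (\<lambda>n. fst y n - fst x n) \<and> \<bar>snd y - snd x\<bar> \<le> 2 * \<kappa> * (1 / 2) ^ k"
      for k :: nat and x y :: "(int \<Rightarrow> real) \<times> real"
    have "\<exists>f. \<forall>k. good k (f k) \<and> close k (f k) (f (Suc k))"
    proof (rule dependent_nat_choice)
      have "ground_state_defect V 2 (\<lambda>_. 1) = V" by (rule ext) (simp add: ground_state_defect_def)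
      then show "\<exists>x. good 0 x"
        by (intro exI[of _ "(\<lambda>_. 1, 2)"])
          (use V in \<open>auto simp: good_def \<rho>_def \<epsilon>_def intro: wiener_const\<close>)
    next
      fix x k assume x: "good k x"
      have small: "8 * (D k)\<^sup>2 * \<epsilon> k \<le> 1"
      proof -
        have "8 * ((D 0)\<^sup>2 * \<kappa>) * (1 / 2 ^ k) \<le> 8 * ((D 0)\<^sup>2 * \<kappa>) * 1"
          using \<kappa> by (intro mult_left_mono[OF half]) auto
        also have "\<dots> \<le> 1" using D0\<kappa> mult_nonneg_nonneg[OF zero_le_power2[of "D 0"] less_imp_le[OF \<kappa>]] by linarith
        finally show ?thesis using DE[of k] by (simp add: mult.assoc)
      qed
      have Pk: "wiener \<alpha> (\<rho> k) (1 / 16) (\<lambda>n. fst x n - 1)"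
        by (rule wiener_mono[where r="\<rho> k" and B="1 / 16 * (1 - (1 / 2) ^ k)"]) (use x in \<open>auto simp: good_def\<close>)
      have ek: "wiener \<alpha> (\<rho> k) (\<epsilon> k) (ground_state_defect V (snd x) (fst x))" using x by (simp add: good_def)
      obtain P' E' where P': "wiener \<alpha> (\<rho> k - 2 * (\<rho> k / 4)) (9 * (D k)\<^sup>2 * \<epsilon> k) (\<lambda>n. P' n - fst x n)"
        and E': "\<bar>E' - snd x\<bar> \<le> 2 * \<epsilon> k"
        and e': "wiener \<alpha> (\<rho> k - 2 * (\<rho> k / 4)) (64 * (D k)\<^sup>2 * (\<epsilon> k)\<^sup>2) (ground_state_defect V E' P')"
        by (rule newton_step[OF sd, of "\<rho> k / 4" "\<rho> k" "fst x" "\<epsilon> k" V "snd x"])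
           (use Pk ek small \<rho> in \<open>auto simp: D_def less_imp_le\<close>)
      have "9 * ((D 0)\<^sup>2 * \<kappa>) * (1 / 2 ^ k) \<le> 1 / 32 * (1 / 2 ^ k)"
        by (rule mult_right_mono) (use D0\<kappa> in auto)
      then have "9 * (D k)\<^sup>2 * \<epsilon> k \<le> 1 / 32 * (1 / 2) ^ k" using DE[of k] by (simp add: power_one_over mult.assoc)
      then have diff: "wiener \<alpha> (\<rho> (Suc k)) (1 / 32 * (1 / 2) ^ k) (\<lambda>n. P' n - fst x n)"
        unfolding \<rho>(2) using wiener_mono[OF P'] by blast
      have "wiener \<alpha> (\<rho> (Suc k)) (1 / 32 * (1 / 2) ^ k + 1 / 16 * (1 - (1 / 2) ^ k)) (\<lambda>n. (P' n - fst x n) + (fst x n - 1))"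
        by (intro wiener_add diff wiener_mono[where r="\<rho> k" and r'="\<rho> (Suc k)" and B="1 / 16 * (1 - (1 / 2) ^ k)"])
           (use x \<rho>(1)[of "Suc k"] \<rho>(1)[of k] in \<open>auto simp: good_def \<rho>(2)\<close>)
      then have P1: "wiener \<alpha> (\<rho> (Suc k)) (1 / 16 * (1 - (1 / 2) ^ Suc k)) (\<lambda>n. P' n - 1)"
        by (simp add: algebra_simps)
      have "64 * (D k)\<^sup>2 * (\<epsilon> k)\<^sup>2 = (64 * ((D 0)\<^sup>2 * \<kappa>)) * (1 / 2 ^ k) * \<epsilon> k"
      proof -
        have "64 * (D k)\<^sup>2 * (\<epsilon> k)\<^sup>2 = 64 * ((D k)\<^sup>2 * \<epsilon> k) * \<epsilon> k" by (simp add: power2_eq_square[of "\<epsilon> k"])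
        then show ?thesis unfolding DE by simp
      qed
      also have "\<dots> \<le> (64 * ((D 0)\<^sup>2 * \<kappa>)) * 1 * \<epsilon> k"
        using \<kappa> \<epsilon>0 by (intro mult_right_mono mult_left_mono[OF half]) auto
      also have "\<dots> \<le> 1 / (2 * s) * \<epsilon> k"
        by (rule mult_right_mono) (use s\<kappa> s \<kappa> \<epsilon>0 in \<open>auto simp: field_simps\<close>)
      also have "\<dots> = \<epsilon> (Suc k)" by (simp add: \<epsilon>_def)
      finally have e1: "wiener \<alpha> (\<rho> (Suc k)) (\<epsilon> (Suc k)) (ground_state_defect V E' P')"
        unfolding \<rho>(2) using wiener_mono[OF e'] by blast
      have "\<bar>E' - snd x\<bar> \<le> 2 * \<kappa> * (1 / 2) ^ k" using E' \<epsilon>le[of k] by linarith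
      then show "\<exists>y. good (Suc k) y \<and> close k x y"
        using P1 e1 diff by (intro exI[of _ "(P', E')"]) (simp add: good_def close_def)
    qed
    then obtain f where f: "\<And>k. good k (f k)" "\<And>k. close k (f k) (f (Suc k))" by blast
    define P where "P k = fst (f k)" for k
    define E where "E k = snd (f k)" for k
    have "\<bar>P (Suc k) n - P k n\<bar> \<le> 1 / 32 * (1 / 2) ^ k" for k n
      using f(2)[of k] wiener_bounded[where r="\<rho> (Suc k)"] \<rho>(1)[of "Suc k"] unfolding close_def P_def
      by (metis less_imp_le)
    then have "convergent (\<lambda>k. P k n)" for n by (rule geometric_Cauchy_limit)
    then have "\<exists>L. (\<lambda>k. P k n) \<longlonglongrightarrow> L" for n by (simp add: convergent_def)
    then obtain L where L: "\<And>n. (\<lambda>k. P k n) \<longlonglongrightarrow> L n" by metis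
    have "\<bar>E (Suc k) - E k\<bar> \<le> 2 * \<kappa> * (1 / 2) ^ k" for k
      using f(2)[of k] by (simp add: close_def E_def)
    then have "convergent E" by (rule geometric_Cauchy_limit)
    then obtain F where F: "E \<longlonglongrightarrow> F" by (auto simp: convergent_def)
    have L1: "\<bar>L n - 1\<bar> \<le> 1 / 16" for n
    proof (rule Lim_bounded)
      show "(\<lambda>k. \<bar>P k n - 1\<bar>) \<longlonglongrightarrow> \<bar>L n - 1\<bar>" by (intro tendsto_intros L)
      show "\<forall>k\<ge>0. \<bar>P k n - 1\<bar> \<le> 1 / 16"
      proof (intro allI impI)
        fix k
        have "\<bar>P k n - 1\<bar> \<le> 1 / 16 * (1 - (1 / 2) ^ k)"
          using f(1)[of k] wiener_bounded[where r="\<rho> k"] \<rho>(1)[of k] unfolding good_def P_def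
          by (metis less_imp_le)
        also have "\<dots> \<le> 1 / 16" by simp
        finally show "\<bar>P k n - 1\<bar> \<le> 1 / 16" .
      qed
    qed
    have "ground_state_defect V F L n = 0" for n
    proof (rule LIMSEQ_unique)
      show "(\<lambda>k. ground_state_defect V (E k) (P k) n) \<longlonglongrightarrow> ground_state_defect V F L n"
        unfolding ground_state_defect_def by (intro tendsto_intros L F)
      show "(\<lambda>k. ground_state_defect V (E k) (P k) n) \<longlonglongrightarrow> 0"
      proof (rule Lim_null_comparison)
        have "norm (ground_state_defect V (E k) (P k) n) \<le> \<kappa> * (1 / 2) ^ k" for k
        proof -
          have "\<bar>ground_state_defect V (E k) (P k) n\<bar> \<le> \<epsilon> k"
            using f(1)[of k] wiener_bounded[where r="\<rho> k"] \<rho>(1)[of k] unfolding good_def P_def E_def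
            by (metis less_imp_le)
          then show ?thesis using \<epsilon>le[of k] by simp
        qed
        then show "\<forall>\<^sub>F k in sequentially. norm (ground_state_defect V (E k) (P k) n) \<le> \<kappa> * (1 / 2) ^ k" by simp
        show "(\<lambda>k. \<kappa> * (1 / 2) ^ k) \<longlonglongrightarrow> 0" by (intro tendsto_mult_right_zero LIMSEQ_realpow_zero) auto
      qed
    qed
    moreover have "L n \<noteq> 0" for n using L1[of n] by auto
    ultimately have g: "L (n + 1) + L (n - 1) + (V n - F) * L n = 0" for n
      unfolding ground_state_defect_def by (metis mult_eq_0_iff)
    have "L (n + 1) + L (n - 1) + V n * L n = F * L n" for n
      using g[of n] by (simp add: algebra_simps)
    then show ?thesis using L1 by blast
  qed
  then show ?thesis using that \<kappa> by blast
qed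

section \<open>Steering a solution with the random potential\<close>

text \<open>In the coordinates of \<open>controlled_half_line_solution\<close> below, one step moves the velocity \<open>y\<close> by
  \<open>s p x\<close> and the position \<open>x\<close> by \<open>q y'\<close>; the sign of the kick \<open>s\<close> can be chosen, and its size lies
  between \<open>l / 3\<close> and \<open>2 l / 3\<close>. This is a double integrator, stabilised by sliding-mode control: the
  sign of \<open>s\<close> is chosen opposite to the sign of \<open>y + k (x - 1)\<close>. While this quantity is at most \<open>B\<close>
  in modulus, the position relaxes towards 1 at rate \<open>k q\<close>. The bound \<open>B\<close> is twice the largest kick,
  and the gain \<open>k = 2 B\<close> makes the interval \<open>\<bar>x - 1\<bar> \<le> 1 / 2\<close> invariant. The drift of the controlled
  quantity is of order \<open>l\<^sup>2\<close> and is beaten by the smallest kick, of order \<open>l\<close>, when \<open>l\<close> is small.\<close>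

lemma control_step:
  fixes C l \<epsilon> :: real
  assumes C: "C \<ge> 1" and l: "l > 0" "96 * l * C ^ 8 \<le> 1" and \<epsilon>: "l / 3 \<le> \<epsilon>" "\<epsilon> \<le> 2 * l / 3"
  defines "B \<equiv> 2 * l * C\<^sup>2" 
  assumes p: "1 / C\<^sup>2 \<le> p" "p \<le> C\<^sup>2" and q: "0 \<le> q" "q \<le> C\<^sup>2"
    and x: "\<bar>x - 1\<bar> \<le> 1 / 2" and \<sigma>: "\<bar>y + 2 * B * (x - 1)\<bar> \<le> B"
  defines "s \<equiv> (if y + 2 * B * (x - 1) > 0 then \<epsilon> - l else \<epsilon>)"
  defines "y' \<equiv> y + s * p * x"
  defines "x' \<equiv> x + q * y'"
  shows "\<bar>x' - 1\<bar> \<le> 1 / 2" "\<bar>y' + 2 * B * (x' - 1)\<bar> \<le> B"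
proof -
  \<comment> \<open>the smallest possible size of a kick \<open>s p x\<close>; the largest is \<open>B / 2\<close>\<close>
  define m where "m = l / (6 * C\<^sup>2)"
  define \<tau> where "\<tau> = y + 2 * B * (x - 1)"
  define w where "w = \<tau> + s * p * x"
  have C2: "C\<^sup>2 \<ge> 1" using C by simp
  have B0: "B > 0" using l C by (simp add: B_def)
  have x': "1 / 2 \<le> x" "x \<le> 3 / 2" using x by linarith+
  have "1 / C\<^sup>2 > 0" using C by simp
  then have p0: "p > 0" using p by linarith
  have px: "1 / C\<^sup>2 * (1 / 2) \<le> p * x" "p * x \<le> C\<^sup>2 * (3 / 2)"
    using p x' p0 C by (intro mult_mono; simp)+
  have s: "l / 3 \<le> \<bar>s\<bar>" "\<bar>s\<bar> \<le> 2 * l / 3" using \<epsilon> l by (auto simp: s_def)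
  have "l / 3 * (1 / C\<^sup>2 * (1 / 2)) \<le> \<bar>s\<bar> * (p * x)" by (rule mult_mono) (use s px l in auto)
  then have low: "m \<le> \<bar>s\<bar> * (p * x)" using C by (simp add: m_def field_simps)
  have "\<bar>s\<bar> * (p * x) \<le> 2 * l / 3 * (C\<^sup>2 * (3 / 2))" by (rule mult_mono) (use s px p0 x' l in auto)
  then have high: "\<bar>s\<bar> * (p * x) \<le> B / 2" by (simp add: B_def)
  have mB: "m \<le> B / 2" using low high by linarith
  have w: "\<bar>w\<bar> \<le> B - m"
  proof (cases "\<tau> > 0")
    case True
    then have "s = - \<bar>s\<bar>" using \<epsilon> l by (simp add: s_def \<tau>_def)
    then have "s * p * x = - (\<bar>s\<bar> * (p * x))" by (metis mult.assoc mult_minus_left)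
    then show ?thesis using True \<sigma> low high mB by (auto simp: w_def \<tau>_def[symmetric] abs_le_iff)
  next
    case False
    then have "s = \<bar>s\<bar>" using \<epsilon> l by (simp add: s_def \<tau>_def)
    then have "s * p * x = \<bar>s\<bar> * (p * x)" by (metis mult.assoc)
    then show ?thesis using False \<sigma> low high mB by (auto simp: w_def \<tau>_def[symmetric] abs_le_iff)
  qed
  have m0: "m > 0" using l C by (simp add: m_def)
  have y'w: "y' = w - 2 * B * (x - 1)" by (simp add: y'_def w_def \<tau>_def)
  have "\<bar>2 * B * (x - 1)\<bar> \<le> B" using x B0 by (simp add: abs_mult)
  then have y': "\<bar>y'\<bar> \<le> 2 * B" using w m0 unfolding y'w by linarith
  have qB: "q * B \<le> 1 / 2"
  proof -
    have "q * B \<le> C\<^sup>2 * B" using q B0 by (intro mult_right_mono) auto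
    also have "\<dots> = 2 * l * C ^ 4" by (simp add: B_def power2_eq_square power_eq_if)
    also have "\<dots> \<le> 2 * l * C ^ 8" using C l by (intro mult_left_mono power_increasing) auto
    also have "\<dots> \<le> 1 / 2" using l by linarith
    finally show ?thesis .
  qed
  have "x' - 1 = (1 - 2 * (q * B)) * (x - 1) + q * w"
    by (simp add: x'_def y'w algebra_simps)
  then have "\<bar>x' - 1\<bar> \<le> \<bar>(1 - 2 * (q * B)) * (x - 1)\<bar> + \<bar>q * w\<bar>" by (metis abs_triangle_ineq)
  also have "\<dots> = (1 - 2 * (q * B)) * \<bar>x - 1\<bar> + q * \<bar>w\<bar>" using qB q by (simp add: abs_mult)
  also have "\<dots> \<le> (1 - 2 * (q * B)) * (1 / 2) + q * B"
    using qB q x w m0 by (intro add_mono mult_left_mono) auto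
  also have "(1 - 2 * (q * B)) * (1 / 2) + q * B = 1 / 2" by (simp add: algebra_simps)
  finally show "\<bar>x' - 1\<bar> \<le> 1 / 2" .
  have "\<bar>2 * B * (q * y')\<bar> = 2 * B * q * \<bar>y'\<bar>" using B0 q by (simp add: abs_mult)
  also have "\<dots> \<le> 2 * B * C\<^sup>2 * (2 * B)" using B0 q y' by (intro mult_mono) auto
  also have "\<dots> \<le> m"
  proof -
    have "2 * B * C\<^sup>2 * (2 * B) * (6 * C\<^sup>2) = l * (96 * l * C ^ 8)"
      by (simp add: B_def power2_eq_square power_eq_if)
    also have "\<dots> \<le> l * 1" using l by (intro mult_left_mono) auto
    finally show ?thesis using C by (simp add: m_def field_simps)
  qed
  finally have "\<bar>2 * B * (q * y')\<bar> \<le> m" .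
  moreover have "y' + 2 * B * (x' - 1) = w + 2 * B * (q * y')"
    by (simp add: y'w x'_def algebra_simps)
  ultimately show "\<bar>y' + 2 * B * (x' - 1)\<bar> \<le> B" using w by linarith
qed

text \<open>Dividing a solution \<open>u\<close> by the ground state, \<open>u = P x\<close>, turns the eigenvalue equation into
  \<open>a n (x (n + 1) - x n) - a (n - 1) (x n - x (n - 1)) = (\<epsilon> - \<omega> n) (P n)\<^sup>2 x n\<close> with
  \<open>a n = P n P (n + 1)\<close>. For \<open>0 < \<epsilon> < l\<close> the factor \<open>\<epsilon> - \<omega> n\<close> is positive or negative as \<open>\<omega> n\<close> is
  0 or \<open>l\<close>, so the potential can be chosen site by site, depending on the past, to keep \<open>x\<close> near 1.\<close>

theorem controlled_half_line_solution:
  fixes P V :: "int \<Rightarrow> real"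
  assumes C: "C \<ge> 1" and P: "\<And>n. 1 / C \<le> P n" "\<And>n. P n \<le> C"
    and ground: "\<And>n. P (n + 1) + P (n - 1) + V n * P n = E * P n"
    and l: "l > 0" "96 * l * C ^ 8 \<le> 1" and \<epsilon>: "l / 3 \<le> \<epsilon>" "\<epsilon> \<le> 2 * l / 3"
  obtains \<omega> u :: "int \<Rightarrow> real" where "range \<omega> \<subseteq> {0, l}"
    "\<And>n. n \<ge> 0 \<Longrightarrow> 1 / (2 * C) \<le> u n \<and> u n \<le> 2 * C"
    "\<And>n. n \<ge> 1 \<Longrightarrow> u (n + 1) + u (n - 1) + (V n + \<omega> n) * u n = (E + \<epsilon>) * u n"
proof -
  define B where "B = 2 * l * C\<^sup>2"
  define s where "s z = (if snd z + 2 * B * (fst z - 1) > 0 then \<epsilon> - l else \<epsilon>)" for z :: "real \<times> real"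
  define a where "a n = P n * P (n + 1)" for n
  define step where "step n z = (let y' = snd z + s z * (P (int n))\<^sup>2 * fst z in (fst z + (1 / a (int n)) * y', y'))" for n z
  \<comment> \<open>The state \<open>z n\<close> consists of \<open>x n\<close> and \<open>a (n - 1) (x n - x (n - 1))\<close>; the velocity is zero at the start.\<close>
  define z where "z = rec_nat (1, 0) step"
  have z0: "z 0 = (1, 0)" and zS: "z (Suc n) = step n (z n)" for n by (simp_all add: z_def)
  have P0: "P n > 0" for n using P(1)[of n] C by (metis divide_pos_pos less_le_trans zero_less_one)
  have inv: "\<bar>fst (z n) - 1\<bar> \<le> 1 / 2 \<and> \<bar>snd (z n) + 2 * B * (fst (z n) - 1)\<bar> \<le> B" for n
  proof (induction n)
    case 0
    then show ?case using l by (simp add: z0 B_def)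
  next
    case (Suc n)
    have "(1 / C)\<^sup>2 \<le> (P (int n))\<^sup>2" using P C by (intro power_mono) auto
    moreover have "(P (int n))\<^sup>2 \<le> C\<^sup>2" using P P0[of "int n"] by (intro power_mono) auto
    moreover have "1 / a (int n) \<le> C\<^sup>2"
    proof -
      have "(1 / C) * (1 / C) \<le> a (int n)" unfolding a_def using P C P0[of "int n"] by (intro mult_mono) auto
      then have "1 / a (int n) \<le> 1 / ((1 / C) * (1 / C))" using C by (intro divide_left_mono) (auto intro!: mult_pos_pos simp: a_def P0)
      then show ?thesis by (simp add: power2_eq_square)
    qed
    ultimately show ?case
      using control_step[OF C l \<epsilon>, of "(P (int n))\<^sup>2" "1 / a (int n)" "fst (z n)" "snd (z n)"] Suc
      by (simp add: zS step_def Let_def s_def B_def power_divide a_def P0 less_imp_le)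
  qed
  define \<omega> where "\<omega> n = \<epsilon> - s (z (nat n))" for n
  define u where "u n = P n * fst (z (nat n))" for n
  have 1: "range \<omega> \<subseteq> {0, l}" by (auto simp: \<omega>_def s_def)
  have 2: "1 / (2 * C) \<le> u n \<and> u n \<le> 2 * C" for n
  proof -
    have x: "1 / 2 \<le> fst (z (nat n))" "fst (z (nat n)) \<le> 2"
      using conjunct1[OF inv[of "nat n"]] by linarith+
    have "1 / C * (1 / 2) \<le> u n" unfolding u_def using x P P0[of n] C by (intro mult_mono) (auto simp: less_imp_le)
    moreover have "u n \<le> C * 2" unfolding u_def using x P P0[of n] C by (intro mult_mono) (auto simp: less_imp_le)
    ultimately show ?thesis by (simp add: mult.commute)
  qed
  have 3: "u (n + 1) + u (n - 1) + (V n + \<omega> n) * u n = (E + \<epsilon>) * u n" if "n \<ge> 1" for n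
  proof -
    define k where "k = nat (n - 1)"
    have n: "n = int (Suc k)" using that by (simp add: k_def)
    have xy: "a (int k) * (fst (z (Suc k)) - fst (z k)) = snd (z (Suc k))" for k
      using P0[of "int k"] P0[of "int k + 1"] by (simp add: zS step_def Let_def a_def)
    have y: "snd (z (Suc (Suc k))) = snd (z (Suc k)) + s (z (Suc k)) * (P n)\<^sup>2 * fst (z (Suc k))"
      unfolding n zS[of "Suc k"] by (simp add: step_def Let_def)
    have 1: "P n * P (n + 1) * (fst (z (Suc (Suc k))) - fst (z (Suc k))) - P (n - 1) * P n * (fst (z (Suc k)) - fst (z k)) 
      = s (z (Suc k)) * (P n)\<^sup>2 * fst (z (Suc k))"
      using xy[of "Suc k"] xy[of k] y unfolding a_def n by (simp add: add_ac)
    have u: "u n = P n * fst (z (Suc k))" "u (n + 1) = P (n + 1) * fst (z (Suc (Suc k)))" "u (n - 1) = P (n - 1) * fst (z k)"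
      "\<omega> n = \<epsilon> - s (z (Suc k))"
      unfolding u_def \<omega>_def n by (simp_all add: nat_add_distrib)
    have g: "(V n - E) * P n = - P (n + 1) - P (n - 1)" using ground[of n] by (simp add: algebra_simps)
    have "P n * (u (n + 1) + u (n - 1) + (V n + \<omega> n) * u n - (E + \<epsilon>) * u n)
      = P n * P (n + 1) * fst (z (Suc (Suc k))) + P (n - 1) * P n * fst (z k) 
         + ((V n - E) * P n) * (P n * fst (z (Suc k))) - s (z (Suc k)) * (P n)\<^sup>2 * fst (z (Suc k))"
      unfolding u by (simp add: algebra_simps power2_eq_square)
    also have "\<dots> = 0" unfolding g 1[symmetric] by (simp add: algebra_simps)
    finally show ?thesis using P0[of n] by simp
  qed
  show ?thesis using that[OF 1] 2 3 by blast
qed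

section \<open>Jacobi operators on the square-summable sequences\<close>

text \<open>Complex potentials are allowed so that \<open>H - z\<close> is again of this form.\<close>

definition jacobi :: "(int \<Rightarrow> complex) \<Rightarrow> (int \<Rightarrow> complex) \<Rightarrow> int \<Rightarrow> complex" where
  "jacobi v \<psi> n = \<psi> (n + 1) + \<psi> (n - 1) + v n * \<psi> n"

definition sqnorm :: "(int \<Rightarrow> complex) \<Rightarrow> real" where
  "sqnorm \<psi> = (\<Sum>\<^sub>\<infinity>n. (cmod (\<psi> n))\<^sup>2)"

lemma sqnorm_nonneg: "sqnorm \<psi> \<ge> 0"
  unfolding sqnorm_def by (rule infsum_nonneg) auto

lemma ell2_norm_eq: "ell2_norm \<psi> = sqrt (sqnorm \<psi>)"
  by (simp add: ell2_norm_def sqnorm_def)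

lemma ell2_has_sum: "\<psi> \<in> ell2 \<Longrightarrow> ((\<lambda>n. (cmod (\<psi> n))\<^sup>2) has_sum sqnorm \<psi>) UNIV"
  unfolding ell2_def sqnorm_def by (simp add: has_sum_infsum)

lemma ell2_comparison:
  assumes "((\<lambda>n. g n) has_sum S) UNIV" and "\<And>n. (cmod (\<psi> n))\<^sup>2 \<le> g n"
  shows "\<psi> \<in> ell2" "sqnorm \<psi> \<le> S"
proof -
  show 1: "\<psi> \<in> ell2" unfolding ell2_def
    by (auto intro!: summable_on_comparison_test[OF has_sum_imp_summable[OF assms(1)]] assms(2))
  show "sqnorm \<psi> \<le> S" using has_sum_mono[OF ell2_has_sum[OF 1] assms(1)] assms(2) by blast
qed

lemma has_sum_shift:
  "((\<lambda>n::int. f (n + k)) has_sum S) UNIV \<longleftrightarrow> (f has_sum S) UNIV"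
  by (rule has_sum_reindex_bij_betw) (auto intro!: bij_betwI[where g="\<lambda>n. n - k"])

lemma ell2_shift_has_sum: "\<psi> \<in> ell2 \<Longrightarrow> ((\<lambda>n. (cmod (\<psi> (n + k)))\<^sup>2) has_sum sqnorm \<psi>) UNIV"
  using has_sum_shift[of "\<lambda>n. (cmod (\<psi> n))\<^sup>2" k] ell2_has_sum by blast

lemma cmod_add3_le: "(cmod (a + b + c))\<^sup>2 \<le> 3 * (cmod a)\<^sup>2 + 3 * (cmod b)\<^sup>2 + 3 * (cmod c)\<^sup>2"
proof -
  have "(cmod (a + b + c))\<^sup>2 \<le> (cmod a + cmod b + cmod c)\<^sup>2"
    by (intro power_mono) (auto intro: order.trans[OF norm_triangle_ineq] add_mono norm_triangle_ineq)
  also have "\<dots> \<le> 3 * (cmod a)\<^sup>2 + 3 * (cmod b)\<^sup>2 + 3 * (cmod c)\<^sup>2"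
    using zero_le_power2[of "cmod a - cmod b"] zero_le_power2[of "cmod a - cmod c"] zero_le_power2[of "cmod b - cmod c"]
    by (simp add: power2_eq_square algebra_simps)
  finally show ?thesis .
qed

lemma jacobi_ell2:
  assumes \<psi>: "\<psi> \<in> ell2" and v: "\<And>n. cmod (v n) \<le> K"
  shows "jacobi v \<psi> \<in> ell2" "sqnorm (jacobi v \<psi>) \<le> (6 + 3 * K\<^sup>2) * sqnorm \<psi>"
proof -
  have K: "K \<ge> 0" using order.trans[OF norm_ge_zero v] .
  have b: "(cmod (jacobi v \<psi> n))\<^sup>2 \<le> 3 * (cmod (\<psi> (n + 1)))\<^sup>2 + 3 * (cmod (\<psi> (n + - 1)))\<^sup>2 + 3 * K\<^sup>2 * (cmod (\<psi> n))\<^sup>2" for n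
  proof -
    have "(cmod (v n * \<psi> n))\<^sup>2 \<le> K\<^sup>2 * (cmod (\<psi> n))\<^sup>2"
      unfolding norm_mult power_mult_distrib using v by (intro mult_right_mono power_mono) auto
    then show ?thesis using cmod_add3_le[of "\<psi> (n + 1)" "\<psi> (n - 1)" "v n * \<psi> n"] by (simp add: jacobi_def)
  qed
  have s: "((\<lambda>n. 3 * (cmod (\<psi> (n + 1)))\<^sup>2 + 3 * (cmod (\<psi> (n + - 1)))\<^sup>2 + 3 * K\<^sup>2 * (cmod (\<psi> n))\<^sup>2) has_sum
     3 * sqnorm \<psi> + 3 * sqnorm \<psi> + 3 * K\<^sup>2 * sqnorm \<psi>) UNIV"
    by (intro has_sum_add has_sum_cmult_right ell2_shift_has_sum ell2_has_sum \<psi>)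
  show "jacobi v \<psi> \<in> ell2" by (rule ell2_comparison(1)[OF s b])
  have "sqnorm (jacobi v \<psi>) \<le> 3 * sqnorm \<psi> + 3 * sqnorm \<psi> + 3 * K\<^sup>2 * sqnorm \<psi>" by (rule ell2_comparison(2)[OF s b])
  then show "sqnorm (jacobi v \<psi>) \<le> (6 + 3 * K\<^sup>2) * sqnorm \<psi>" by (simp add: algebra_simps)
qed

lemma cmod_diff_sq: "(cmod (a - b))\<^sup>2 = (cmod a)\<^sup>2 - 2 * Re (a * cnj b) + (cmod b)\<^sup>2"
  by (simp only: cmod_power2) (simp add: power2_eq_square algebra_simps)

lemma ell2_product_summable:
  assumes "\<psi> \<in> ell2" "\<phi> \<in> ell2"
  shows "(\<lambda>n. \<psi> (n + j) * cnj (\<phi> (n + k))) summable_on UNIV"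
proof (rule abs_summable_summable, rule summable_on_comparison_test)
  have prod_le: "a * b \<le> a\<^sup>2 + b\<^sup>2" if "a \<ge> 0" "b \<ge> 0" for a b :: real
  proof -
    have "2 * (a * b) \<le> a\<^sup>2 + b\<^sup>2" using sum_squares_bound[of a b] by (simp add: mult.assoc)
    moreover have "a * b \<ge> 0" using that by simp
    ultimately show ?thesis by linarith
  qed
  show "(\<lambda>n. (cmod (\<psi> (n + j)))\<^sup>2 + (cmod (\<phi> (n + k)))\<^sup>2) summable_on UNIV"
    by (intro summable_on_add has_sum_imp_summable[OF ell2_shift_has_sum] assms)
  show "cmod (\<psi> (n + j) * cnj (\<phi> (n + k))) \<le> (cmod (\<psi> (n + j)))\<^sup>2 + (cmod (\<phi> (n + k)))\<^sup>2" for n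
    using prod_le[of "cmod (\<psi> (n + j))" "cmod (\<phi> (n + k))"] by (simp add: norm_mult)
qed auto

text \<open>Summation by parts: the adjoint has the conjugate potential.\<close>

lemma jacobi_adjoint:
  assumes \<psi>: "\<psi> \<in> ell2" and \<phi>: "\<phi> \<in> ell2" and v: "\<And>n. cmod (v n) \<le> K"
  shows "\<exists>S. ((\<lambda>n. \<psi> n * cnj (jacobi v \<phi> n)) has_sum S) UNIV \<and> ((\<lambda>n. jacobi (\<lambda>n. cnj (v n)) \<psi> n * cnj (\<phi> n)) has_sum S) UNIV"
proof -
  have v\<psi>: "(\<lambda>n. cnj (v n) * \<psi> n) \<in> ell2"
  proof (rule ell2_comparison(1)[OF has_sum_cmult_right[OF ell2_has_sum[OF \<psi>], of "K\<^sup>2"]])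
    show "(cmod (cnj (v n) * \<psi> n))\<^sup>2 \<le> K\<^sup>2 * (cmod (\<psi> n))\<^sup>2" for n
      unfolding norm_mult power_mult_distrib using v by (intro mult_right_mono power_mono) auto
  qed
  define A where "A = infsum (\<lambda>n. \<psi> n * cnj (\<phi> (n + 1))) UNIV"
  define B where "B = infsum (\<lambda>n. \<psi> n * cnj (\<phi> (n - 1))) UNIV"
  define D where "D = infsum (\<lambda>n. cnj (v n) * \<psi> n * cnj (\<phi> n)) UNIV"
  have A: "((\<lambda>n. \<psi> n * cnj (\<phi> (n + 1))) has_sum A) UNIV"
    using ell2_product_summable[OF \<psi> \<phi>, of 0 1] unfolding A_def by (simp add: has_sum_infsum)
  have B: "((\<lambda>n. \<psi> n * cnj (\<phi> (n - 1))) has_sum B) UNIV"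
    using ell2_product_summable[OF \<psi> \<phi>, of 0 "-1"] unfolding B_def by (simp add: has_sum_infsum)
  have D: "((\<lambda>n. cnj (v n) * \<psi> n * cnj (\<phi> n)) has_sum D) UNIV"
    using ell2_product_summable[OF v\<psi> \<phi>, of 0 0] unfolding D_def by (simp add: has_sum_infsum)
  have A': "((\<lambda>n. \<psi> (n - 1) * cnj (\<phi> n)) has_sum A) UNIV"
    using has_sum_shift[of "\<lambda>n. \<psi> n * cnj (\<phi> (n + 1))" "-1"] A by simp
  have B': "((\<lambda>n. \<psi> (n + 1) * cnj (\<phi> n)) has_sum B) UNIV"
    using has_sum_shift[of "\<lambda>n. \<psi> n * cnj (\<phi> (n - 1))" 1] B by simp
  have "((\<lambda>n. \<psi> n * cnj (\<phi> (n + 1)) + \<psi> n * cnj (\<phi> (n - 1)) + cnj (v n) * \<psi> n * cnj (\<phi> n)) has_sum A + B + D) UNIV"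
    by (intro has_sum_add A B D)
  moreover have "((\<lambda>n. \<psi> (n - 1) * cnj (\<phi> n) + \<psi> (n + 1) * cnj (\<phi> n) + cnj (v n) * \<psi> n * cnj (\<phi> n)) has_sum A + B + D) UNIV"
    by (intro has_sum_add A' B' D)
  ultimately show ?thesis by (intro exI[of _ "A + B + D"]) (simp add: jacobi_def algebra_simps)
qed

lemma jacobi_linear:
  "jacobi v (\<lambda>n. a * \<psi> n + b * \<phi> n) n = a * jacobi v \<psi> n + b * jacobi v \<phi> n"
  by (simp add: jacobi_def algebra_simps)

text \<open>The map \<open>1 - s T* T\<close> is a contraction when \<open>T\<close> is bounded below: expanding the square, the cross term
  is \<open>- 2 s \<parallel>T \<psi>\<parallel>\<^sup>2\<close> and the last term at most \<open>s \<parallel>T \<psi>\<parallel>\<^sup>2\<close>, because \<open>1 / s\<close> bounds the squared norm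
  of \<open>T*\<close>.\<close>

lemma normal_equation_contraction:
  fixes K :: real
  assumes v: "\<And>n. cmod (v n) \<le> K" and \<psi>: "\<psi> \<in> ell2"
    and low: "\<delta> * sqnorm \<psi> \<le> sqnorm (jacobi v \<psi>)"
  defines "s \<equiv> 1 / (6 + 3 * K\<^sup>2)"
  defines "\<xi> \<equiv> (\<lambda>n. \<psi> n - complex_of_real s * jacobi (\<lambda>n. cnj (v n)) (jacobi v \<psi>) n)"
  shows "\<xi> \<in> ell2" "sqnorm \<xi> \<le> (1 - s * \<delta>) * sqnorm \<psi>"
proof -
  have M: "6 + 3 * K\<^sup>2 > 0" by (simp add: add_pos_nonneg)
  then have s: "s > 0" by (simp add: s_def)
  note T = jacobi_ell2[where v=v, OF \<psi> v]
  have v': "cmod (cnj (v n)) \<le> K" for n using v by simp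
  define g where "g = jacobi (\<lambda>n. cnj (v n)) (jacobi v \<psi>)"
  have g: "g \<in> ell2" "sqnorm g \<le> (6 + 3 * K\<^sup>2) * sqnorm (jacobi v \<psi>)"
    unfolding g_def using jacobi_ell2[where v="\<lambda>n. cnj (v n)", OF T(1) v'] by auto
  obtain S where S: "((\<lambda>n. \<psi> n * cnj (g n)) has_sum S) UNIV" 
    "((\<lambda>n. jacobi v \<psi> n * cnj (jacobi v \<psi> n)) has_sum S) UNIV"
    using jacobi_adjoint[where v="\<lambda>n. cnj (v n)", OF \<psi> T(1) v'] unfolding g_def by auto
  have "((\<lambda>n. Re (jacobi v \<psi> n * cnj (jacobi v \<psi> n))) has_sum Re S) UNIV" by (rule has_sum_Re[OF S(2)])
  moreover have "((\<lambda>n. (cmod (jacobi v \<psi> n))\<^sup>2) has_sum sqnorm (jacobi v \<psi>)) UNIV" by (rule ell2_has_sum[OF T(1)])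
  moreover have "Re (z * cnj z) = (cmod z)\<^sup>2" for z by (simp add: complex_mult_cnj cmod_power2)
  ultimately have ReS: "Re S = sqnorm (jacobi v \<psi>)" using has_sum_unique by fastforce
  have eq: "(cmod (\<xi> n))\<^sup>2 = (cmod (\<psi> n))\<^sup>2 - 2 * s * Re (\<psi> n * cnj (g n)) + s\<^sup>2 * (cmod (g n))\<^sup>2" for n
    unfolding \<xi>_def g_def[symmetric] cmod_diff_sq using s
    by (simp add: norm_mult power_mult_distrib algebra_simps)
  have "((\<lambda>n. (cmod (\<psi> n))\<^sup>2 + (- (2 * s)) * Re (\<psi> n * cnj (g n)) + s\<^sup>2 * (cmod (g n))\<^sup>2) has_sum
      sqnorm \<psi> + (- (2 * s)) * Re S + s\<^sup>2 * sqnorm g) UNIV"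
    by (intro has_sum_add has_sum_cmult_right ell2_has_sum has_sum_Re S g \<psi>)
  then have h: "((\<lambda>n. (cmod (\<xi> n))\<^sup>2) has_sum sqnorm \<psi> - 2 * s * sqnorm (jacobi v \<psi>) + s\<^sup>2 * sqnorm g) UNIV"
    unfolding eq ReS by simp
  then show "\<xi> \<in> ell2" by (rule ell2_comparison) simp
  have "sqnorm \<xi> = sqnorm \<psi> - 2 * s * sqnorm (jacobi v \<psi>) + s\<^sup>2 * sqnorm g"
    using ell2_has_sum[OF \<open>\<xi> \<in> ell2\<close>] h has_sum_unique by blast
  also have "s\<^sup>2 * sqnorm g \<le> s\<^sup>2 * ((6 + 3 * K\<^sup>2) * sqnorm (jacobi v \<psi>))"
    using g(2) by (rule mult_left_mono) auto
  also have "s\<^sup>2 * ((6 + 3 * K\<^sup>2) * sqnorm (jacobi v \<psi>)) = s * sqnorm (jacobi v \<psi>)"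
    using M by (simp add: s_def power2_eq_square)
  finally have "sqnorm \<xi> \<le> sqnorm \<psi> - s * sqnorm (jacobi v \<psi>)" by simp
  also have "\<dots> \<le> sqnorm \<psi> - s * (\<delta> * sqnorm \<psi>)" using low s by simp
  finally show "sqnorm \<xi> \<le> (1 - s * \<delta>) * sqnorm \<psi>" by (simp add: algebra_simps)
qed

lemma sqnorm_eq_0D: "\<psi> \<in> ell2 \<Longrightarrow> sqnorm \<psi> = 0 \<Longrightarrow> \<psi> n = 0"
  using nonneg_has_sum_le_0D[OF ell2_has_sum[of \<psi>], of n] by auto

lemma cmod_le_sqnorm: "\<psi> \<in> ell2 \<Longrightarrow> (cmod (\<psi> n))\<^sup>2 \<le> sqnorm \<psi>"
  using finite_sum_le_has_sum[OF ell2_has_sum, of \<psi> "{n}"] by auto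

lemma L2_set_le_sqnorm: "\<psi> \<in> ell2 \<Longrightarrow> finite F \<Longrightarrow> L2_set (\<lambda>n. cmod (\<psi> n)) F \<le> sqrt (sqnorm \<psi>)"
  unfolding L2_set_def by (intro real_sqrt_le_mono finite_sum_le_has_sum[OF ell2_has_sum]) auto

text \<open>Minkowski's inequality on finite sets of sites; the limit is only taken pointwise.\<close>

lemma ell2_series:
  assumes r: "\<And>k. r k \<in> ell2" and b: "\<And>k. sqrt (sqnorm (r k)) \<le> b k" and s: "summable b"
  shows "summable (\<lambda>k. r k n)" "(\<lambda>n. \<Sum>k. r k n) \<in> ell2"
proof -
  have b0: "b k \<ge> 0" for k using b[of k] sqnorm_nonneg[of "r k"] by (meson order.trans real_sqrt_ge_zero)
  have s1: "summable (\<lambda>k. r k n)" for n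
  proof (rule summable_comparison_test'[OF s, where N=0])
    show "norm (r k n) \<le> b k" for k
      using cmod_le_sqnorm[OF r, of k n] b[of k] real_le_rsqrt order.trans by blast
  qed
  then show "summable (\<lambda>k. r k n)" .
  have "(\<Sum>n\<in>F. (cmod (\<Sum>k. r k n))\<^sup>2) \<le> (suminf b)\<^sup>2" if F: "finite F" for F
  proof (rule Lim_bounded)
    show "(\<lambda>N. \<Sum>n\<in>F. (cmod (\<Sum>k<N. r k n))\<^sup>2) \<longlonglongrightarrow> (\<Sum>n\<in>F. (cmod (\<Sum>k. r k n))\<^sup>2)"
      by (intro tendsto_intros summable_LIMSEQ s1)
    have "L2_set (\<lambda>n. cmod (\<Sum>k<N. r k n)) F \<le> (\<Sum>k<N. b k)" for N
    proof (induction N)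
      case 0
      then show ?case by (simp add: L2_set_def)
    next
      case (Suc N)
      have "L2_set (\<lambda>n. cmod (\<Sum>k<Suc N. r k n)) F \<le> L2_set (\<lambda>n. cmod (\<Sum>k<N. r k n) + cmod (r N n)) F"
        by (intro L2_set_mono) (auto intro: norm_triangle_ineq)
      also have "\<dots> \<le> L2_set (\<lambda>n. cmod (\<Sum>k<N. r k n)) F + L2_set (\<lambda>n. cmod (r N n)) F"
        by (rule L2_set_triangle_ineq)
      also have "L2_set (\<lambda>n. cmod (r N n)) F \<le> b N" using L2_set_le_sqnorm[OF r F, of N] b[of N] by linarith
      finally show ?case using Suc by simp
    qed
    also have "(\<Sum>k<N. b k) \<le> suminf b" for N using s b0 by (intro sum_le_suminf) auto
    finally have "(L2_set (\<lambda>n. cmod (\<Sum>k<N. r k n)) F)\<^sup>2 \<le> (suminf b)\<^sup>2" for N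
      by (intro power_mono L2_set_nonneg)
    then show "\<forall>N\<ge>0. (\<Sum>n\<in>F. (cmod (\<Sum>k<N. r k n))\<^sup>2) \<le> (suminf b)\<^sup>2"
      by (simp add: L2_set_def sum_nonneg)
  qed
  then have "(\<lambda>n. (cmod (\<Sum>k. r k n))\<^sup>2) summable_on UNIV"
    by (intro nonneg_bdd_above_summable_on bdd_aboveI2[where M="(suminf b)\<^sup>2"]) auto
  then show "(\<lambda>n. \<Sum>k. r k n) \<in> ell2" by (simp add: ell2_def)
qed

text \<open>The normal equation \<open>T* T \<psi> = T* \<phi>\<close> is solved by summing the residuals of the contraction
  \<open>1 - s T* T\<close>. As the operators involve neighbouring sites only, the equation passes to the
  pointwise limit, and injectivity of \<open>T*\<close> then gives \<open>T \<psi> = \<phi>\<close>.\<close>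

lemma jacobi_surj:
  assumes v: "\<And>n. cmod (v n) \<le> K" and \<delta>: "\<delta> > 0"
    and low: "\<And>\<psi>. \<psi> \<in> ell2 \<Longrightarrow> \<delta> * sqnorm \<psi> \<le> sqnorm (jacobi v \<psi>)"
    and low': "\<And>\<psi>. \<psi> \<in> ell2 \<Longrightarrow> \<delta> * sqnorm \<psi> \<le> sqnorm (jacobi (\<lambda>n. cnj (v n)) \<psi>)"
    and \<phi>: "\<phi> \<in> ell2"
  shows "\<exists>\<psi>\<in>ell2. jacobi v \<psi> = \<phi>"
proof -
  define s where "s = 1 / (6 + 3 * K\<^sup>2)"
  have M: "6 + 3 * K\<^sup>2 > 0" by (simp add: add_pos_nonneg)
  then have s: "s > 0" by (simp add: s_def)
  have v': "cmod (cnj (v n)) \<le> K" for n using v by simp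
  let ?T = "jacobi v" and ?T' = "jacobi (\<lambda>n. cnj (v n))"
  define R where "R \<psi> = (\<lambda>n. \<psi> n - complex_of_real s * ?T' (?T \<psi>) n)" for \<psi>
  define r where "r k = (R ^^ k) (?T' \<phi>)" for k
  define q where "q = max 0 (1 - s * \<delta>)"
  have q: "0 \<le> q" "q < 1" using s \<delta> by (auto simp: q_def)
  have r: "r k \<in> ell2 \<and> sqnorm (r k) \<le> q ^ k * sqnorm (?T' \<phi>)" for k
  proof (induction k)
    case 0
    then show ?case using jacobi_ell2[OF \<phi> v'] by (simp add: r_def)
  next
    case (Suc k)
    have c: "R (r k) \<in> ell2" "sqnorm (R (r k)) \<le> (1 - s * \<delta>) * sqnorm (r k)"
      using normal_equation_contraction[OF v _ low, of "r k"] Suc unfolding R_def s_def by auto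
    note c(2)
    also have "(1 - s * \<delta>) * sqnorm (r k) \<le> q * (q ^ k * sqnorm (?T' \<phi>))"
      using Suc q by (intro mult_mono) (auto simp: q_def sqnorm_nonneg)
    finally show ?case using c(1) by (simp add: r_def mult.assoc)
  qed
  define \<rho> where "\<rho> k = (\<lambda>n. complex_of_real s * r k n)" for k
  have \<rho>: "\<rho> k \<in> ell2 \<and> sqrt (sqnorm (\<rho> k)) \<le> s * (sqrt q ^ k * sqrt (sqnorm (?T' \<phi>)))" for k
  proof -
    have h: "((\<lambda>n. s\<^sup>2 * (cmod (r k n))\<^sup>2) has_sum s\<^sup>2 * sqnorm (r k)) UNIV"
      using r by (intro has_sum_cmult_right ell2_has_sum) auto
    have c: "\<rho> k \<in> ell2" "sqnorm (\<rho> k) \<le> s\<^sup>2 * sqnorm (r k)"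
      by (rule ell2_comparison[OF h]; simp add: \<rho>_def norm_mult power_mult_distrib)+
    note c(2)
    also have "s\<^sup>2 * sqnorm (r k) \<le> s\<^sup>2 * (q ^ k * sqnorm (?T' \<phi>))" using r by (intro mult_left_mono) auto
    finally have "sqrt (sqnorm (\<rho> k)) \<le> sqrt (s\<^sup>2 * (q ^ k * sqnorm (?T' \<phi>)))" by (rule real_sqrt_le_mono)
    then show ?thesis using c(1) s by (simp add: real_sqrt_mult real_sqrt_power)
  qed
  have "summable (\<lambda>k. s * (sqrt q ^ k * sqrt (sqnorm (?T' \<phi>))))"
    using q by (intro summable_mult summable_mult2 summable_geometric) auto
  note ser = ell2_series[of \<rho>, OF conjunct1[OF \<rho>] conjunct2[OF \<rho>] this]
  define \<psi> where "\<psi> n = (\<Sum>k. \<rho> k n)" for n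
  have \<psi>: "\<psi> \<in> ell2" unfolding \<psi>_def by (rule ser(2))
  have part: "?T' (?T (\<lambda>n. \<Sum>k<N. \<rho> k n)) n = ?T' \<phi> n - r N n" for N n
  proof (induction N arbitrary: n)
    case 0
    then show ?case by (simp add: r_def jacobi_def)
  next
    case (Suc N)
    have "?T' (?T (\<lambda>n. \<Sum>k<Suc N. \<rho> k n)) n = ?T' (?T (\<lambda>n. \<Sum>k<N. \<rho> k n)) n + ?T' (?T (\<rho> N)) n"
      by (simp add: jacobi_def algebra_simps)
    also have "?T' (?T (\<rho> N)) n = complex_of_real s * ?T' (?T (r N)) n"
      by (simp add: jacobi_def \<rho>_def algebra_simps)
    also have "\<dots> = r N n - r (Suc N) n" by (simp add: r_def R_def)
    finally show ?case using Suc by simp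
  qed
  have "?T' (?T \<psi>) n = ?T' \<phi> n" for n
  proof (rule LIMSEQ_unique)
    show "(\<lambda>N. ?T' (?T (\<lambda>n. \<Sum>k<N. \<rho> k n)) n) \<longlonglongrightarrow> ?T' (?T \<psi>) n"
      unfolding jacobi_def \<psi>_def by (intro tendsto_intros summable_LIMSEQ ser(1))
    have "(\<lambda>k. \<rho> k n) \<longlonglongrightarrow> 0" by (rule summable_LIMSEQ_zero[OF ser(1)])
    then have "(\<lambda>k. \<rho> k n / complex_of_real s) \<longlonglongrightarrow> 0 / complex_of_real s" using s by (intro tendsto_intros) auto
    then have "(\<lambda>k. r k n) \<longlonglongrightarrow> 0" using s by (simp add: \<rho>_def)
    then have "(\<lambda>N. ?T' \<phi> n - r N n) \<longlonglongrightarrow> ?T' \<phi> n - 0" by (intro tendsto_intros)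
    then show "(\<lambda>N. ?T' (?T (\<lambda>n. \<Sum>k<N. \<rho> k n)) n) \<longlonglongrightarrow> ?T' \<phi> n" unfolding part by simp
  qed
  then have zero: "?T' (\<lambda>n. ?T \<psi> n - \<phi> n) n = 0" for n
    using jacobi_linear[of "\<lambda>n. cnj (v n)" 1 "?T \<psi>" "- 1" \<phi> n] by simp
  define d where "d n = ?T \<psi> n - \<phi> n" for n
  have dl: "d \<in> ell2"
  proof (rule ell2_comparison(1)[OF has_sum_add[OF has_sum_cmult_right[OF ell2_has_sum[OF jacobi_ell2(1)[OF \<psi> v]], of 3] has_sum_cmult_right[OF ell2_has_sum[OF \<phi>], of 3]]])
    show "(cmod (d n))\<^sup>2 \<le> 3 * (cmod (jacobi v \<psi> n))\<^sup>2 + 3 * (cmod (\<phi> n))\<^sup>2" for n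
      using cmod_add3_le[of "jacobi v \<psi> n" "- \<phi> n" 0] by (simp add: d_def)
  qed
  have "\<delta> * sqnorm d \<le> sqnorm (?T' d)" by (rule low'[OF dl])
  also have "?T' d = (\<lambda>n. 0)" using zero unfolding d_def by blast
  also have "sqnorm (\<lambda>n. 0) = 0" by (simp add: sqnorm_def)
  finally have "sqnorm d = 0" using \<delta> sqnorm_nonneg[of d] by (simp add: mult_le_0_iff)
  then have "d n = 0" for n using sqnorm_eq_0D[OF dl] by simp
  then show ?thesis using \<psi> by (intro bexI[of _ \<psi>]) (auto simp: d_def)
qed

section \<open>Finitely supported quasimodes and the spectrum\<close>

text \<open>An approximate eigenfunction with squared relative error less than \<open>\<delta>\<close>. Finite support makes the
  notion local, so that it can be transplanted from one potential to another.\<close>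

definition quasimode :: "(int \<Rightarrow> real) \<Rightarrow> real \<Rightarrow> real \<Rightarrow> bool" where
  "quasimode V E \<delta> \<longleftrightarrow> (\<exists>\<psi>. finite {n. \<psi> n \<noteq> 0} \<and>
     sqnorm (jacobi (\<lambda>n. complex_of_real (V n - E)) \<psi>) < \<delta> * sqnorm \<psi>)"

lemma finite_support_sqnorm:
  assumes "finite A" "\<And>n. n \<notin> A \<Longrightarrow> \<psi> n = 0"
  shows "\<psi> \<in> ell2" "sqnorm \<psi> = (\<Sum>n\<in>A. (cmod (\<psi> n))\<^sup>2)"
proof -
  have h: "((\<lambda>n. (cmod (\<psi> n))\<^sup>2) has_sum (\<Sum>n\<in>A. (cmod (\<psi> n))\<^sup>2)) UNIV"
    by (rule has_sum_finite_neutralI[OF assms(1)]) (use assms(2) in auto)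
  then show "\<psi> \<in> ell2" by (auto simp: ell2_def has_sum_imp_summable)
  show "sqnorm \<psi> = (\<Sum>n\<in>A. (cmod (\<psi> n))\<^sup>2)" unfolding sqnorm_def using h by (rule infsumI)
qed

lemma sqnorm_le_off_finite:
  assumes \<phi>: "\<phi> \<in> ell2" and A: "finite A" and c: "c \<ge> 0"
    and "\<And>n. n \<in> A \<Longrightarrow> (cmod (\<psi> n))\<^sup>2 \<le> c" "\<And>n. n \<notin> A \<Longrightarrow> (cmod (\<psi> n))\<^sup>2 \<le> (cmod (\<phi> n))\<^sup>2"
  shows "sqnorm \<psi> \<le> sqnorm \<phi> + real (card A) * c"
proof (rule ell2_comparison(2))
  have "((\<lambda>n. if n \<in> A then c else 0) has_sum real (card A) * c) UNIV"
    by (rule has_sum_finite_neutralI[OF A]) auto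
  then show "((\<lambda>n. (cmod (\<phi> n))\<^sup>2 + (if n \<in> A then c else 0)) has_sum sqnorm \<phi> + real (card A) * c) UNIV"
    by (intro has_sum_add ell2_has_sum \<phi>)
  show "(cmod (\<psi> n))\<^sup>2 \<le> (cmod (\<phi> n))\<^sup>2 + (if n \<in> A then c else 0)" for n
    using assms(4,5)[of n] c by (cases "n \<in> A") (auto intro: order.trans)
qed

lemma jacobi_pointwise_bound:
  assumes "cmod (v n) \<le> K" "(cmod (\<psi> (n + 1)))\<^sup>2 \<le> \<epsilon>" "(cmod (\<psi> (n - 1)))\<^sup>2 \<le> \<epsilon>" "(cmod (\<psi> n))\<^sup>2 \<le> \<epsilon>"
  shows "(cmod (jacobi v \<psi> n))\<^sup>2 \<le> (6 + 3 * K\<^sup>2) * \<epsilon>"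
proof -
  have "(cmod (v n * \<psi> n))\<^sup>2 \<le> K\<^sup>2 * \<epsilon>"
    unfolding norm_mult power_mult_distrib using assms by (intro mult_mono power_mono) auto
  then show ?thesis
    using cmod_add3_le[of "\<psi> (n + 1)" "\<psi> (n - 1)" "v n * \<psi> n"] assms(2,3) by (simp add: jacobi_def algebra_simps)
qed

text \<open>Cutting off far out changes the two norms by as little as desired: the cut function differs from
  the original by a small tail, and its image acquires errors at the four sites next to the cuts
  only, where the function is small.\<close>

lemma ell2_quasimode:
  assumes V: "\<And>n. \<bar>V n - E\<bar> \<le> K" and \<psi>: "\<psi> \<in> ell2" and \<delta>: "\<delta> > 0"
    and lt: "sqnorm (jacobi (\<lambda>n. complex_of_real (V n - E)) \<psi>) < \<delta> * sqnorm \<psi>"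
  shows "quasimode V E \<delta>"
proof -
  define v where "v = (\<lambda>n. complex_of_real (V n - E))"
  have v: "cmod (v n) \<le> K" for n unfolding v_def norm_of_real by (rule V)
  define A where "A = sqnorm (jacobi v \<psi>)"
  define X where "X = sqnorm \<psi>"
  define M where "M = 4 * (6 + 3 * K\<^sup>2)"
  have M: "M > 0" by (simp add: M_def add_pos_nonneg)
  \<comment> \<open>The cut changes the two norms by at most \<open>M \<epsilon>\<close> and \<open>\<epsilon>\<close>; the strict inequality leaves room for this.\<close>
  define \<epsilon> where "\<epsilon> = (\<delta> * X - A) / (2 * (M + \<delta>))"
  have AX: "A < \<delta> * X" using lt by (simp only: A_def X_def v_def)
  then have \<epsilon>: "\<epsilon> > 0" using M \<delta> by (simp add: \<epsilon>_def)
  have h: "((\<lambda>n. (cmod (\<psi> n))\<^sup>2) has_sum X) UNIV" unfolding X_def by (rule ell2_has_sum[OF \<psi>])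
  obtain F where F: "finite F" "dist (sum (\<lambda>n. (cmod (\<psi> n))\<^sup>2) F) X \<le> \<epsilon>"
    using has_sum_finite_approximation[OF h \<epsilon>] by blast
  then have FX: "X - \<epsilon> \<le> (\<Sum>n\<in>F. (cmod (\<psi> n))\<^sup>2)" by (simp add: dist_real_def abs_le_iff)
  obtain N :: int where N: "\<And>n. n \<in> F \<Longrightarrow> \<bar>n\<bar> \<le> N"
  proof -
    have "finite (abs ` F)" using F by simp
    then show ?thesis using that[of "Max (insert 0 (abs ` F))"] F by (auto intro!: Max_ge)
  qed
  have small: "(cmod (\<psi> n))\<^sup>2 \<le> \<epsilon>" if "\<bar>n\<bar> > N" for n
  proof -
    have "n \<notin> F" using N[of n] that by auto
    have "(\<Sum>m\<in>insert n F. (cmod (\<psi> m))\<^sup>2) \<le> X" by (rule finite_sum_le_has_sum[OF h]) (use F in auto)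
    then show ?thesis using \<open>n \<notin> F\<close> F FX by simp
  qed
  define L where "L = \<bar>N\<bar> + 2"
  define \<phi> where "\<phi> n = (if \<bar>n\<bar> \<le> L then \<psi> n else 0)" for n
  have supp: "\<phi> n = 0" if "n \<notin> {-L..L}" for n using that by (auto simp: \<phi>_def)
  have "X - \<epsilon> \<le> sqnorm \<phi>"
  proof -
    have "F \<subseteq> {-L..L}" using N by (force simp: L_def)
    then have "(\<Sum>n\<in>F. (cmod (\<psi> n))\<^sup>2) \<le> (\<Sum>n\<in>{-L..L}. (cmod (\<psi> n))\<^sup>2)" by (intro sum_mono2) auto
    also have "\<dots> = (\<Sum>n\<in>{-L..L}. (cmod (\<phi> n))\<^sup>2)" by (intro sum.cong) (auto simp: \<phi>_def)
    also have "\<dots> = sqnorm \<phi>" by (rule finite_support_sqnorm(2)[symmetric]) (use supp in auto)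
    finally show ?thesis using FX by simp
  qed
  moreover have "sqnorm (jacobi v \<phi>) \<le> A + M * \<epsilon>"
  proof -
    let ?B = "{- L - 1, - L, L, L + 1}"
    have c0: "(6 + 3 * K\<^sup>2) * \<epsilon> \<ge> 0" using \<epsilon> by simp
    have "sqnorm (jacobi v \<phi>) \<le> sqnorm (jacobi v \<psi>) + real (card ?B) * ((6 + 3 * K\<^sup>2) * \<epsilon>)"
    proof (rule sqnorm_le_off_finite[OF jacobi_ell2(1)[where v=v, OF \<psi> v] _ c0])
      fix n assume n: "n \<in> ?B"
      have "(cmod (\<phi> m))\<^sup>2 \<le> \<epsilon>" if "\<bar>m\<bar> > N" for m using small[OF that] \<epsilon> by (simp add: \<phi>_def)
      then show "(cmod (jacobi v \<phi> n))\<^sup>2 \<le> (6 + 3 * K\<^sup>2) * \<epsilon>"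
        using n by (intro jacobi_pointwise_bound v) (auto simp: L_def)
    next
      fix n assume n: "n \<notin> ?B"
      then consider "\<bar>n\<bar> < L" | "\<bar>n\<bar> > L + 1" by fastforce
      then have "jacobi v \<phi> n = jacobi v \<psi> n \<or> jacobi v \<phi> n = 0"
        by cases (auto simp: jacobi_def \<phi>_def)
      then show "(cmod (jacobi v \<phi> n))\<^sup>2 \<le> (cmod (jacobi v \<psi> n))\<^sup>2" by auto
    qed simp
    also have "real (card ?B) * ((6 + 3 * K\<^sup>2) * \<epsilon>) \<le> 4 * ((6 + 3 * K\<^sup>2) * \<epsilon>)"
    proof (rule mult_right_mono[OF _ c0])
      have "card ?B \<le> 4" by (simp add: card_insert_if)
      then show "real (card ?B) \<le> 4" by linarith
    qed
    finally show ?thesis by (simp add: A_def M_def algebra_simps)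
  qed
  moreover have "A + M * \<epsilon> < \<delta> * (X - \<epsilon>)"
  proof -
    have "M + \<delta> \<noteq> 0" using M \<delta> by simp
    then have "2 * ((M + \<delta>) * \<epsilon>) = \<delta> * X - A" unfolding \<epsilon>_def by (simp add: divide_simps)
    moreover have "(M + \<delta>) * \<epsilon> > 0" using M \<delta> \<epsilon> by simp
    ultimately show ?thesis by (simp add: algebra_simps)
  qed
  moreover have "\<delta> * (X - \<epsilon>) \<le> \<delta> * sqnorm \<phi>" using calculation(1) \<delta> by (intro mult_left_mono) auto
  ultimately have "sqnorm (jacobi v \<phi>) < \<delta> * sqnorm \<phi>" by linarith
  moreover have "finite {n. \<phi> n \<noteq> 0}" by (rule finite_subset[of _ "{-L..L}"]) (auto simp: \<phi>_def)
  ultimately show ?thesis unfolding quasimode_def v_def by blast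
qed

lemma boundedly_invertible_lower_bound:
  assumes "ell2_boundedly_invertible T"
  shows "\<exists>\<delta>>0. \<forall>\<psi>\<in>ell2. \<delta> * sqnorm \<psi> \<le> sqnorm (T \<psi>)"
proof -
  obtain C where bij: "bij_betw T ell2 ell2" and C: "\<And>\<phi>. \<phi> \<in> ell2 \<Longrightarrow> ell2_norm (inv_into ell2 T \<phi>) \<le> C * ell2_norm \<phi>"
    using assms unfolding ell2_boundedly_invertible_def by blast
  define D where "D = \<bar>C\<bar> + 1"
  have D: "D > 0" by (simp add: D_def)
  have "1 / D\<^sup>2 * sqnorm \<psi> \<le> sqnorm (T \<psi>)" if \<psi>: "\<psi> \<in> ell2" for \<psi>
  proof -
    have "T \<psi> \<in> ell2" "inv_into ell2 T (T \<psi>) = \<psi>"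
      using bij \<psi> by (auto simp: bij_betw_def inv_into_f_f)
    then have "sqrt (sqnorm \<psi>) \<le> C * sqrt (sqnorm (T \<psi>))" using C[of "T \<psi>"] by (simp add: ell2_norm_eq)
    also have "\<dots> \<le> D * sqrt (sqnorm (T \<psi>))" by (intro mult_right_mono) (auto simp: D_def sqnorm_nonneg)
    finally have "(sqrt (sqnorm \<psi>))\<^sup>2 \<le> (D * sqrt (sqnorm (T \<psi>)))\<^sup>2" by (intro power_mono) (auto simp: sqnorm_nonneg)
    then have "sqnorm \<psi> \<le> D\<^sup>2 * sqnorm (T \<psi>)" by (simp add: power_mult_distrib sqnorm_nonneg)
    then show ?thesis using D by (simp add: field_simps)
  qed
  then show ?thesis using D by (intro exI[of _ "1 / D\<^sup>2"]) auto
qed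

lemma jacobi_boundedly_invertible:
  assumes v: "\<And>n. cmod (v n) \<le> K" and \<delta>: "\<delta> > 0"
    and low: "\<And>\<psi>. \<psi> \<in> ell2 \<Longrightarrow> \<delta> * sqnorm \<psi> \<le> sqnorm (jacobi v \<psi>)"
    and low': "\<And>\<psi>. \<psi> \<in> ell2 \<Longrightarrow> \<delta> * sqnorm \<psi> \<le> sqnorm (jacobi (\<lambda>n. cnj (v n)) \<psi>)"
  shows "ell2_boundedly_invertible (jacobi v)"
proof -
  have inj: "inj_on (jacobi v) ell2"
  proof (rule inj_onI)
    fix \<psi> \<phi> assume p: "\<psi> \<in> ell2" "\<phi> \<in> ell2" and eq: "jacobi v \<psi> = jacobi v \<phi>"
    define d where "d n = 1 * \<psi> n + (- 1) * \<phi> n" for n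
    have dl: "d \<in> ell2"
    proof (rule ell2_comparison(1)[OF has_sum_add[OF has_sum_cmult_right[OF ell2_has_sum[OF p(1)], of 3] has_sum_cmult_right[OF ell2_has_sum[OF p(2)], of 3]]])
      show "(cmod (d n))\<^sup>2 \<le> 3 * (cmod (\<psi> n))\<^sup>2 + 3 * (cmod (\<phi> n))\<^sup>2" for n
        using cmod_add3_le[of "\<psi> n" "- \<phi> n" 0] by (simp add: d_def)
    qed
    have "jacobi v d = (\<lambda>n. 0)" unfolding d_def using jacobi_linear[of v 1 \<psi> "-1" \<phi>] eq by auto
    then have "\<delta> * sqnorm d \<le> 0" using low[OF dl] by (simp add: sqnorm_def)
    then have "sqnorm d = 0" using \<delta> sqnorm_nonneg[of d] by (simp add: mult_le_0_iff)
    then have "d n = 0" for n using sqnorm_eq_0D[OF dl] by simp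
    then show "\<psi> = \<phi>" unfolding d_def by (auto simp: fun_eq_iff)
  qed
  have "jacobi v ` ell2 = ell2"
    using jacobi_surj[where v=v, OF v \<delta> low low'] jacobi_ell2(1)[where v=v, OF _ v] by (auto simp: image_iff)
  then have bij: "bij_betw (jacobi v) ell2 ell2" using inj by (simp add: bij_betw_def)
  have "ell2_norm (inv_into ell2 (jacobi v) \<phi>) \<le> sqrt (1 / \<delta>) * ell2_norm \<phi>" if \<phi>: "\<phi> \<in> ell2" for \<phi>
  proof -
    define \<psi> where "\<psi> = inv_into ell2 (jacobi v) \<phi>"
    have "\<psi> \<in> ell2" "jacobi v \<psi> = \<phi>"
      using bij \<phi> unfolding \<psi>_def by (auto simp: bij_betw_def inv_into_into f_inv_into_f)
    then have "\<delta> * sqnorm \<psi> \<le> sqnorm \<phi>" using low by blast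
    then have "sqnorm \<psi> \<le> (1 / \<delta>) * sqnorm \<phi>" using \<delta> by (simp add: field_simps)
    then have "sqrt (sqnorm \<psi>) \<le> sqrt ((1 / \<delta>) * sqnorm \<phi>)" by (rule real_sqrt_le_mono)
    then show ?thesis unfolding ell2_norm_eq \<psi>_def real_sqrt_mult .
  qed
  then show ?thesis unfolding ell2_boundedly_invertible_def using bij by blast
qed

text \<open>For a real potential the cross term in \<open>\<parallel>(H + i y) \<psi>\<parallel>\<^sup>2\<close> vanishes because \<open>H\<close> is symmetric.\<close>

lemma sqnorm_jacobi_imaginary_shift:
  assumes V: "\<And>n. \<bar>V n\<bar> \<le> K" and \<psi>: "\<psi> \<in> ell2"
  shows "y\<^sup>2 * sqnorm \<psi> \<le> sqnorm (jacobi (\<lambda>n. complex_of_real (V n) + \<i> * complex_of_real y) \<psi>)"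
proof -
  define v where "v = (\<lambda>n. complex_of_real (V n))"
  have v: "cmod (v n) \<le> K" for n using V by (simp add: v_def)
  define g where "g = jacobi v \<psi>"
  have g: "g \<in> ell2" unfolding g_def by (rule jacobi_ell2(1)[where v=v, OF \<psi> v])
  obtain S where S: "((\<lambda>n. \<psi> n * cnj (g n)) has_sum S) UNIV" "((\<lambda>n. g n * cnj (\<psi> n)) has_sum S) UNIV"
  proof -
    have "(\<lambda>n. cnj (v n)) = v" by (simp add: v_def)
    then show ?thesis using jacobi_adjoint[where v=v, OF \<psi> \<psi> v] that unfolding g_def by auto
  qed
  have "((\<lambda>n. cnj (\<psi> n * cnj (g n))) has_sum cnj S) UNIV" using S(1) by (simp only: has_sum_cnj_iff)
  then have "cnj S = S" using S(2) has_sum_unique by (fastforce simp: mult.commute)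
  then have ImS: "Im S = 0" by (simp add: complex_eq_iff)
  have eq: "(cmod (jacobi (\<lambda>n. v n + \<i> * complex_of_real y) \<psi> n))\<^sup>2 = (cmod (g n))\<^sup>2 + 2 * y * Im (g n * cnj (\<psi> n)) + y\<^sup>2 * (cmod (\<psi> n))\<^sup>2" for n
  proof -
    have "jacobi (\<lambda>n. v n + \<i> * complex_of_real y) \<psi> n = g n + \<i> * complex_of_real y * \<psi> n"
      by (simp add: g_def jacobi_def algebra_simps)
    then show ?thesis by (simp only: cmod_power2) (simp add: power2_eq_square algebra_simps)
  qed
  have "((\<lambda>n. (cmod (g n))\<^sup>2 + 2 * y * Im (g n * cnj (\<psi> n)) + y\<^sup>2 * (cmod (\<psi> n))\<^sup>2) has_sum sqnorm g + 2 * y * Im S + y\<^sup>2 * sqnorm \<psi>) UNIV"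
    by (intro has_sum_add has_sum_cmult_right ell2_has_sum has_sum_Im S g \<psi>)
  then have "sqnorm (jacobi (\<lambda>n. v n + \<i> * complex_of_real y) \<psi>) = sqnorm g + y\<^sup>2 * sqnorm \<psi>"
    unfolding sqnorm_def[of "jacobi _ _"] eq ImS by (simp add: infsumI)
  then show ?thesis using sqnorm_nonneg[of g] by (simp add: v_def)
qed

text \<open>Off the real axis the imaginary part bounds the operator and its adjoint below; at a real energy
  the operator is its own adjoint, and a lower bound is exactly the absence of quasimodes.\<close>

theorem schroedinger_spectrum:
  assumes V: "\<And>n. \<bar>V n\<bar> \<le> K"
  shows "ell2_spectrum (\<lambda>\<psi> n. \<psi> (n + 1) + \<psi> (n - 1) + complex_of_real (V n) * \<psi> n)
    = complex_of_real ` {E. \<forall>\<delta>>0. quasimode V E \<delta>}"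
proof -
  have op: "(\<lambda>\<psi> n. \<psi> (n + 1) + \<psi> (n - 1) + complex_of_real (V n) * \<psi> n - z * \<psi> n) = jacobi (\<lambda>n. complex_of_real (V n) - z)" for z
    by (intro ext) (simp add: jacobi_def algebra_simps)
  have bound: "cmod (complex_of_real (V n) - z) \<le> K + cmod z" for n z
    using norm_triangle_ineq4[of "complex_of_real (V n)" z] V[of n] by simp
  have nonreal: "ell2_boundedly_invertible (jacobi (\<lambda>n. complex_of_real (V n) - z))" if z: "Im z \<noteq> 0" for z
  proof (rule jacobi_boundedly_invertible[OF bound])
    show "0 < (Im z)\<^sup>2" using z by simp
    have VR: "\<bar>V n - Re z\<bar> \<le> K + \<bar>Re z\<bar>" for n using V[of n] by linarith
    have e: "complex_of_real (V n) - z = complex_of_real (V n - Re z) + \<i> * complex_of_real (- Im z)"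
        "cnj (complex_of_real (V n) - z) = complex_of_real (V n - Re z) + \<i> * complex_of_real (Im z)" for n
      by (simp_all add: complex_eq_iff)
    show "(Im z)\<^sup>2 * sqnorm \<psi> \<le> sqnorm (jacobi (\<lambda>n. complex_of_real (V n) - z) \<psi>)" if "\<psi> \<in> ell2" for \<psi>
      unfolding e using sqnorm_jacobi_imaginary_shift[where V="\<lambda>n. V n - Re z" and y="- Im z", OF VR that] by simp
    show "(Im z)\<^sup>2 * sqnorm \<psi> \<le> sqnorm (jacobi (\<lambda>n. cnj (complex_of_real (V n) - z)) \<psi>)" if "\<psi> \<in> ell2" for \<psi>
      unfolding e using sqnorm_jacobi_imaginary_shift[where V="\<lambda>n. V n - Re z" and y="Im z", OF VR that] by simp
  qed
  have VE: "\<bar>V n - E\<bar> \<le> K + \<bar>E\<bar>" for n E using V[of n] by linarith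
  have real: "ell2_boundedly_invertible (jacobi (\<lambda>n. complex_of_real (V n) - complex_of_real E)) \<longleftrightarrow> (\<exists>\<delta>>0. \<not> quasimode V E \<delta>)" for E
  proof
    assume "ell2_boundedly_invertible (jacobi (\<lambda>n. complex_of_real (V n) - complex_of_real E))"
    from boundedly_invertible_lower_bound[OF this] obtain \<delta> where \<delta>: "\<delta> > 0"
      "\<And>\<psi>. \<psi> \<in> ell2 \<Longrightarrow> \<delta> * sqnorm \<psi> \<le> sqnorm (jacobi (\<lambda>n. complex_of_real (V n - E)) \<psi>)"
      unfolding of_real_diff by blast
    have "\<not> quasimode V E \<delta>"
    proof
      assume "quasimode V E \<delta>"
      then obtain \<psi> where fin: "finite {n. \<psi> n \<noteq> 0}" and lt: "sqnorm (jacobi (\<lambda>n. complex_of_real (V n - E)) \<psi>) < \<delta> * sqnorm \<psi>"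
        unfolding quasimode_def by blast
      have "\<psi> \<in> ell2" by (rule finite_support_sqnorm(1)[OF fin]) auto
      then show False using \<delta>(2)[of \<psi>] lt by linarith
    qed
    then show "\<exists>\<delta>>0. \<not> quasimode V E \<delta>" using \<delta> by blast
  next
    assume "\<exists>\<delta>>0. \<not> quasimode V E \<delta>"
    then obtain \<delta> where \<delta>: "\<delta> > 0" "\<not> quasimode V E \<delta>" by blast
    have low: "\<delta> * sqnorm \<psi> \<le> sqnorm (jacobi (\<lambda>n. complex_of_real (V n - E)) \<psi>)" if "\<psi> \<in> ell2" for \<psi>
      using ell2_quasimode[where V=V, OF VE that \<delta>(1)] \<delta>(2) by (meson not_le)
    show "ell2_boundedly_invertible (jacobi (\<lambda>n. complex_of_real (V n) - complex_of_real E))"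
      by (rule jacobi_boundedly_invertible[OF bound \<delta>(1)]) (use low in auto)
  qed
  have "z \<in> ell2_spectrum (\<lambda>\<psi> n. \<psi> (n + 1) + \<psi> (n - 1) + complex_of_real (V n) * \<psi> n)
    \<longleftrightarrow> z \<in> complex_of_real ` {E. \<forall>\<delta>>0. quasimode V E \<delta>}" for z
  proof (cases "Im z = 0")
    case True
    then have z: "z = complex_of_real (Re z)" by (simp add: complex_eq_iff)
    have "z \<in> ell2_spectrum (\<lambda>\<psi> n. \<psi> (n + 1) + \<psi> (n - 1) + complex_of_real (V n) * \<psi> n) \<longleftrightarrow> (\<forall>\<delta>>0. quasimode V (Re z) \<delta>)"
      unfolding ell2_spectrum_def mem_Collect_eq op by (subst z) (simp only: real, blast)
    also have "\<dots> \<longleftrightarrow> z \<in> complex_of_real ` {E. \<forall>\<delta>>0. quasimode V E \<delta>}"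
      by (subst (2) z) auto
    finally show ?thesis .
  next
    case False
    then show ?thesis using nonreal[OF False] unfolding ell2_spectrum_def mem_Collect_eq op by auto
  qed
  then show ?thesis by blast
qed

text \<open>A quasimode only sees the potential on its support, so a potential that agrees there approximately,
  after a translation by \<open>k\<close>, has the translated quasimode.\<close>

lemma quasimode_local:
  assumes "quasimode V E \<delta>"
  obtains N where "\<And>V' E' k \<eta>. (\<And>n. \<bar>n\<bar> \<le> N \<Longrightarrow> \<bar>(V' (n + k) - E') - (V n - E)\<bar> \<le> \<eta>) \<Longrightarrow> quasimode V' E' (2 * \<delta> + 2 * \<eta>\<^sup>2)"
proof -
  obtain \<psi> where fin: "finite {n. \<psi> n \<noteq> 0}" and lt: "sqnorm (jacobi (\<lambda>n. complex_of_real (V n - E)) \<psi>) < \<delta> * sqnorm \<psi>"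
    using assms unfolding quasimode_def by blast
  obtain N :: int where N: "\<And>n. \<psi> n \<noteq> 0 \<Longrightarrow> \<bar>n\<bar> \<le> N"
    using that[of "Max (insert 0 (abs ` {n. \<psi> n \<noteq> 0}))"] fin by (auto intro!: Max_ge)
  have \<psi>: "\<psi> \<in> ell2" by (rule finite_support_sqnorm(1)[OF fin]) auto
  have "quasimode V' E' (2 * \<delta> + 2 * \<eta>\<^sup>2)" if close: "\<And>n. \<bar>n\<bar> \<le> N \<Longrightarrow> \<bar>(V' (n + k) - E') - (V n - E)\<bar> \<le> \<eta>" for V' E' k \<eta>
  proof -
    define \<phi> where "\<phi> n = \<psi> (n - k)" for n
    have f\<phi>: "finite {n. \<phi> n \<noteq> 0}"
    proof -
      have "{n. \<phi> n \<noteq> 0} = (\<lambda>n. n + k) ` {n. \<psi> n \<noteq> 0}" by (force simp: \<phi>_def image_iff)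
      then show ?thesis using fin by simp
    qed
    have "((\<lambda>n. (cmod (\<phi> n))\<^sup>2) has_sum sqnorm \<psi>) UNIV"
      using ell2_shift_has_sum[OF \<psi>, of "- k"] by (simp add: \<phi>_def)
    then have n\<phi>: "sqnorm \<phi> = sqnorm \<psi>" unfolding sqnorm_def[of \<phi>] by (rule infsumI)
    let ?J = "jacobi (\<lambda>n. complex_of_real (V n - E)) \<psi>"
    let ?J' = "jacobi (\<lambda>n. complex_of_real (V' n - E')) \<phi>"
    have Jl: "?J \<in> ell2"
    proof (rule finite_support_sqnorm(1))
      show "finite ({n. \<psi> n \<noteq> 0} \<union> (\<lambda>n. n - 1) ` {n. \<psi> n \<noteq> 0} \<union> (\<lambda>n. n + 1) ` {n. \<psi> n \<noteq> 0})" using fin by simp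
      show "?J n = 0" if "n \<notin> {n. \<psi> n \<noteq> 0} \<union> (\<lambda>n. n - 1) ` {n. \<psi> n \<noteq> 0} \<union> (\<lambda>n. n + 1) ` {n. \<psi> n \<noteq> 0}" for n
      proof -
        have "\<psi> n = 0" "\<psi> (n + 1) = 0" "\<psi> (n - 1) = 0" using that by (force simp: image_iff)+
        then show ?thesis by (simp add: jacobi_def)
      qed
    qed
    have "sqnorm ?J' \<le> 2 * sqnorm ?J + 2 * \<eta>\<^sup>2 * sqnorm \<psi>"
    proof (rule ell2_comparison(2))
      show "((\<lambda>n. 2 * (cmod (?J (n + - k)))\<^sup>2 + 2 * \<eta>\<^sup>2 * (cmod (\<psi> (n + - k)))\<^sup>2) has_sum 2 * sqnorm ?J + 2 * \<eta>\<^sup>2 * sqnorm \<psi>) UNIV"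
        by (intro has_sum_add has_sum_cmult_right ell2_shift_has_sum Jl \<psi>)
      fix n
      define m where "m = n - k"
      define t where "t = (V' (m + k) - E') - (V m - E)"
      have J': "?J' n = ?J m + complex_of_real t * \<psi> m"
        by (simp add: jacobi_def \<phi>_def m_def t_def algebra_simps)
      have t: "(cmod (complex_of_real t * \<psi> m))\<^sup>2 \<le> \<eta>\<^sup>2 * (cmod (\<psi> m))\<^sup>2"
      proof (cases "\<psi> m = 0")
        case False
        then have "\<bar>t\<bar> \<le> \<eta>" unfolding t_def using close N by blast
        then have "t\<^sup>2 \<le> \<eta>\<^sup>2" using abs_le_square_iff power2_abs by fastforce
        then show ?thesis by (simp add: norm_mult power_mult_distrib mult_right_mono)
      qed simp
      have two: "(cmod (a + b))\<^sup>2 \<le> 2 * (cmod a)\<^sup>2 + 2 * (cmod b)\<^sup>2" for a b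
      proof -
        have "(cmod (a + b))\<^sup>2 \<le> (cmod a + cmod b)\<^sup>2" by (intro power_mono norm_triangle_ineq) auto
        also have "\<dots> \<le> 2 * (cmod a)\<^sup>2 + 2 * (cmod b)\<^sup>2"
          using sum_squares_bound[of "cmod a" "cmod b"] by (simp add: power2_sum)
        finally show ?thesis .
      qed
      show "(cmod (?J' n))\<^sup>2 \<le> 2 * (cmod (?J (n + - k)))\<^sup>2 + 2 * \<eta>\<^sup>2 * (cmod (\<psi> (n + - k)))\<^sup>2"
        unfolding J' using two[of "?J m" "complex_of_real t * \<psi> m"] t by (simp add: m_def)
    qed
    also have "\<dots> < (2 * \<delta> + 2 * \<eta>\<^sup>2) * sqnorm \<phi>" using lt unfolding n\<phi> by (simp add: algebra_simps)
    finally show ?thesis unfolding quasimode_def using f\<phi> by blast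
  qed
  then show ?thesis using that by blast
qed

lemma quasimode_energy_bound:
  assumes q: "quasimode V E 1" and V: "\<And>n. \<bar>V n\<bar> \<le> K"
  shows "\<bar>E\<bar> \<le> K + 3"
proof (rule ccontr)
  assume E: "\<not> \<bar>E\<bar> \<le> K + 3"
  obtain \<psi> where fin: "finite {n. \<psi> n \<noteq> 0}" and lt: "sqnorm (jacobi (\<lambda>n. complex_of_real (V n - E)) \<psi>) < sqnorm \<psi>"
    using q unfolding quasimode_def by auto
  have \<psi>: "\<psi> \<in> ell2" by (rule finite_support_sqnorm(1)[OF fin]) auto
  let ?J = "jacobi (\<lambda>n. complex_of_real (V n - E)) \<psi>"
  have "cmod (complex_of_real (V n - E)) \<le> K + \<bar>E\<bar>" for n unfolding norm_of_real using V[of n] by linarith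
  note Jl = jacobi_ell2(1)[where v="\<lambda>n. complex_of_real (V n - E)", OF \<psi> this]
  have b: "(cmod (3 * \<psi> n))\<^sup>2 \<le> 3 * (cmod (?J n))\<^sup>2 + 3 * (cmod (\<psi> (n + 1)))\<^sup>2 + 3 * (cmod (\<psi> (n + - 1)))\<^sup>2" for n
  proof -
    have "3 \<le> \<bar>V n - E\<bar>" using E V[of n] by linarith
    then have "(cmod (3 * \<psi> n))\<^sup>2 \<le> (cmod (complex_of_real (V n - E) * \<psi> n))\<^sup>2"
      unfolding norm_mult norm_of_real by (intro power_mono mult_right_mono) auto
    also have "complex_of_real (V n - E) * \<psi> n = ?J n + - \<psi> (n + 1) + - \<psi> (n - 1)"
      by (simp add: jacobi_def)
    also have "(cmod (?J n + - \<psi> (n + 1) + - \<psi> (n - 1)))\<^sup>2 \<le> 3 * (cmod (?J n))\<^sup>2 + 3 * (cmod (- \<psi> (n + 1)))\<^sup>2 + 3 * (cmod (- \<psi> (n - 1)))\<^sup>2"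
      by (rule cmod_add3_le)
    finally show ?thesis by simp
  qed
  have h: "((\<lambda>n. 3 * (cmod (?J n))\<^sup>2 + 3 * (cmod (\<psi> (n + 1)))\<^sup>2 + 3 * (cmod (\<psi> (n + - 1)))\<^sup>2) has_sum 3 * sqnorm ?J + 3 * sqnorm \<psi> + 3 * sqnorm \<psi>) UNIV"
    by (intro has_sum_add has_sum_cmult_right ell2_shift_has_sum ell2_has_sum Jl \<psi>)
  have "((\<lambda>n. 9 * (cmod (\<psi> n))\<^sup>2) has_sum 9 * sqnorm \<psi>) UNIV" by (intro has_sum_cmult_right ell2_has_sum \<psi>)
  then have "((\<lambda>n. (cmod (3 * \<psi> n))\<^sup>2) has_sum 9 * sqnorm \<psi>) UNIV" by (simp add: norm_mult power_mult_distrib)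
  then have "9 * sqnorm \<psi> \<le> 3 * sqnorm ?J + 3 * sqnorm \<psi> + 3 * sqnorm \<psi>" using has_sum_mono[OF _ h] b by blast
  then show False using lt by linarith
qed

text \<open>Truncations of a solution that stays between two positive constants: the error at the ends is
  bounded while the norm grows with the length.\<close>

lemma half_line_solution_quasimode:
  assumes a: "a > 0" and u: "\<And>n. n \<ge> 0 \<Longrightarrow> a \<le> u n \<and> u n \<le> b"
    and eq: "\<And>n. n \<ge> 1 \<Longrightarrow> u (n + 1) + u (n - 1) + V n * u n = E * u n"
    and V: "\<And>n. \<bar>V n - E\<bar> \<le> K" and \<delta>: "\<delta> > 0"
  shows "quasimode V E \<delta>"
proof -
  define v where "v = (\<lambda>n. complex_of_real (V n - E))"
  have v: "cmod (v n) \<le> K" for n unfolding v_def norm_of_real by (rule V)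
  have b: "b > 0" using u[of 0] a by linarith
  define M where "M = 4 * ((6 + 3 * K\<^sup>2) * b\<^sup>2)"
  obtain N :: nat where N: "real N > M / (\<delta> * a\<^sup>2)" using reals_Archimedean2 by blast
  define L where "L = int N"
  define \<psi> where "\<psi> n = (if 0 \<le> n \<and> n \<le> L then complex_of_real (u n) else 0)" for n
  have fin: "finite {n. \<psi> n \<noteq> 0}" by (rule finite_subset[of _ "{0..L}"]) (auto simp: \<psi>_def)
  have \<psi>b: "(cmod (\<psi> n))\<^sup>2 \<le> b\<^sup>2" for n
    using u[of n] a b by (auto simp: \<psi>_def intro!: power_mono)
  have "M < \<delta> * a\<^sup>2 * real N" using N \<delta> a by (simp add: field_simps)
  also have "\<dots> \<le> \<delta> * (\<Sum>n\<in>{0..L}. a\<^sup>2)" using \<delta> a by (simp add: L_def algebra_simps)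
  also have "\<dots> \<le> \<delta> * (\<Sum>n\<in>{0..L}. (cmod (\<psi> n))\<^sup>2)"
  proof (intro mult_left_mono sum_mono)
    fix n assume n: "n \<in> {0..L}"
    then have "a \<le> u n" using u[of n] by simp
    also have "\<dots> \<le> cmod (\<psi> n)" using n by (simp add: \<psi>_def)
    finally have "a \<le> cmod (\<psi> n)" .
    then show "a\<^sup>2 \<le> (cmod (\<psi> n))\<^sup>2" using a by (intro power_mono) auto
  qed (use \<delta> in auto)
  also have "(\<Sum>n\<in>{0..L}. (cmod (\<psi> n))\<^sup>2) = sqnorm \<psi>"
    by (rule finite_support_sqnorm(2)[symmetric]) (auto simp: \<psi>_def)
  finally have low: "M < \<delta> * sqnorm \<psi>" .
  let ?B = "{- 1, 0, L, L + 1}"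
  have c0: "(6 + 3 * K\<^sup>2) * b\<^sup>2 \<ge> 0" by simp
  have "sqnorm (jacobi v \<psi>) \<le> sqnorm (\<lambda>n. 0) + real (card ?B) * ((6 + 3 * K\<^sup>2) * b\<^sup>2)"
  proof (rule sqnorm_le_off_finite[OF _ _ c0])
    show "(\<lambda>n. 0) \<in> ell2" by (simp add: ell2_def)
    show "(cmod (jacobi v \<psi> n))\<^sup>2 \<le> (6 + 3 * K\<^sup>2) * b\<^sup>2" for n
      by (intro jacobi_pointwise_bound v \<psi>b)
  next
    fix n assume n: "n \<notin> ?B"
    then consider "1 \<le> n \<and> n < L" | "n < -1 \<or> n > L + 1" by fastforce
    then have "jacobi v \<psi> n = 0"
    proof cases
      case 1
      then have "jacobi v \<psi> n = complex_of_real (u (n + 1) + u (n - 1) + (V n - E) * u n)"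
        by (simp add: jacobi_def \<psi>_def v_def)
      also have "u (n + 1) + u (n - 1) + (V n - E) * u n = 0" using eq[of n] 1 by (simp add: algebra_simps)
      finally show ?thesis by simp
    next
      case 2
      then show ?thesis by (auto simp: jacobi_def \<psi>_def L_def)
    qed
    then show "(cmod (jacobi v \<psi> n))\<^sup>2 \<le> (cmod 0)\<^sup>2" by simp
  qed simp
  also have "real (card ?B) * ((6 + 3 * K\<^sup>2) * b\<^sup>2) \<le> 4 * ((6 + 3 * K\<^sup>2) * b\<^sup>2)"
  proof (rule mult_right_mono[OF _ c0])
    have "card ?B \<le> 4" by (simp add: card_insert_if)
    then show "real (card ?B) \<le> 4" by linarith
  qed
  finally have "sqnorm (jacobi v \<psi>) \<le> M" by (simp add: M_def sqnorm_def)
  then show ?thesis unfolding quasimode_def using fin low unfolding v_def by (intro exI[of _ \<psi>]) auto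
qed

section \<open>Density and recurrence of the torus rotation\<close>

text \<open>Kronecker's theorem, whose independence hypothesis for \<open>1, \<alpha>\<^sub>1, \<dots>, \<alpha>\<^sub>d\<close> over the integers is
  the assumption that no nontrivial integer combination of the coordinates of \<open>\<alpha>\<close> is an integer.\<close>

lemma orbit_dense_mod_integers:
  fixes \<alpha> :: "real ^ 'd"
  assumes irr: "\<And>m :: int ^ 'd. m \<noteq> 0 \<Longrightarrow> of_int_vec m \<bullet> \<alpha> \<notin> \<int>" and \<epsilon>: "\<epsilon> > 0"
  obtains j :: int and m :: "int ^ 'd" where "norm (of_int j *\<^sub>R \<alpha> - of_int_vec m - x) < \<epsilon>"
proof -
  define n where "n = CARD('d)"
  have n: "n > 0" by (simp add: n_def)
  obtain e :: "nat \<Rightarrow> 'd" where e: "bij_betw e {..<n} UNIV"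
    using ex_bij_betw_nat_finite[of "UNIV :: 'd set"] by (auto simp: n_def atLeast0LessThan)
  define t where "t i = (if i < n then \<alpha> $ e i else 1)" for i
  have lin: "(\<Sum>i\<in>{..n}. of_int (c i) * t i) = 0 \<Longrightarrow> (\<forall>i\<in>{..n}. c i = 0)" for c :: "nat \<Rightarrow> int"
  proof -
    assume s: "(\<Sum>i\<in>{..n}. of_int (c i) * t i) = 0"
    define m :: "int ^ 'd" where "m = (\<chi> k. c (inv_into {..<n} e k))"
    have me: "m $ e i = c i" if "i < n" for i
      using e that by (simp add: m_def bij_betw_def inv_into_f_f)
    have "of_int_vec m \<bullet> \<alpha> = (\<Sum>k\<in>UNIV. of_int (m $ k) * \<alpha> $ k)"
      by (simp add: inner_vec_def of_int_vec_def)
    also have "\<dots> = (\<Sum>i\<in>{..<n}. of_int (m $ e i) * \<alpha> $ e i)"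
      by (rule sum.reindex_bij_betw[OF e, symmetric])
    also have "\<dots> = (\<Sum>i\<in>{..<n}. of_int (c i) * t i)"
      by (intro sum.cong) (auto simp: me t_def)
    finally have ip: "of_int_vec m \<bullet> \<alpha> = - of_int (c n)"
      using s by (simp add: lessThan_Suc_atMost[symmetric] t_def)
    then have "of_int_vec m \<bullet> \<alpha> \<in> \<int>" by simp
    then have "m = 0" using irr by blast
    then have "c i = 0" if "i < n" for i using me[OF that] by simp
    moreover have "c n = 0" using ip \<open>m = 0\<close> by simp
    ultimately show "\<forall>i\<in>{..n}. c i = 0" by (auto simp: le_less)
  qed
  have inj: "inj_on t {..n}"
  proof (rule inj_onI, rule ccontr)
    fix i j assume ij: "i \<in> {..n}" "j \<in> {..n}" "t i = t j" "i \<noteq> j"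
    define c where "c = (\<lambda>k. if k = i then 1 else if k = j then - 1 else (0::int))"
    have "(\<Sum>k\<in>{..n}. of_int (c k) * t k) = (\<Sum>k\<in>{i, j}. of_int (c k) * t k)"
      using ij by (intro sum.mono_neutral_right) (auto simp: c_def)
    also have "\<dots> = 0" using ij by (simp add: c_def)
    finally have "c i = 0" using lin ij by blast
    then show False by (simp add: c_def)
  qed
  interpret Modules.module "(\<lambda>r. (*) (real_of_int r))"
    by (simp add: Modules.module.intro distrib_left mult.commute)
  have "independent (t ` {..n})"
    unfolding independent_explicit_module
  proof (intro allI impI)
    fix T :: "real set" and u v
    assume T: "finite T" "T \<subseteq> t ` {..n}" "(\<Sum>v\<in>T. of_int (u v) * v) = 0" "v \<in> T"
    define c where "c i = (if t i \<in> T then u (t i) else 0)" for i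
    have "(\<Sum>i\<in>{..n}. of_int (c i) * t i) = (\<Sum>w\<in>t ` {..n}. of_int (if w \<in> T then u w else 0) * w)"
      by (subst sum.reindex[OF inj]) (simp add: c_def)
    also have "\<dots> = (\<Sum>w\<in>T. of_int (if w \<in> T then u w else 0) * w)"
      using T by (intro sum.mono_neutral_right) auto
    also have "\<dots> = 0" using T(3) by simp
    finally have c0: "\<forall>i\<in>{..n}. c i = 0" by (rule lin)
    obtain i where i: "i \<in> {..n}" "v = t i" using T by auto
    have "c i = 0" using c0 i(1) by blast
    then show "u v = 0" using T(4) i(2) by (simp add: c_def)
  qed
  then have ind: "module.independent (\<lambda>r x. of_int r * x) (t ` {..n})" .
  have "\<epsilon> / n > 0" using \<epsilon> n by simp
  from Kronecker_thm_2[OF ind inj _ this, of "\<lambda>i. x $ e i"]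
  obtain k l where kl: "\<And>i. i < n \<Longrightarrow> \<bar>of_int k * t i - of_int (l i) - x $ e i\<bar> < \<epsilon> / n"
    by (auto simp: t_def)
  define m :: "int ^ 'd" where "m = (\<chi> q. l (inv_into {..<n} e q))"
  let ?v = "of_int k *\<^sub>R \<alpha> - of_int_vec m - x"
  have "norm ?v \<le> (\<Sum>q\<in>UNIV. \<bar>?v $ q\<bar>)" by (rule norm_le_l1_cart)
  also have "\<dots> = (\<Sum>i\<in>{..<n}. \<bar>?v $ e i\<bar>)" by (rule sum.reindex_bij_betw[OF e, symmetric])
  also have "\<dots> < (\<Sum>i\<in>{..<n}. \<epsilon> / n)"
  proof (rule sum_strict_mono)
    fix i assume i: "i \<in> {..<n}"
    have "m $ e i = l i" using e i by (simp add: m_def bij_betw_def inv_into_f_f)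
    then show "\<bar>?v $ e i\<bar> < \<epsilon> / n" using kl[of i] i by (simp add: t_def of_int_vec_def)
  qed (use n in auto)
  also have "\<dots> = \<epsilon>" using n by simp
  finally show ?thesis by (rule that)
qed

text \<open>Dirichlet's theorem, applied to \<open>(L + 1) \<alpha>\<close> so that the return time exceeds \<open>L\<close>.\<close>

lemma orbit_returns:
  fixes \<alpha> :: "real ^ 'd" and L :: nat
  assumes \<epsilon>: "\<epsilon> > 0"
  obtains q :: int and m :: "int ^ 'd" where "q > int L" "norm (of_int q *\<^sub>R \<alpha> - of_int_vec m) < \<epsilon>"
proof -
  define n where "n = CARD('d)"
  have n: "n > 0" by (simp add: n_def)
  obtain e :: "nat \<Rightarrow> 'd" where e: "bij_betw e {..<n} UNIV"
    using ex_bij_betw_nat_finite[of "UNIV :: 'd set"] by (auto simp: n_def atLeast0LessThan)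
  obtain N :: nat where N: "real n / \<epsilon> < real N" using reals_Archimedean2 by blast
  have "real n / \<epsilon> > 0" using n \<epsilon> by simp
  then have N0: "N > 0" using N by (cases N) auto
  obtain q p where q: "q > 0" and p: "\<And>i. i < n \<Longrightarrow> \<bar>of_int q * (of_nat (L + 1) * \<alpha> $ e i) - of_int (p i)\<bar> < 1 / N"
    using Dirichlet_approx_simult[OF N0, of n "\<lambda>i. of_nat (L + 1) * \<alpha> $ e i"] by metis
  define m :: "int ^ 'd" where "m = (\<chi> k. p (inv_into {..<n} e k))"
  let ?q = "q * int (L + 1)"
  let ?v = "of_int ?q *\<^sub>R \<alpha> - of_int_vec m"
  have "norm ?v \<le> (\<Sum>k\<in>UNIV. \<bar>?v $ k\<bar>)" by (rule norm_le_l1_cart)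
  also have "\<dots> = (\<Sum>i\<in>{..<n}. \<bar>?v $ e i\<bar>)" by (rule sum.reindex_bij_betw[OF e, symmetric])
  also have "\<dots> \<le> (\<Sum>i\<in>{..<n}. 1 / N)"
  proof (rule sum_mono)
    fix i assume i: "i \<in> {..<n}"
    have "m $ e i = p i" using e i by (simp add: m_def bij_betw_def inv_into_f_f)
    then show "\<bar>?v $ e i\<bar> \<le> 1 / N" using p[of i] i by (simp add: of_int_vec_def mult.assoc)
  qed
  also have "\<dots> = n / N" by simp
  also have "\<dots> < \<epsilon>" using N N0 \<epsilon> by (simp add: field_simps)
  finally have "norm ?v < \<epsilon>" .
  moreover have "?q > int L"
  proof -
    have "1 * int (L + 1) \<le> q * int (L + 1)" using q by (intro mult_right_mono) auto
    then show ?thesis unfolding mult_1 by linarith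
  qed
  ultimately show ?thesis using that by blast
qed

section \<open>Patterns in independent sequences\<close>

text \<open>Independence of disjoint windows. Carrying a cylinder over a further window \<open>T\<close> along makes the
  induction work: the event that window \<open>J\<close> fails as well is the difference of two events of the
  same kind with one window fewer.\<close>

lemma (in product_prob_space) prob_cylinder_avoiding:
  fixes J :: nat
  assumes X: "\<And>i. i \<in> I \<Longrightarrow> X i \<in> sets (M i)" 
    and "finite T" "T \<subseteq> I" "\<forall>j<J. finite (W j) \<and> W j \<subseteq> I \<and> T \<inter> W j = {}"
    and "\<forall>i j. i < j \<and> j < J \<longrightarrow> W i \<inter> W j = {}"
  shows "measure (PiM I M) {\<omega> \<in> space (PiM I M). (\<forall>i\<in>T. \<omega> i \<in> X i) \<and> (\<forall>j<J. \<not> (\<forall>i\<in>W j. \<omega> i \<in> X i))}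
     = (\<Prod>i\<in>T. measure (M i) (X i)) * (\<Prod>j<J. 1 - (\<Prod>i\<in>W j. measure (M i) (X i)))"
  using assms(2-)
proof (induction J arbitrary: T)
  case 0
  have "emeasure (Pi\<^sub>M I M) {\<omega> \<in> space (PiM I M). \<forall>i\<in>T. \<omega> i \<in> X i} = (\<Prod>i\<in>T. emeasure (M i) (X i))"
    using 0 X by (intro emeasure_PiM_Collect) auto
  then show ?case
    unfolding emeasure_eq_measure M.emeasure_eq_measure
    by (simp add: prod_ennreal measure_nonneg prod_nonneg)
next
  case (Suc J)
  define A where "A T = {\<omega> \<in> space (PiM I M). (\<forall>i\<in>T. \<omega> i \<in> X i) \<and> (\<forall>j<J. \<not> (\<forall>i\<in>W j. \<omega> i \<in> X i))}" for T
  have meas: "A T \<in> sets (PiM I M)" if "finite T" "T \<subseteq> I" for T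
  proof -
    have cyl: "{\<omega> \<in> space (PiM I M). \<forall>i\<in>S. \<omega> i \<in> X i} \<in> sets (PiM I M)" if "finite S" "S \<subseteq> I" for S
    proof (intro sets.sets_Collect_finite_All sets_Collect_single')
      fix i assume "i \<in> S"
      then have "i \<in> I" using that by blast
      then have "{x \<in> space (M i). x \<in> X i} = X i" using sets.sets_into_space[OF X] by auto
      then show "{x \<in> space (M i). x \<in> X i} \<in> sets (M i)" using X[OF \<open>i \<in> I\<close>] by simp
    qed (use that in auto)
    have "A T = {\<omega> \<in> space (PiM I M). \<forall>i\<in>T. \<omega> i \<in> X i} \<inter> (space (PiM I M) - (\<Union>j<J. {\<omega> \<in> space (PiM I M). \<forall>i\<in>W j. \<omega> i \<in> X i}))"
      by (auto simp: A_def)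
    also have "\<dots> \<in> sets (PiM I M)"
      using that Suc.prems(3) by (intro sets.Int sets.Diff sets.top sets.finite_UN cyl) auto
    finally show ?thesis .
  qed
  have WJ: "finite (W J)" "W J \<subseteq> I" "T \<inter> W J = {}" using Suc.prems(3) by auto
  have "{\<omega> \<in> space (PiM I M). (\<forall>i\<in>T. \<omega> i \<in> X i) \<and> (\<forall>j<Suc J. \<not> (\<forall>i\<in>W j. \<omega> i \<in> X i))} = A T - A (T \<union> W J)"
    by (auto simp: A_def less_Suc_eq)
  also have "measure (PiM I M) \<dots> = measure (PiM I M) (A T) - measure (PiM I M) (A (T \<union> W J))"
    using Suc.prems WJ by (intro finite_measure_Diff meas) (auto simp: A_def)
  also have "measure (PiM I M) (A T) = (\<Prod>i\<in>T. measure (M i) (X i)) * (\<Prod>j<J. 1 - (\<Prod>i\<in>W j. measure (M i) (X i)))"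
    unfolding A_def using Suc.prems by (intro Suc.IH) auto
  also have "measure (PiM I M) (A (T \<union> W J)) = (\<Prod>i\<in>T \<union> W J. measure (M i) (X i)) * (\<Prod>j<J. 1 - (\<Prod>i\<in>W j. measure (M i) (X i)))"
    unfolding A_def
  proof (intro Suc.IH)
    show "\<forall>j<J. finite (W j) \<and> W j \<subseteq> I \<and> (T \<union> W J) \<inter> W j = {}"
    proof (intro allI impI)
      fix j assume j: "j < J"
      then have "W j \<inter> W J = {}" using Suc.prems(4) by simp
      then show "finite (W j) \<and> W j \<subseteq> I \<and> (T \<union> W J) \<inter> W j = {}"
        using Suc.prems(3)[rule_format, of j] j by auto
    qed
  qed (use Suc.prems WJ in auto)
  also have "(\<Prod>i\<in>T \<union> W J. measure (M i) (X i)) = (\<Prod>i\<in>T. measure (M i) (X i)) * (\<Prod>i\<in>W J. measure (M i) (X i))"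
    using Suc.prems WJ by (intro prod.union_disjoint) auto
  finally show ?case by (simp add: algebra_simps)
qed

text \<open>Among \<open>J\<close> disjoint windows all fail with probability \<open>(1 - \<pi>) ^ J\<close>, where \<open>\<pi> > 0\<close> is the
  probability of the pattern, and \<open>J\<close> is arbitrary.\<close>

lemma AE_pattern_occurs:
  fixes \<nu> :: "real measure" and U :: "nat \<Rightarrow> real set"
  assumes \<nu>: "real_distribution \<nu>" and U: "\<And>i. i < L \<Longrightarrow> open (U i) \<and> measure \<nu> (U i) > 0"
    and K: "\<And>J :: nat. \<exists>k :: nat \<Rightarrow> int. (\<forall>j<J. k j \<in> K) \<and> (\<forall>i j. i < j \<and> j < J \<longrightarrow> k i + int L \<le> k j)"
  shows "AE \<omega> in Pi\<^sub>M UNIV (\<lambda>_::int. \<nu>). \<exists>k\<in>K. \<forall>i<L. \<omega> (k + int i) \<in> U i"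
proof -
  interpret \<nu>: real_distribution \<nu> by (rule \<nu>)
  interpret product_prob_space "\<lambda>_::int. \<nu>" UNIV by unfold_locales
  let ?M = "Pi\<^sub>M UNIV (\<lambda>_::int. \<nu>)"
  define \<pi> where "\<pi> = (\<Prod>i<L. measure \<nu> (U i))"
  have \<pi>: "0 < \<pi>" "\<pi> \<le> 1" using U by (auto simp: \<pi>_def intro!: prod_pos prod_le_1)
  have Usets: "U i \<in> sets \<nu>" if "i < L" for i using U[OF that] by auto
  have "\<exists>B. B \<in> sets ?M \<and> {\<omega> \<in> space ?M. \<not> (\<exists>k\<in>K. \<forall>i<L. \<omega> (k + int i) \<in> U i)} \<subseteq> B \<and> measure ?M B \<le> (1 - \<pi>) ^ J" for J
  proof -
    obtain k :: "nat \<Rightarrow> int" where k: "\<And>j. j < J \<Longrightarrow> k j \<in> K" "\<And>i j. i < j \<Longrightarrow> j < J \<Longrightarrow> k i + int L \<le> k j"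
      using K[of J] by blast
    define W where "W j = {k j..<k j + int L}" for j
    \<comment> \<open>As the windows are disjoint, the pattern shifted into all of them is one family of sets \<open>X\<close> over the sites.\<close>
    define pick where "pick n = (SOME j. j < J \<and> n \<in> W j)" for n
    have dis: "W i \<inter> W j = {}" if "i < j" "j < J" for i j using k(2)[OF that] by (auto simp: W_def)
    have pick: "pick n = j" if "j < J" "n \<in> W j" for n j
    proof -
      have "pick n < J \<and> n \<in> W (pick n)" unfolding pick_def by (rule someI[of _ j]) (use that in auto)
      then show ?thesis using dis[of j "pick n"] dis[of "pick n" j] that by (cases j "pick n" rule: linorder_cases) auto
    qed
    define X where "X n = (if \<exists>j<J. n \<in> W j then U (nat (n - k (pick n))) else UNIV)" for n
    have Xk: "X (k j + int i) = U i" if "j < J" "i < L" for i j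
    proof -
      have "k j + int i \<in> W j" using that by (simp add: W_def)
      then show ?thesis using pick[OF that(1)] that by (auto simp: X_def)
    qed
    have Xs: "X n \<in> sets \<nu>" for n
    proof (cases "\<exists>j<J. n \<in> W j")
      case True
      then obtain j where j: "j < J" "n \<in> W j" by blast
      then have "n = k j + int (nat (n - k j))" "nat (n - k j) < L" by (auto simp: W_def)
      then show ?thesis using Xk[OF j(1)] Usets by metis
    qed (auto simp: X_def)
    define B where "B = {\<omega> \<in> space ?M. (\<forall>i\<in>{}. \<omega> i \<in> X i) \<and> (\<forall>j<J. \<not> (\<forall>i\<in>W j. \<omega> i \<in> X i))}"
    have Wim: "W j = (\<lambda>i. k j + int i) ` {..<L}" for j
    proof (intro equalityI subsetI)
      fix n assume "n \<in> W j"
      then have "n = k j + int (nat (n - k j))" "nat (n - k j) < L" by (auto simp: W_def)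
      then show "n \<in> (\<lambda>i. k j + int i) ` {..<L}" by blast
    qed (auto simp: W_def)
    have "(\<Prod>i\<in>W j. measure \<nu> (X i)) = \<pi>" if "j < J" for j
      unfolding Wim \<pi>_def by (subst prod.reindex) (auto simp: inj_on_def Xk that)
    then have mB: "measure ?M B = (1 - \<pi>) ^ J"
      unfolding B_def using dis Xs by (subst prob_cylinder_avoiding) (auto simp: W_def)
    have sB: "B \<in> sets ?M"
    proof -
      have cyl: "{\<omega> \<in> space ?M. \<forall>i\<in>W j. \<omega> i \<in> X i} \<in> sets ?M" for j
        using Xs by (intro sets.sets_Collect_finite_All) (auto simp: W_def intro!: sets_Collect_single')
      have "B = space ?M - (\<Union>j<J. {\<omega> \<in> space ?M. \<forall>i\<in>W j. \<omega> i \<in> X i})" by (auto simp: B_def)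
      then show ?thesis using cyl by auto
    qed
    have "{\<omega> \<in> space ?M. \<not> (\<exists>k\<in>K. \<forall>i<L. \<omega> (k + int i) \<in> U i)} \<subseteq> B"
    proof
      fix \<omega> assume \<omega>: "\<omega> \<in> {\<omega> \<in> space ?M. \<not> (\<exists>k\<in>K. \<forall>i<L. \<omega> (k + int i) \<in> U i)}"
      have "\<not> (\<forall>i\<in>W j. \<omega> i \<in> X i)" if j: "j < J" for j
      proof -
        obtain i where "i < L" "\<omega> (k j + int i) \<notin> U i" using \<omega> k(1)[OF j] by blast
        then show ?thesis using Xk[OF j] unfolding Wim by auto
      qed
      then show "\<omega> \<in> B" using \<omega> by (simp add: B_def)
    qed
    then show ?thesis using sB mB by (intro exI[of _ B] conjI) simp_all
  qed
  from choice[OF allI[OF this]] obtain B where "\<forall>J. B J \<in> sets ?M \<and>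
      {\<omega> \<in> space ?M. \<not> (\<exists>k\<in>K. \<forall>i<L. \<omega> (k + int i) \<in> U i)} \<subseteq> B J \<and> measure ?M (B J) \<le> (1 - \<pi>) ^ J" ..
  then have B: "\<And>J. B J \<in> sets ?M" "\<And>J. {\<omega> \<in> space ?M. \<not> (\<exists>k\<in>K. \<forall>i<L. \<omega> (k + int i) \<in> U i)} \<subseteq> B J"
    "\<And>J. measure ?M (B J) \<le> (1 - \<pi>) ^ J" by simp_all
  have "measure ?M (\<Inter>J. B J) \<le> (1 - \<pi>) ^ J" for J
    using B by (intro order.trans[OF finite_measure_mono B(3)[of J]]) auto
  moreover have "(\<lambda>J. (1 - \<pi>) ^ J) \<longlonglongrightarrow> 0" using \<pi> by (intro LIMSEQ_realpow_zero) auto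
  ultimately have "measure ?M (\<Inter>J. B J) \<le> 0" by (intro LIMSEQ_le_const) auto
  then have "measure ?M (\<Inter>J. B J) = 0" using measure_nonneg[of ?M "\<Inter>J. B J"] by linarith
  then have "(\<Inter>J. B J) \<in> null_sets ?M" using B by (intro null_setsI) (auto simp: emeasure_eq_measure)
  then show ?thesis by (rule AE_I') (use B(2) in blast)
qed

text \<open>The complement of the support is a union of open null sets, hence null by the Lindelof property.\<close>

lemma AE_topological_support:
  assumes \<nu>: "real_distribution \<nu>"
  shows "AE \<omega> in Pi\<^sub>M UNIV (\<lambda>_::int. \<nu>). range \<omega> \<subseteq> topological_support \<nu>"
proof -
  interpret \<nu>: real_distribution \<nu> by (rule \<nu>)
  interpret product_prob_space "\<lambda>_::int. \<nu>" UNIV by unfold_locales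
  define \<U> where "\<U> = {U :: real set. open U \<and> measure \<nu> U = 0}"
  obtain \<V> where \<V>: "\<V> \<subseteq> \<U>" "countable \<V>" "\<Union>\<V> = \<Union>\<U>"
    using Lindelof[of \<U>] by (auto simp: \<U>_def)
  have "U \<in> null_sets \<nu>" if "U \<in> \<V>" for U
    using \<V>(1) that by (intro null_setsI) (auto simp: \<U>_def \<nu>.emeasure_eq_measure)
  then have "(\<Union>U\<in>\<V>. U) \<in> null_sets \<nu>" by (rule null_sets_UN'[OF \<V>(2)])
  then have null: "\<Union>\<U> \<in> null_sets \<nu>" using \<V>(3) by simp
  have "topological_support \<nu> = - \<Union>\<U>"
    using measure_nonneg[of \<nu>] by (auto simp: topological_support_def \<U>_def less_le)
  then have "AE x in \<nu>. x \<in> topological_support \<nu>"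
    by (intro AE_I'[OF null]) auto
  then have "AE \<omega> in Pi\<^sub>M UNIV (\<lambda>_::int. \<nu>). \<omega> n \<in> topological_support \<nu>" for n
    by (intro AE_component) auto
  then have "AE \<omega> in Pi\<^sub>M UNIV (\<lambda>_::int. \<nu>). \<forall>n. \<omega> n \<in> topological_support \<nu>"
    by (simp add: AE_all_countable)
  then show ?thesis by (rule AE_mp) (intro AE_I2 impI, auto)
qed

section \<open>The almost sure spectrum\<close>

lemma of_int_vec_minus: "of_int_vec (- m) = - of_int_vec m"
  by (simp add: of_int_vec_def vec_eq_iff)

lemma of_int_vec_scale: "of_int_vec (\<chi> i. k * m $ i) = of_int k *\<^sub>R of_int_vec m"
  by (simp add: of_int_vec_def vec_eq_iff)

lemma torus_function_diff: "torus_function f \<Longrightarrow> f (x - of_int_vec m) = f x"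
  unfolding torus_function_def by (metis add_uminus_conv_diff of_int_vec_minus)

lemma torus_reduction:
  fixes x :: "real ^ 'd"
  obtains m :: "int ^ 'd" where "norm (x - of_int_vec m) \<le> real CARD('d)"
proof -
  define m :: "int ^ 'd" where "m = (\<chi> i. \<lfloor>x $ i\<rfloor>)"
  have "norm (x - of_int_vec m) \<le> (\<Sum>i\<in>UNIV. \<bar>(x - of_int_vec m) $ i\<bar>)" by (rule norm_le_l1_cart)
  also have "\<dots> \<le> (\<Sum>i\<in>(UNIV :: 'd set). 1)"
  proof (rule sum_mono)
    show "\<bar>(x - of_int_vec m) $ i\<bar> \<le> 1" for i by (simp add: m_def of_int_vec_def abs_le_iff) linarith
  qed
  finally show ?thesis using that by simp
qed

text \<open>Uniform continuity with respect to the distance on the torus, from compactness of a ball that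
  contains a neighbourhood of a fundamental domain.\<close>

lemma torus_uniformly_continuous:
  fixes f :: "real ^ 'd \<Rightarrow> real"
  assumes f: "torus_function f" and c: "continuous_on UNIV f" and \<epsilon>: "\<epsilon> > 0"
  obtains d where "d > 0" "\<And>x y m. norm (x - y - of_int_vec m) < d \<Longrightarrow> \<bar>f x - f y\<bar> < \<epsilon>"
proof -
  let ?S = "cball (0 :: real ^ 'd) (real CARD('d) + 1)"
  have "uniformly_continuous_on ?S f"
    by (rule compact_uniformly_continuous) (auto intro: continuous_on_subset[OF c])
  then obtain d where d: "d > 0" "\<And>x y. x \<in> ?S \<Longrightarrow> y \<in> ?S \<Longrightarrow> dist y x < d \<Longrightarrow> dist (f y) (f x) < \<epsilon>"
    unfolding uniformly_continuous_on_def using \<epsilon> by metis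
  have "\<bar>f x - f y\<bar> < \<epsilon>" if xy: "norm (x - y - of_int_vec m) < min d 1" for x y and m :: "int ^ 'd"
  proof -
    obtain l :: "int ^ 'd" where l: "norm (y - of_int_vec l) \<le> real CARD('d)" by (rule torus_reduction)
    have eq: "x - of_int_vec (m + l) = (y - of_int_vec l) + (x - y - of_int_vec m)" by (simp add: of_int_vec_add algebra_simps)
    have "norm (x - of_int_vec (m + l)) \<le> real CARD('d) + 1"
      unfolding eq using l xy by (intro order.trans[OF norm_triangle_ineq]) auto
    moreover have "dist (x - of_int_vec (m + l)) (y - of_int_vec l) < d"
    proof -
      have d: "x - of_int_vec (m + l) - (y - of_int_vec l) = x - y - of_int_vec m" unfolding eq by simp
      show ?thesis unfolding dist_norm d using xy by simp
    qed
    ultimately have "dist (f (x - of_int_vec (m + l))) (f (y - of_int_vec l)) < \<epsilon>"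
      using l by (intro d(2)) auto
    then show ?thesis using f by (simp add: torus_function_diff dist_real_def)
  qed
  then show ?thesis using that[of "min d 1"] d(1) by simp
qed

lemma torus_bounded:
  fixes f :: "real ^ 'd \<Rightarrow> real"
  assumes f: "torus_function f" and c: "continuous_on UNIV f"
  obtains F where "\<And>x. \<bar>f x\<bar> \<le> F"
proof -
  have "compact (f ` cball 0 (real CARD('d)))"
    by (intro compact_continuous_image continuous_on_subset[OF c]) auto
  then obtain F where F: "\<And>x. x \<in> cball 0 (real CARD('d)) \<Longrightarrow> \<bar>f x\<bar> \<le> F"
    by (meson bounded_real compact_imp_bounded image_eqI)
  have "\<bar>f x\<bar> \<le> F" for x
  proof -
    obtain m :: "int ^ 'd" where "norm (x - of_int_vec m) \<le> real CARD('d)" by (rule torus_reduction)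
    then show ?thesis using F[of "x - of_int_vec m"] f by (simp add: torus_function_diff)
  qed
  then show ?thesis by (rule that)
qed

definition potential :: "real \<Rightarrow> (real ^ 'd \<Rightarrow> real) \<Rightarrow> real ^ 'd \<Rightarrow> real ^ 'd \<Rightarrow> (int \<Rightarrow> real) \<Rightarrow> int \<Rightarrow> real" where
  "potential c f \<alpha> \<theta> \<omega> n = c * f (\<theta> + of_int n *\<^sub>R \<alpha>) + \<omega> n"

text \<open>The energies that are approximate eigenvalues of some operator in the hull, the family of all
  operators with arbitrary phase \<open>\<theta>\<close> and arbitrary values of \<open>\<omega>\<close> in \<open>A\<close>. For \<open>A\<close> the support of \<open>\<nu>\<close>
  this set is the almost sure spectrum, and it visibly depends neither on \<open>\<theta>\<close> nor on \<open>\<omega>\<close>.\<close>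

definition hull_spectrum :: "real \<Rightarrow> (real ^ 'd \<Rightarrow> real) \<Rightarrow> real ^ 'd \<Rightarrow> real set \<Rightarrow> real set" where
  "hull_spectrum c f \<alpha> A = {E. \<forall>\<delta>>0. \<exists>\<theta> \<omega>. range \<omega> \<subseteq> A \<and> quasimode (potential c f \<alpha> \<theta> \<omega>) E \<delta>}"

lemma hull_spectrumD:
  "E \<in> hull_spectrum c f \<alpha> A \<Longrightarrow> \<delta> > 0 \<Longrightarrow> \<exists>\<theta> \<omega>. range \<omega> \<subseteq> A \<and> quasimode (potential c f \<alpha> \<theta> \<omega>) E \<delta>"
  by (simp add: hull_spectrum_def)

lemma potential_bound:
  assumes "\<And>x. \<bar>f x\<bar> \<le> F" "\<And>x. x \<in> A \<Longrightarrow> \<bar>x\<bar> \<le> B" "range \<omega> \<subseteq> A"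
  shows "\<bar>potential c f \<alpha> \<theta> \<omega> n\<bar> \<le> \<bar>c\<bar> * F + B"
proof -
  have "\<bar>c * f (\<theta> + of_int n *\<^sub>R \<alpha>)\<bar> \<le> \<bar>c\<bar> * F" unfolding abs_mult using assms(1) by (intro mult_left_mono) auto
  moreover have "\<bar>\<omega> n\<bar> \<le> B" using assms(2,3) by auto
  ultimately show ?thesis unfolding potential_def by linarith
qed

text \<open>Closedness comes from stability of quasimodes under small changes of the energy, boundedness from
  the uniform bound on the potentials.\<close>

lemma compact_hull_spectrum:
  assumes f: "\<And>x. \<bar>f x\<bar> \<le> F" and A: "bounded A"
  shows "compact (hull_spectrum c f \<alpha> A)"
proof -
  obtain B where B: "\<And>x. x \<in> A \<Longrightarrow> \<bar>x\<bar> \<le> B" using A by (auto simp: bounded_iff)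
  have "\<bar>E\<bar> \<le> \<bar>c\<bar> * F + B + 3" if E: "E \<in> hull_spectrum c f \<alpha> A" for E
  proof -
    obtain \<theta> \<omega> where \<omega>: "range \<omega> \<subseteq> A" and q: "quasimode (potential c f \<alpha> \<theta> \<omega>) E 1"
      using hull_spectrumD[OF E, of 1] by auto
    show ?thesis by (rule quasimode_energy_bound[OF q potential_bound[OF f B \<omega>]])
  qed
  then have "bounded (hull_spectrum c f \<alpha> A)" by (auto simp: bounded_iff)
  moreover have "closed (hull_spectrum c f \<alpha> A)"
  proof (rule closure_subset_eq[THEN iffD1], rule subsetI)
    fix E assume "E \<in> closure (hull_spectrum c f \<alpha> A)"
    then have E: "\<forall>e>0. \<exists>E'\<in>hull_spectrum c f \<alpha> A. dist E' E < e" by (simp add: closure_approachable)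
    show "E \<in> hull_spectrum c f \<alpha> A"
      unfolding hull_spectrum_def mem_Collect_eq
    proof (intro allI impI)
      fix \<delta> :: real assume \<delta>: "\<delta> > 0"
      then have "sqrt \<delta> / 2 > 0" by simp
      from E[rule_format, OF this] obtain E' where E': "E' \<in> hull_spectrum c f \<alpha> A" "dist E' E < sqrt \<delta> / 2" by blast
      then obtain \<theta> \<omega> where \<omega>: "range \<omega> \<subseteq> A" and q: "quasimode (potential c f \<alpha> \<theta> \<omega>) E' (\<delta> / 4)"
        using hull_spectrumD[OF E'(1), of "\<delta> / 4"] \<delta> by auto
      from quasimode_local[OF q] obtain N where
        N: "\<And>V' E'' k \<eta>. (\<And>n. \<bar>n\<bar> \<le> N \<Longrightarrow> \<bar>(V' (n + k) - E'') - (potential c f \<alpha> \<theta> \<omega> n - E')\<bar> \<le> \<eta>) \<Longrightarrow> quasimode V' E'' (2 * (\<delta> / 4) + 2 * \<eta>\<^sup>2)"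
        by metis
      have "quasimode (potential c f \<alpha> \<theta> \<omega>) E (2 * (\<delta> / 4) + 2 * (sqrt \<delta> / 2)\<^sup>2)"
        by (rule N[where k=0]) (use E'(2) in \<open>auto simp: dist_real_def\<close>)
      moreover have "2 * (\<delta> / 4) + 2 * (sqrt \<delta> / 2)\<^sup>2 = \<delta>" using \<delta> by (simp add: power_divide)
      ultimately have "quasimode (potential c f \<alpha> \<theta> \<omega>) E \<delta>" by simp
      then show "\<exists>\<theta> \<omega>. range \<omega> \<subseteq> A \<and> quasimode (potential c f \<alpha> \<theta> \<omega>) E \<delta>" using \<omega> by blast
    qed
  qed
  ultimately show ?thesis by (simp add: compact_eq_bounded_closed)
qed

text \<open>The return times of the rotation provide arbitrarily many disjoint windows at which the phase is
  nearly the one at site \<open>j\<close>; in one of them the random potential shows the prescribed pattern.\<close>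

lemma AE_hull_pattern:
  fixes f :: "real ^ 'd \<Rightarrow> real"
  assumes f: "torus_function f" "continuous_on UNIV f" and \<nu>: "real_distribution \<nu>"
    and xs: "set xs \<subseteq> topological_support \<nu>" and \<epsilon>: "\<epsilon> > 0"
  shows "AE \<omega> in Pi\<^sub>M UNIV (\<lambda>_::int. \<nu>). \<exists>k. 
    (\<forall>n. \<bar>f (\<theta> + of_int (n + k) *\<^sub>R \<alpha>) - f (\<theta> + of_int (n + j) *\<^sub>R \<alpha>)\<bar> < \<epsilon>) \<and> (\<forall>i<length xs. \<bar>\<omega> (k + int i) - xs ! i\<bar> < \<epsilon>)"
proof -
  define K where "K = {k. \<forall>n. \<bar>f (\<theta> + of_int (n + k) *\<^sub>R \<alpha>) - f (\<theta> + of_int (n + j) *\<^sub>R \<alpha>)\<bar> < \<epsilon>}"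
  obtain d where d: "d > 0" "\<And>x y m. norm (x - y - of_int_vec m) < d \<Longrightarrow> \<bar>f x - f y\<bar> < \<epsilon>"
    using torus_uniformly_continuous[OF f \<epsilon>] by metis
  have "AE \<omega> in Pi\<^sub>M UNIV (\<lambda>_::int. \<nu>). \<exists>k\<in>K. \<forall>i<length xs. \<omega> (k + int i) \<in> ball (xs ! i) \<epsilon>"
  proof (rule AE_pattern_occurs[OF \<nu>])
    fix i assume "i < length xs"
    then have "xs ! i \<in> topological_support \<nu>" using xs by auto
    then show "open (ball (xs ! i) \<epsilon>) \<and> 0 < measure \<nu> (ball (xs ! i) \<epsilon>)"
      using \<epsilon> unfolding topological_support_def by auto
  next
    fix J :: nat
    have "d / (real J + 1) > 0" using d by simp
    then obtain q :: int and m :: "int ^ 'd" where q: "q > int (length xs)" "norm (of_int q *\<^sub>R \<alpha> - of_int_vec m) < d / (real J + 1)"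
      by (rule orbit_returns)
    define k where "k i = j + int i * q" for i
    have "k i \<in> K" if i: "i < J" for i
      unfolding K_def
    proof (intro CollectI allI d(2))
      fix n
      have eq: "\<theta> + of_int (n + k i) *\<^sub>R \<alpha> - (\<theta> + of_int (n + j) *\<^sub>R \<alpha>) - of_int_vec (\<chi> l. int i * m $ l) = real i *\<^sub>R (of_int q *\<^sub>R \<alpha> - of_int_vec m)"
        unfolding of_int_vec_scale by (simp add: k_def algebra_simps)
      have "norm (real i *\<^sub>R (of_int q *\<^sub>R \<alpha> - of_int_vec m)) \<le> real i * (d / (real J + 1))"
        unfolding norm_scaleR using q(2) by (intro mult_mono) auto
      also have "\<dots> < d"
      proof -
        have "d * real i < d * (real J + 1)" using i d(1) by simp
        then show ?thesis by (simp add: field_simps)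
      qed
      finally show "norm (\<theta> + of_int (n + k i) *\<^sub>R \<alpha> - (\<theta> + of_int (n + j) *\<^sub>R \<alpha>) - of_int_vec (\<chi> l. int i * m $ l)) < d"
        unfolding eq .
    qed
    moreover have "k i + int (length xs) \<le> k i'" if "i < i'" for i i'
    proof -
      have "1 * q \<le> (int i' - int i) * q" using that q by (intro mult_right_mono) auto
      then show ?thesis using q by (simp add: k_def algebra_simps)
    qed
    ultimately show "\<exists>k. (\<forall>j<J. k j \<in> K) \<and> (\<forall>i j. i < j \<and> j < J \<longrightarrow> k i + int (length xs) \<le> k j)" by blast
  qed
  then show ?thesis
    by (rule AE_mp) (intro AE_I2 impI, auto simp: K_def dist_real_def abs_minus_commute)
qed

text \<open>Almost every \<open>\<omega>\<close> has all values in the support, which gives one inclusion. For the other, countably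
  many patterns over a dense subset of the support and countably many phases along the orbit
  approximate every piece of every operator in the hull. Almost surely all of these occur, so every
  quasimode in the hull can be transplanted to the given operator. Two compact sets with the
  defining property agree, because almost sure statements on a probability space are compatible.\<close>

theorem almost_sure_spectrum_eq_hull_spectrum:
  fixes f :: "real ^ 'd \<Rightarrow> real"
  assumes f: "torus_function f" "continuous_on UNIV f" 
    and irr: "\<And>m :: int ^ 'd. m \<noteq> 0 \<Longrightarrow> of_int_vec m \<bullet> \<alpha> \<notin> \<int>"
    and \<nu>: "real_distribution \<nu>" and supp: "compact (topological_support \<nu>)"
  shows "almost_sure_spectrum c f \<alpha> \<nu> = hull_spectrum c f \<alpha> (topological_support \<nu>)"
proof -
  interpret \<nu>: real_distribution \<nu> by (rule \<nu>)
  interpret product_prob_space "\<lambda>_::int. \<nu>" UNIV by unfold_locales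
  let ?M = "Pi\<^sub>M UNIV (\<lambda>_::int. \<nu>)"
  let ?A = "topological_support \<nu>"
  let ?S = "hull_spectrum c f \<alpha> ?A"
  obtain F where F: "\<And>x. \<bar>f x\<bar> \<le> F" using torus_bounded[OF f] by blast
  have bA: "bounded ?A" by (rule compact_imp_bounded[OF supp])
  then obtain B where B: "\<And>x. x \<in> ?A \<Longrightarrow> \<bar>x\<bar> \<le> B" by (auto simp: bounded_iff)
  obtain D where D: "countable D" "D \<subseteq> ?A" "?A \<subseteq> closure D" using separable[of ?A] by metis
  have spec: "ell2_spectrum (schroedinger_op c f \<alpha> \<theta> \<omega>) = complex_of_real ` {E. \<forall>\<delta>>0. quasimode (potential c f \<alpha> \<theta> \<omega>) E \<delta>}"
    if "range \<omega> \<subseteq> ?A" for \<theta> \<omega>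
  proof -
    have "schroedinger_op c f \<alpha> \<theta> \<omega> = (\<lambda>\<psi> n. \<psi> (n + 1) + \<psi> (n - 1) + complex_of_real (potential c f \<alpha> \<theta> \<omega> n) * \<psi> n)"
      by (intro ext) (simp add: schroedinger_op_def potential_def)
    then show ?thesis using schroedinger_spectrum[OF potential_bound[OF F B that]] by simp
  qed
  have ae: "AE \<omega> in ?M. ell2_spectrum (schroedinger_op c f \<alpha> \<theta> \<omega>) = complex_of_real ` ?S" for \<theta>
  proof -
    define good where "good xs j m \<omega> \<longleftrightarrow> (\<exists>k. 
      (\<forall>n. \<bar>f (\<theta> + of_int (n + k) *\<^sub>R \<alpha>) - f (\<theta> + of_int (n + j) *\<^sub>R \<alpha>)\<bar> < 1 / (real m + 1)) \<and> (\<forall>i<length xs. \<bar>\<omega> (k + int i) - xs ! i\<bar> < 1 / (real m + 1)))"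
      for xs and j :: int and m :: nat and \<omega> :: "int \<Rightarrow> real"
    have "AE \<omega> in ?M. good xs j m \<omega>" if "xs \<in> lists D" for xs j m
      unfolding good_def by (rule AE_hull_pattern[OF f \<nu>]) (use that D(2) in auto)
    then have "AE \<omega> in ?M. \<forall>xs\<in>lists D. \<forall>j m. good xs j m \<omega>"
      by (simp add: AE_ball_countable countable_lists[OF D(1)] AE_all_countable)
    moreover have "AE \<omega> in ?M. range \<omega> \<subseteq> ?A" by (rule AE_topological_support[OF \<nu>])
    ultimately show ?thesis
    proof eventually_elim
      case (elim \<omega>)
      have "E \<in> ?S" if "\<forall>\<delta>>0. quasimode (potential c f \<alpha> \<theta> \<omega>) E \<delta>" for E
        using that elim(2) unfolding hull_spectrum_def by blast
      moreover have "quasimode (potential c f \<alpha> \<theta> \<omega>) E \<delta>" if E: "E \<in> ?S" and \<delta>: "\<delta> > 0" for E \<delta>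
      proof -
        obtain \<theta>' \<omega>' where \<omega>': "range \<omega>' \<subseteq> ?A" and q: "quasimode (potential c f \<alpha> \<theta>' \<omega>') E (\<delta> / 4)"
          using hull_spectrumD[OF E, of "\<delta> / 4"] \<delta> by auto
        from quasimode_local[OF q] obtain N where
          N: "\<And>V' E'' k \<eta>. (\<And>n. \<bar>n\<bar> \<le> N \<Longrightarrow> \<bar>(V' (n + k) - E'') - (potential c f \<alpha> \<theta>' \<omega>' n - E)\<bar> \<le> \<eta>) \<Longrightarrow> quasimode V' E'' (2 * (\<delta> / 4) + 2 * \<eta>\<^sup>2)"
          by metis
        define \<eta> where "\<eta> = sqrt \<delta> / 2"
        have \<eta>: "\<eta> > 0" "2 * (\<delta> / 4) + 2 * \<eta>\<^sup>2 = \<delta>" using \<delta> by (simp_all add: \<eta>_def power_divide)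
        obtain m :: nat where m: "2 * (\<bar>c\<bar> + 1) / \<eta> < real m" using reals_Archimedean2 by blast
        define \<epsilon> where "\<epsilon> = 1 / (real m + 1)"
        have \<epsilon>: "\<epsilon> > 0" by (simp add: \<epsilon>_def)
        have \<epsilon>\<eta>: "2 * (\<bar>c\<bar> + 1) * \<epsilon> \<le> \<eta>" using m \<eta> by (simp add: \<epsilon>_def field_simps)
        obtain d where d: "d > 0" "\<And>x y m. norm (x - y - of_int_vec m) < d \<Longrightarrow> \<bar>f x - f y\<bar> < \<epsilon>"
          using torus_uniformly_continuous[OF f \<epsilon>] by metis
        obtain j and l :: "int ^ 'd" where jl: "norm (of_int j *\<^sub>R \<alpha> - of_int_vec l - (\<theta>' - \<theta>)) < d"
          using orbit_dense_mod_integers[OF irr d(1)] by metis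
        have fj: "\<bar>f (\<theta> + of_int (n + j) *\<^sub>R \<alpha>) - f (\<theta>' + of_int n *\<^sub>R \<alpha>)\<bar> < \<epsilon>" for n
        proof (rule d(2)[of _ _ l])
          have eq: "\<theta> + of_int (n + j) *\<^sub>R \<alpha> - (\<theta>' + of_int n *\<^sub>R \<alpha>) - of_int_vec l = of_int j *\<^sub>R \<alpha> - of_int_vec l - (\<theta>' - \<theta>)"
            by (simp add: algebra_simps)
          show "norm (\<theta> + of_int (n + j) *\<^sub>R \<alpha> - (\<theta>' + of_int n *\<^sub>R \<alpha>) - of_int_vec l) < d"
            unfolding eq by (rule jl)
        qed
        have "\<exists>x\<in>D. \<bar>x - \<omega>' n\<bar> < \<epsilon>" for n
        proof -
          have "\<omega>' n \<in> closure D" using \<omega>' D(3) by blast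
          then show ?thesis using \<epsilon> by (auto simp: closure_approachable dist_real_def)
        qed
        then obtain g where g: "\<And>n. g n \<in> D" "\<And>n. \<bar>g n - \<omega>' n\<bar> < \<epsilon>" by metis
        \<comment> \<open>The sites \<open>-N..N\<close> become the list positions \<open>0..2 N\<close>, so the phase to match is that at \<open>j - N\<close>.\<close>
        define xs where "xs = map (\<lambda>i. g (int i - N)) [0..<nat (2 * N + 1)]"
        have "xs \<in> lists D" using g(1) by (auto simp: xs_def)
        then have "good xs (j - N) m \<omega>" using elim(1) by blast
        then obtain k where kf: "\<And>n. \<bar>f (\<theta> + of_int (n + k) *\<^sub>R \<alpha>) - f (\<theta> + of_int (n + (j - N)) *\<^sub>R \<alpha>)\<bar> < \<epsilon>"
          and kx: "\<And>i. i < length xs \<Longrightarrow> \<bar>\<omega> (k + int i) - xs ! i\<bar> < \<epsilon>"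
          unfolding good_def \<epsilon>_def by blast
        have "\<bar>(potential c f \<alpha> \<theta> \<omega> (n + (k + N)) - E) - (potential c f \<alpha> \<theta>' \<omega>' n - E)\<bar> \<le> \<eta>" if n: "\<bar>n\<bar> \<le> N" for n
        proof -
          define i where "i = nat (n + N)"
          have i: "i < length xs" "int i = n + N" using n by (auto simp: i_def xs_def)
          have "xs ! i = g n" using i unfolding xs_def by simp
          then have "\<bar>\<omega> (n + (k + N)) - \<omega>' n\<bar> < 2 * \<epsilon>"
            using kx[OF i(1)] g(2)[of n] unfolding i(2) by (simp add: add_ac)
          moreover have "\<bar>f (\<theta> + of_int (n + (k + N)) *\<^sub>R \<alpha>) - f (\<theta>' + of_int n *\<^sub>R \<alpha>)\<bar> \<le> 2 * \<epsilon>"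
            using kf[of "n + N"] fj[of n] by (simp add: add_ac)
          then have "\<bar>c * (f (\<theta> + of_int (n + (k + N)) *\<^sub>R \<alpha>) - f (\<theta>' + of_int n *\<^sub>R \<alpha>))\<bar> \<le> \<bar>c\<bar> * (2 * \<epsilon>)"
            unfolding abs_mult by (rule mult_left_mono) auto
          ultimately have "\<bar>c * (f (\<theta> + of_int (n + (k + N)) *\<^sub>R \<alpha>) - f (\<theta>' + of_int n *\<^sub>R \<alpha>)) + (\<omega> (n + (k + N)) - \<omega>' n)\<bar> \<le> \<bar>c\<bar> * (2 * \<epsilon>) + 2 * \<epsilon>" by linarith
          also have "\<dots> \<le> \<eta>" using \<epsilon>\<eta> by (simp add: algebra_simps)
          finally show ?thesis by (simp add: potential_def algebra_simps)
        qed
        from N[of "potential c f \<alpha> \<theta> \<omega>" "k + N" E \<eta>, OF this] show ?thesis unfolding \<eta>(2) .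
      qed
      ultimately have "{E. \<forall>\<delta>>0. quasimode (potential c f \<alpha> \<theta> \<omega>) E \<delta>} = ?S" by blast
      then show ?case using spec[OF elim(2)] by simp
    qed
  qed
  show ?thesis
    unfolding almost_sure_spectrum_def
  proof (rule the_equality)
    show "is_almost_sure_spectrum c f \<alpha> \<nu> ?S"
      unfolding is_almost_sure_spectrum_def using ae compact_hull_spectrum[where f=f, OF F bA] by blast
    fix S' assume "is_almost_sure_spectrum c f \<alpha> \<nu> S'"
    then have "AE \<omega> in ?M. ell2_spectrum (schroedinger_op c f \<alpha> 0 \<omega>) = complex_of_real ` S'"
      unfolding is_almost_sure_spectrum_def by blast
    with ae[of 0] have "AE \<omega> in ?M. complex_of_real ` S' = complex_of_real ` ?S"
      by eventually_elim simp
    then have "complex_of_real ` S' = complex_of_real ` ?S" by simp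
    then show "S' = ?S" by (simp add: inj_image_eq_iff inj_of_real)
  qed
qed

section \<open>Finite differences of real-analytic functions\<close>

text \<open>Finite differences take the place of derivatives because they act exactly on discrete Fourier
  coefficients.\<close>

definition partial_difference :: "real \<Rightarrow> 'd \<Rightarrow> (real ^ 'd \<Rightarrow> real) \<Rightarrow> real ^ 'd \<Rightarrow> real" where
  "partial_difference h i f x = f (x + h *\<^sub>R axis i 1) - f x"

definition forward_difference :: "real \<Rightarrow> (real \<Rightarrow> real) \<Rightarrow> real \<Rightarrow> real" where
  "forward_difference h p u = p (u + h) - p u"

text \<open>The mean value theorem, once for every difference.\<close>

lemma forward_difference_bound:
  assumes h: "h \<ge> 0" and G: "\<And>j x. (G j has_real_derivative G (Suc j) x) (at x)"
    and B: "\<And>x. u \<le> x \<Longrightarrow> x \<le> u + real k * h \<Longrightarrow> \<bar>G k x\<bar> \<le> B"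
  shows "\<bar>(forward_difference h ^^ k) (G 0) u\<bar> \<le> h ^ k * B"
  using G B
proof (induction k arbitrary: G B)
  case 0
  then show ?case by simp
next
  case (Suc k)
  define G' where "G' j = forward_difference h (G j)" for j
  have "(forward_difference h ^^ Suc k) (G 0) u = (forward_difference h ^^ k) (G' 0) u"
    by (simp add: funpow_swap1 G'_def del: funpow.simps) (simp add: funpow_swap1)
  also have "\<bar>\<dots>\<bar> \<le> h ^ k * (h * B)"
  proof (rule Suc.IH)
    show "(G' j has_real_derivative G' (Suc j) x) (at x)" for j x
    proof -
      have "((\<lambda>x. G j (x + h)) has_real_derivative G (Suc j) (x + h)) (at x)"
        using DERIV_shift[of "G j" "G (Suc j) (x + h)" x h] Suc.prems(1) by (simp add: add.commute)
      then show ?thesis unfolding G'_def forward_difference_def[abs_def]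
        by (intro DERIV_diff Suc.prems(1))
    qed
    fix x assume x: "u \<le> x" "x \<le> u + real k * h"
    show "\<bar>G' k x\<bar> \<le> h * B"
    proof (cases "h = 0")
      case True
      then show ?thesis by (simp add: G'_def forward_difference_def)
    next
      case False
      then have "x < x + h" using h by simp
      from MVT2[OF this, of "G k" "G (Suc k)"] obtain z where z: "x < z" "z < x + h" "G k (x + h) - G k x = h * G (Suc k) z"
        using Suc.prems(1) by auto
      have "\<bar>G (Suc k) z\<bar> \<le> B" using z x by (intro Suc.prems(2)) (auto simp: algebra_simps)
      then have "h * \<bar>G (Suc k) z\<bar> \<le> h * B" using h by (rule mult_left_mono)
      then show ?thesis using h by (simp add: G'_def forward_difference_def z(3) abs_mult)
    qed
  qed
  finally show ?case by (simp add: mult_ac)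
qed

text \<open>A Cauchy estimate for monomials: the bound grows with \<open>n\<close> like the value \<open>s ^ n\<close> at the edge of the
  interval of twice the length, so it can be summed against the coefficients of a power series.\<close>

lemma forward_difference_monomial:
  fixes s u h :: real
  assumes s: "s > 0" and h: "h \<ge> 0" and u: "\<bar>u\<bar> \<le> s / 2" "\<bar>u + real k * h\<bar> \<le> s / 2"
  shows "\<bar>(forward_difference h ^^ k) (\<lambda>x. x ^ n) u\<bar> \<le> fact k * (2 / s * h) ^ k * s ^ n"
proof -
  define G where "G j x = real (n choose j) * fact j * x ^ (n - j)" for j and x :: real
  have der: "(G j has_real_derivative G (Suc j) x) (at x)" for j x
  proof (cases "j < n")
    case True
    have d: "(G j has_real_derivative real (n choose j) * fact j * (real (n - j) * x ^ (n - j - 1))) (at x)"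
      unfolding G_def[abs_def] by (auto intro!: derivative_eq_intros)
    have "(n choose j) * (n - j) = (n choose Suc j) * Suc j"
      using binomial_absorption[of j n] binomial_absorb_comp[of n j] by (simp add: mult.commute)
    then have "real (n choose j) * real (n - j) = real (n choose Suc j) * real (Suc j)"
      by (metis of_nat_mult)
    moreover have "real (n choose j) * fact j * (real (n - j) * x ^ (n - j - 1)) = real (n choose j) * real (n - j) * (fact j * x ^ (n - j - 1))"
      by (simp add: mult_ac)
    ultimately have "real (n choose j) * fact j * (real (n - j) * x ^ (n - j - 1)) = G (Suc j) x"
      by (simp add: G_def fact_Suc mult_ac del: of_nat_Suc)
    then show ?thesis using d by simp
  next
    case False
    then show ?thesis unfolding G_def[abs_def] by (simp add: binomial_eq_0)
  qed
  have "\<bar>G k x\<bar> \<le> fact k * (2 / s) ^ k * s ^ n" if "u \<le> x" "x \<le> u + real k * h" for x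
  proof (cases "k \<le> n")
    case True
    have x: "\<bar>x\<bar> \<le> s / 2" using that u by linarith
    have "real (n choose k) \<le> 2 ^ n" using binomial_le_pow2[of n k] by (metis of_nat_le_iff of_nat_numeral of_nat_power)
    then have "real (n choose k) * \<bar>x\<bar> ^ (n - k) \<le> 2 ^ n * (s / 2) ^ (n - k)"
      using x by (intro mult_mono power_mono) auto
    also have "\<dots> = (2 / s) ^ k * s ^ n"
    proof -
      have "(2::real) ^ n = 2 ^ k * 2 ^ (n - k)" "s ^ n = s ^ k * s ^ (n - k)" using True by (simp_all flip: power_add)
      then show ?thesis using s by (simp add: power_divide)
    qed
    finally have "fact k * (real (n choose k) * \<bar>x\<bar> ^ (n - k)) \<le> fact k * ((2 / s) ^ k * s ^ n)"
      by (rule mult_left_mono) auto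
    then show ?thesis by (simp add: G_def abs_mult power_abs mult_ac)
  next
    case False
    then show ?thesis using s by (simp add: G_def binomial_eq_0)
  qed
  from forward_difference_bound[where G=G, OF h der this]
  have "\<bar>(forward_difference h ^^ k) (G 0) u\<bar> \<le> h ^ k * (fact k * (2 / s) ^ k * s ^ n)" by blast
  moreover have "G 0 = (\<lambda>x. x ^ n)" by (simp add: G_def fun_eq_iff)
  moreover have "h ^ k * (fact k * (2 / s) ^ k * s ^ n) = fact k * (2 / s * h) ^ k * s ^ n"
    by (simp only: power_mult_distrib mult_ac)
  ultimately show ?thesis by simp
qed

text \<open>Differences in one coordinate only act on the factor that depends on it.\<close>

lemma partial_difference_separate:
  assumes C: "\<And>y. C (y + h *\<^sub>R axis i 1) = C y" and g: "\<And>y. g y = C y * p (y $ i - z)"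
  shows "(partial_difference h i ^^ k) g y = C y * (forward_difference h ^^ k) p (y $ i - z)"
proof (induction k arbitrary: y)
  case 0
  then show ?case by (simp add: g)
next
  case (Suc k)
  have "(y + h *\<^sub>R axis i 1) $ i - z = (y $ i - z) + h" by (simp add: axis_def)
  then show ?case
    unfolding funpow.simps o_def partial_difference_def[of h i "(partial_difference h i ^^ k) g"] Suc C
    by (simp add: forward_difference_def algebra_simps)
qed

lemma partial_difference_has_sum:
  fixes g :: "'k \<Rightarrow> real ^ 'd \<Rightarrow> real"
  assumes "\<And>j. j \<le> k \<Longrightarrow> ((\<lambda>\<kappa>. g \<kappa> (y + (real j * h) *\<^sub>R axis i 1)) has_sum f (y + (real j * h) *\<^sub>R axis i 1)) UNIV"
  shows "((\<lambda>\<kappa>. (partial_difference h i ^^ k) (g \<kappa>) y) has_sum (partial_difference h i ^^ k) f y) UNIV"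
  using assms
proof (induction k arbitrary: y)
  case 0
  then show ?case using 0[of 0] by simp
next
  case (Suc k)
  have 1: "((\<lambda>\<kappa>. (partial_difference h i ^^ k) (g \<kappa>) y) has_sum (partial_difference h i ^^ k) f y) UNIV"
    using Suc.prems by (intro Suc.IH) auto
  have 2: "((\<lambda>\<kappa>. (partial_difference h i ^^ k) (g \<kappa>) (y + h *\<^sub>R axis i 1)) has_sum (partial_difference h i ^^ k) f (y + h *\<^sub>R axis i 1)) UNIV"
  proof (intro Suc.IH)
    fix j assume "j \<le> k"
    then show "((\<lambda>\<kappa>. g \<kappa> (y + h *\<^sub>R axis i 1 + (real j * h) *\<^sub>R axis i 1)) has_sum f (y + h *\<^sub>R axis i 1 + (real j * h) *\<^sub>R axis i 1)) UNIV"
      using Suc.prems[of "Suc j"] by (simp add: algebra_simps)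
  qed
  show ?case
    unfolding funpow.simps o_def partial_difference_def[of h i "(partial_difference h i ^^ k) _"]
    by (intro has_sum_difference 1 2)
qed

text \<open>Unconditional convergence of a real series is absolute convergence, so the value at one corner of
  a cube dominates the series on the whole cube.\<close>

lemma real_analytic_local_cube:
  fixes f :: "real ^ 'd \<Rightarrow> real"
  assumes "real_analytic f"
  obtains s A a where "s > 0" "A \<ge> 0" "((\<lambda>\<kappa> :: 'd \<Rightarrow> nat. \<bar>a \<kappa>\<bar> * (\<Prod>i\<in>UNIV. s ^ \<kappa> i)) has_sum A) UNIV"
    "\<forall>y. (\<forall>i. \<bar>y $ i - z $ i\<bar> \<le> s) \<longrightarrow> ((\<lambda>\<kappa>. a \<kappa> * (\<Prod>i\<in>UNIV. (y $ i - z $ i) ^ \<kappa> i)) has_sum f y) UNIV"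
proof -
  obtain r a where r: "r > 0" and a: "\<And>y. y \<in> ball z r \<Longrightarrow> ((\<lambda>\<kappa> :: 'd \<Rightarrow> nat. a \<kappa> * (\<Prod>i\<in>UNIV. (y $ i - z $ i) ^ \<kappa> i)) has_sum f y) UNIV"
    using assms unfolding real_analytic_def by blast
  define s where "s = r / (2 * real CARD('d))"
  have s: "s > 0" using r by (simp add: s_def)
  have cube: "y \<in> ball z r" if "\<And>i. \<bar>y $ i - z $ i\<bar> \<le> s" for y
  proof -
    have "norm (y - z) \<le> (\<Sum>i\<in>UNIV. \<bar>(y - z) $ i\<bar>)" by (rule norm_le_l1_cart)
    also have "\<dots> \<le> (\<Sum>i\<in>(UNIV::'d set). s)" using that by (intro sum_mono) auto
    also have "\<dots> < r" using r by (simp add: s_def)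
    finally show ?thesis by (simp add: dist_norm norm_minus_commute)
  qed
  define y where "y = z + (\<chi> i. s)"
  have "y \<in> ball z r" using s by (intro cube) (simp add: y_def)
  from has_sum_imp_summable[OF a[OF this]]
  have "(\<lambda>\<kappa>. a \<kappa> * (\<Prod>i\<in>UNIV. s ^ \<kappa> i)) summable_on UNIV" by (simp add: y_def)
  then have "(\<lambda>\<kappa>. \<bar>a \<kappa>\<bar> * (\<Prod>i\<in>UNIV. s ^ \<kappa> i)) summable_on UNIV"
    using s by (subst (asm) summable_on_iff_abs_summable_on_real) (simp add: abs_mult abs_prod)
  then have A: "((\<lambda>\<kappa>. \<bar>a \<kappa>\<bar> * (\<Prod>i\<in>UNIV. s ^ \<kappa> i)) has_sum infsum (\<lambda>\<kappa>. \<bar>a \<kappa>\<bar> * (\<Prod>i\<in>UNIV. s ^ \<kappa> i)) UNIV) UNIV"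
    by (rule has_sum_infsum)
  moreover have "infsum (\<lambda>\<kappa>. \<bar>a \<kappa>\<bar> * (\<Prod>i\<in>UNIV. s ^ \<kappa> i)) UNIV \<ge> 0"
    using s by (intro infsum_nonneg mult_nonneg_nonneg prod_nonneg) auto
  ultimately show ?thesis using that[OF s] a cube by blast
qed

lemma abs_power_product_le:
  fixes x :: "real ^ 'd"
  assumes "\<And>i. \<bar>x $ i\<bar> \<le> s"
  shows "\<bar>\<Prod>i\<in>I. (x $ i) ^ \<kappa> i\<bar> \<le> (\<Prod>i\<in>I. s ^ \<kappa> i)"
  unfolding abs_prod power_abs using assms by (intro prod_mono) (auto intro: power_mono)

lemma real_analytic_continuous:
  fixes f :: "real ^ 'd \<Rightarrow> real"
  assumes "real_analytic f"
  shows "continuous_on UNIV f"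
proof (rule continuous_at_imp_continuous_on, rule ballI)
  fix z :: "real ^ 'd"
  obtain s A a where s: "s > 0" and A0: "A \<ge> 0" and A: "((\<lambda>\<kappa> :: 'd \<Rightarrow> nat. \<bar>a \<kappa>\<bar> * (\<Prod>i\<in>UNIV. s ^ \<kappa> i)) has_sum A) UNIV"
    and f: "\<forall>y. (\<forall>i. \<bar>y $ i - z $ i\<bar> \<le> s) \<longrightarrow> ((\<lambda>\<kappa>. a \<kappa> * (\<Prod>i\<in>UNIV. (y $ i - z $ i) ^ \<kappa> i)) has_sum f y) UNIV"
    by (rule real_analytic_local_cube[OF assms, of z])
  have c: "\<bar>y $ i - z $ i\<bar> \<le> s" if "y \<in> ball z s" for y i
  proof -
    have "\<bar>(y - z) $ i\<bar> \<le> norm (y - z)" by (rule component_le_norm_cart)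
    then show ?thesis using that by (simp add: dist_norm norm_minus_commute)
  qed
  have "uniform_limit (ball z s) (\<lambda>X y. \<Sum>\<kappa>\<in>X. a \<kappa> * (\<Prod>i\<in>UNIV. (y $ i - z $ i) ^ \<kappa> i)) f (finite_subsets_at_top UNIV)"
  proof (rule Weierstrass_m_test_general')
    show "((\<lambda>\<kappa>. a \<kappa> * (\<Prod>i\<in>UNIV. (y $ i - z $ i) ^ \<kappa> i)) has_sum f y) UNIV" if "y \<in> ball z s" for y
      using f c[OF that] by blast
    show "(\<lambda>\<kappa>. \<bar>a \<kappa>\<bar> * (\<Prod>i\<in>UNIV. s ^ \<kappa> i)) summable_on UNIV" by (rule has_sum_imp_summable[OF A])
    fix \<kappa> y assume "y \<in> ball z s"
    then have "\<bar>\<Prod>i\<in>UNIV. ((y - z) $ i) ^ \<kappa> i\<bar> \<le> (\<Prod>i\<in>UNIV. s ^ \<kappa> i)"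
      using c by (intro abs_power_product_le) auto
    then show "norm (a \<kappa> * (\<Prod>i\<in>UNIV. (y $ i - z $ i) ^ \<kappa> i)) \<le> \<bar>a \<kappa>\<bar> * (\<Prod>i\<in>UNIV. s ^ \<kappa> i)"
      by (simp add: abs_mult mult_left_mono)
  qed
  then have "continuous_on (ball z s) f"
    by (rule uniform_limit_theorem[rotated]) (auto intro!: always_eventually continuous_intros)
  then show "isCont f z" using s by (simp add: continuous_on_eq_continuous_at)
qed

lemma real_analytic_local_difference_bound:
  fixes f :: "real ^ 'd \<Rightarrow> real"
  assumes "real_analytic f"
  obtains A R \<eta> where "A \<ge> 0" "R \<ge> 0" "\<eta> > 0"
    "\<And>i x k h. x \<in> ball z \<eta> \<Longrightarrow> h \<ge> 0 \<Longrightarrow> real k * h \<le> \<eta> \<Longrightarrow> \<bar>(partial_difference h i ^^ k) f x\<bar> \<le> A * fact k * (R * h) ^ k"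
proof -
  obtain s A a where s: "s > 0" and A0: "A \<ge> 0" and A: "((\<lambda>\<kappa> :: 'd \<Rightarrow> nat. \<bar>a \<kappa>\<bar> * (\<Prod>i\<in>UNIV. s ^ \<kappa> i)) has_sum A) UNIV"
    and f: "\<forall>y. (\<forall>i. \<bar>y $ i - z $ i\<bar> \<le> s) \<longrightarrow> ((\<lambda>\<kappa>. a \<kappa> * (\<Prod>i\<in>UNIV. (y $ i - z $ i) ^ \<kappa> i)) has_sum f y) UNIV"
    by (rule real_analytic_local_cube[OF assms, of z])
  define g where "g \<kappa> y = a \<kappa> * (\<Prod>i\<in>UNIV. (y $ i - z $ i) ^ \<kappa> i)" for \<kappa> and y :: "real ^ 'd"
  have "\<bar>(partial_difference h i ^^ k) f x\<bar> \<le> A * fact k * (2 / s * h) ^ k"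
    if x: "x \<in> ball z (s / 4)" and h: "h \<ge> 0" and kh: "real k * h \<le> s / 4" for i x k h
  proof -
    have xc: "\<bar>x $ l - z $ l\<bar> \<le> s / 4" for l
    proof -
      have "\<bar>(x - z) $ l\<bar> \<le> norm (x - z)" by (rule component_le_norm_cart)
      then show ?thesis using x by (simp add: dist_norm norm_minus_commute)
    qed
    have sum: "((\<lambda>\<kappa>. (partial_difference h i ^^ k) (g \<kappa>) x) has_sum (partial_difference h i ^^ k) f x) UNIV"
    proof (rule partial_difference_has_sum)
      fix j assume "j \<le> k"
      then have jh: "0 \<le> real j * h" "real j * h \<le> s / 4" using h kh mult_right_mono[of "real j" "real k" h] by (simp, linarith)
      show "((\<lambda>\<kappa>. g \<kappa> (x + (real j * h) *\<^sub>R axis i 1)) has_sum f (x + (real j * h) *\<^sub>R axis i 1)) UNIV"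
        unfolding g_def
      proof (rule f[rule_format])
        fix l
        have "\<bar>((real j * h) *\<^sub>R axis i (1::real)) $ l\<bar> \<le> s / 4" using jh s by (simp add: axis_def)
        then show "\<bar>(x + (real j * h) *\<^sub>R axis i 1) $ l - z $ l\<bar> \<le> s" unfolding vector_add_component using xc[of l] s by linarith
      qed
    qed
    have bound: "norm ((partial_difference h i ^^ k) (g \<kappa>) x) \<le> fact k * (2 / s * h) ^ k * (\<bar>a \<kappa>\<bar> * (\<Prod>i\<in>UNIV. s ^ \<kappa> i))" for \<kappa>
    proof -
      define C where "C y = a \<kappa> * (\<Prod>l\<in>UNIV - {i}. (y $ l - z $ l) ^ \<kappa> l)" for y :: "real ^ 'd"
      have "(partial_difference h i ^^ k) (g \<kappa>) x = C x * (forward_difference h ^^ k) (\<lambda>u. u ^ \<kappa> i) (x $ i - z $ i)"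
      proof (rule partial_difference_separate)
        show "C (y + h *\<^sub>R axis i 1) = C y" for y
          unfolding C_def by (intro arg_cong2[where f="(*)"] refl prod.cong) (auto simp: axis_def)
        show "g \<kappa> y = C y * (y $ i - z $ i) ^ \<kappa> i" for y
          unfolding C_def g_def by (subst prod.remove[of UNIV i]) (auto simp: mult_ac)
      qed
      moreover have "\<bar>(forward_difference h ^^ k) (\<lambda>u. u ^ \<kappa> i) (x $ i - z $ i)\<bar> \<le> fact k * (2 / s * h) ^ k * s ^ \<kappa> i"
      proof (rule forward_difference_monomial[OF s h])
        show "\<bar>x $ i - z $ i\<bar> \<le> s / 2" using xc[of i] s by linarith
        have "0 \<le> real k * h" using h by simp
        then show "\<bar>x $ i - z $ i + real k * h\<bar> \<le> s / 2" using xc[of i] kh by linarith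
      qed
      moreover have "\<bar>C x\<bar> \<le> \<bar>a \<kappa>\<bar> * (\<Prod>l\<in>UNIV - {i}. s ^ \<kappa> l)"
      proof -
        have "\<bar>\<Prod>l\<in>UNIV - {i}. ((x - z) $ l) ^ \<kappa> l\<bar> \<le> (\<Prod>l\<in>UNIV - {i}. s ^ \<kappa> l)"
        proof (rule abs_power_product_le)
          show "\<bar>(x - z) $ l\<bar> \<le> s" for l unfolding vector_minus_component using xc[of l] s by linarith
        qed
        then show ?thesis by (simp add: C_def abs_mult mult_left_mono)
      qed
      ultimately have "norm ((partial_difference h i ^^ k) (g \<kappa>) x) \<le> (\<bar>a \<kappa>\<bar> * (\<Prod>l\<in>UNIV - {i}. s ^ \<kappa> l)) * (fact k * (2 / s * h) ^ k * s ^ \<kappa> i)"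
        unfolding real_norm_def by (simp only: abs_mult) (intro mult_mono, use s in \<open>auto intro!: mult_nonneg_nonneg prod_nonneg\<close>)
      also have "\<dots> = fact k * (2 / s * h) ^ k * (\<bar>a \<kappa>\<bar> * (\<Prod>i\<in>UNIV. s ^ \<kappa> i))"
      proof -
        have "(\<Prod>i\<in>UNIV. s ^ \<kappa> i) = s ^ \<kappa> i * (\<Prod>l\<in>UNIV - {i}. s ^ \<kappa> l)" by (rule prod.remove) auto
        then show ?thesis by (simp add: mult_ac)
      qed
      finally show ?thesis .
    qed
    have "norm ((partial_difference h i ^^ k) f x) \<le> fact k * (2 / s * h) ^ k * A"
      by (rule norm_infsum_le[OF sum has_sum_cmult_right[OF A] bound])
    then show ?thesis by (simp add: mult_ac)
  qed
  then show ?thesis using that[of A "2 / s" "s / 4"] A0 s by simp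
qed

lemma partial_difference_torus:
  fixes f :: "real ^ 'd \<Rightarrow> real"
  assumes "torus_function f"
  shows "torus_function ((partial_difference h i ^^ k) f)"
proof (induction k)
  case (Suc k)
  have eq: "x + of_int_vec m + h *\<^sub>R axis i 1 = (x + h *\<^sub>R axis i 1) + of_int_vec m" for x :: "real ^ 'd" and m
    by (simp add: add_ac)
  show ?case
    unfolding torus_function_def funpow.simps o_def partial_difference_def[of h i "(partial_difference h i ^^ k) f"] eq
    using Suc unfolding torus_function_def by metis
qed (simp add: assms)

text \<open>Compactness of a fundamental domain makes the local Cauchy estimates uniform.\<close>

lemma real_analytic_difference_bound:
  fixes f :: "real ^ 'd \<Rightarrow> real"
  assumes an: "real_analytic f" and tor: "torus_function f"
  obtains A R \<eta> where "A \<ge> 0" "R > 0" "\<eta> > 0"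
    "\<And>i x k h. h \<ge> 0 \<Longrightarrow> real k * h \<le> \<eta> \<Longrightarrow> \<bar>(partial_difference h i ^^ k) f x\<bar> \<le> A * fact k * (R * h) ^ k"
proof -
  have "\<forall>z. \<exists>A R \<eta>. A \<ge> 0 \<and> R \<ge> 0 \<and> \<eta> > 0 \<and> (\<forall>i x k h. x \<in> ball z \<eta> \<and> h \<ge> 0 \<and> real k * h \<le> \<eta> \<longrightarrow> \<bar>(partial_difference h i ^^ k) f x\<bar> \<le> A * fact k * (R * h) ^ k)"
  proof
    fix z :: "real ^ 'd"
    show "\<exists>A R \<eta>. A \<ge> 0 \<and> R \<ge> 0 \<and> \<eta> > 0 \<and> (\<forall>i x k h. x \<in> ball z \<eta> \<and> h \<ge> 0 \<and> real k * h \<le> \<eta> \<longrightarrow> \<bar>(partial_difference h i ^^ k) f x\<bar> \<le> A * fact k * (R * h) ^ k)"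
      by (rule real_analytic_local_difference_bound[OF an, of z]) blast
  qed
  then obtain A R \<eta> where loc: "\<And>z :: real ^ 'd. A z \<ge> 0 \<and> R z \<ge> (0::real) \<and> \<eta> z > 0 \<and> (\<forall>i x k h. x \<in> ball z (\<eta> z) \<and> h \<ge> 0 \<and> real k * h \<le> \<eta> z \<longrightarrow> \<bar>(partial_difference h i ^^ k) f x\<bar> \<le> A z * fact k * (R z * h) ^ k)"
    unfolding choice_iff by blast
  let ?S = "cball (0 :: real ^ 'd) (real CARD('d))"
  obtain Z where Z: "finite Z" "?S \<subseteq> (\<Union>z\<in>Z. ball z (\<eta> z))"
  proof (rule compactE_image[of ?S ?S "\<lambda>z. ball z (\<eta> z)"])
    show "?S \<subseteq> (\<Union>z\<in>?S. ball z (\<eta> z))" using loc by force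
  qed auto
  define A' where "A' = sum A Z"
  define R' where "R' = sum R Z + 1"
  define \<eta>' where "\<eta>' = Min (insert 1 (\<eta> ` Z))"
  have A': "A z \<le> A'" if "z \<in> Z" for z unfolding A'_def using loc Z that by (intro member_le_sum) auto
  have R': "R z \<le> R'" if "z \<in> Z" for z
  proof -
    have "R z \<le> sum R Z" using loc Z that by (intro member_le_sum) auto
    then show ?thesis by (simp add: R'_def)
  qed
  have \<eta>': "\<eta>' \<le> \<eta> z" if "z \<in> Z" for z unfolding \<eta>'_def using Z that by (intro Min_le) auto
  have pos: "A' \<ge> 0" "R' > 0" "\<eta>' > 0"
    using loc Z by (auto simp: A'_def R'_def \<eta>'_def intro!: sum_nonneg add_nonneg_pos)
  have "\<bar>(partial_difference h i ^^ k) f x\<bar> \<le> A' * fact k * (R' * h) ^ k" if h: "h \<ge> 0" "real k * h \<le> \<eta>'" for i x k h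
  proof -
    obtain m :: "int ^ 'd" where "norm (x - of_int_vec m) \<le> real CARD('d)" by (rule torus_reduction)
    then have "x - of_int_vec m \<in> ?S" by simp
    then obtain z where z: "z \<in> Z" "x - of_int_vec m \<in> ball z (\<eta> z)" using Z by blast
    have "\<bar>(partial_difference h i ^^ k) f x\<bar> = \<bar>(partial_difference h i ^^ k) f (x - of_int_vec m)\<bar>"
      using torus_function_diff[OF partial_difference_torus[OF tor]] by metis
    also have "\<dots> \<le> A z * fact k * (R z * h) ^ k"
      using loc[of z] z h \<eta>'[OF z(1)] by auto
    also have "\<dots> \<le> A' * fact k * (R' * h) ^ k"
      using A'[OF z(1)] R'[OF z(1)] loc[of z] h pos by (intro mult_mono power_mono) auto
    finally show ?thesis .
  qed
  then show ?thesis using that pos by blast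
qed

section \<open>Discrete Fourier analysis on the torus grid\<close>

text \<open>The distributive law, with families of indices written as vectors.\<close>

lemma sum_product_over_box:
  fixes g :: "'d::finite \<Rightarrow> 'a \<Rightarrow> 'b :: comm_semiring_1"
  assumes B: "\<And>i. finite (B i)"
  shows "(\<Sum>m\<in>{m :: 'a ^ 'd. \<forall>i. m $ i \<in> B i}. \<Prod>i\<in>UNIV. g i (m $ i)) = (\<Prod>i\<in>UNIV. \<Sum>x\<in>B i. g i x)"
proof -
  have "(\<Prod>i\<in>UNIV. \<Sum>x\<in>B i. g i x) = (\<Sum>q\<in>PiE UNIV B. \<Prod>i\<in>UNIV. g i (q i))"
    by (rule prod_sum_PiE) (use B in auto)
  also have "\<dots> = (\<Sum>m\<in>{m :: 'a ^ 'd. \<forall>i. m $ i \<in> B i}. \<Prod>i\<in>UNIV. g i (m $ i))"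
    by (rule sum.reindex_bij_witness[where i="\<lambda>m. ($) m" and j="\<lambda>q. vec_lambda q"]) (auto simp: PiE_def)
  finally show ?thesis by simp
qed

lemma finite_box: "(\<And>i. finite (B i)) \<Longrightarrow> finite {m :: 'a ^ 'd::finite. \<forall>i. m $ i \<in> B i}"
proof -
  assume B: "\<And>i. finite (B i)"
  have "finite (PiE UNIV B)" by (rule finite_PiE) (use B in auto)
  moreover have "{m :: 'a ^ 'd. \<forall>i. m $ i \<in> B i} \<subseteq> vec_lambda ` PiE UNIV B"
  proof
    fix m :: "'a ^ 'd" assume "m \<in> {m. \<forall>i. m $ i \<in> B i}"
    then show "m \<in> vec_lambda ` PiE UNIV B" by (intro image_eqI[of _ _ "($) m"]) (auto simp: PiE_def)
  qed
  ultimately show ?thesis by (rule finite_surj)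
qed

lemma sum_roots_of_unity:
  fixes M :: nat and a j :: int
  assumes M: "M > 0"
  shows "(\<Sum>x\<in>{a..<a + int M}. cis (2 * pi * of_int x * of_int j / M)) = (if int M dvd j then of_nat M else 0)"
proof -
  define z where "z = cis (2 * pi * of_int j / M)"
  have "(\<Sum>x\<in>{a..<a + int M}. cis (2 * pi * of_int x * of_int j / M)) = (\<Sum>k<M. cis (2 * pi * of_int (a + int k) * of_int j / M))"
    by (rule sum.reindex_bij_witness[where i="\<lambda>k. a + int k" and j="\<lambda>x. nat (x - a)"]) auto
  also have "\<dots> = (\<Sum>k<M. cis (2 * pi * of_int a * of_int j / M) * z ^ k)"
  proof (rule sum.cong[OF refl])
    fix k
    have "2 * pi * of_int (a + int k) * of_int j / M = 2 * pi * of_int a * of_int j / M + real k * (2 * pi * of_int j / M)"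
      by (simp add: add_divide_distrib algebra_simps)
    then show "cis (2 * pi * of_int (a + int k) * of_int j / M) = cis (2 * pi * of_int a * of_int j / M) * z ^ k"
      unfolding z_def Complex.DeMoivre cis_mult by (rule arg_cong)
  qed
  also have "\<dots> = cis (2 * pi * of_int a * of_int j / M) * (\<Sum>k<M. z ^ k)" by (simp add: sum_distrib_left)
  finally have eq: "(\<Sum>x\<in>{a..<a + int M}. cis (2 * pi * of_int x * of_int j / M)) = cis (2 * pi * of_int a * of_int j / M) * (\<Sum>k<M. z ^ k)" .
  show ?thesis
  proof (cases "int M dvd j")
    case True
    then obtain q where q: "j = int M * q" by blast
    have "cis (2 * pi * of_int x * of_int j / M) = 1" for x :: int
    proof -
      have "2 * pi * of_int x * of_int j / M = 2 * pi * of_int (x * q)" using M by (simp add: q)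
      then show ?thesis by (simp only: cis_multiple_2pi Ints_of_int)
    qed
    then show ?thesis using True by simp
  next
    case False
    have "z ^ M = 1"
    proof -
      have "real M * (2 * pi * of_int j / M) = 2 * pi * of_int j" using M by simp
      then show ?thesis unfolding z_def Complex.DeMoivre by (simp only: cis_multiple_2pi Ints_of_int)
    qed
    moreover have "z \<noteq> 1"
    proof
      assume "z = 1"
      then have "cos (2 * pi * of_int j / M) = 1" unfolding z_def by (metis cis.sel(1) one_complex.sel(1))
      then obtain n :: int where "2 * pi * of_int j / M = of_int n * 2 * pi" by (auto simp: cos_one_2pi_int)
      then have "(of_int j :: real) = of_int (n * int M)" using M by (simp add: field_simps)
      then have "j = n * int M" by (simp only: of_int_eq_iff)
      then show False using False by simp
    qed
    ultimately have "(\<Sum>k<M. z ^ k) = 0" by (simp add: geometric_sum)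
    then show ?thesis using False eq by simp
  qed
qed

definition grid :: "nat \<Rightarrow> (int ^ 'd) set" where
  "grid M = {j. \<forall>i. j $ i \<in> {0..<int M}}"

definition centered_box :: "nat \<Rightarrow> (int ^ 'd) set" where
  "centered_box M = {m. \<forall>i. m $ i \<in> {- (int M div 2)..<- (int M div 2) + int M}}"

definition grid_point :: "nat \<Rightarrow> int ^ 'd \<Rightarrow> real ^ 'd" where
  "grid_point M j = (1 / real M) *\<^sub>R of_int_vec j"

definition fourier_char :: "int ^ 'd \<Rightarrow> real ^ 'd \<Rightarrow> complex" where
  "fourier_char m x = cis (2 * pi * (of_int_vec m \<bullet> x))"

text \<open>Fourier coefficients computed from the values on the grid of mesh \<open>1 / M\<close>. They replace integrals
  over the torus: inversion is a finite computation, and passing to finer grids is a limit of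
  sequences.\<close>

definition discrete_fourier :: "nat \<Rightarrow> (real ^ 'd \<Rightarrow> real) \<Rightarrow> int ^ 'd \<Rightarrow> complex" where
  "discrete_fourier M f m = (\<Sum>j\<in>grid M. complex_of_real (f (grid_point M j)) * fourier_char (- m) (grid_point M j)) / of_nat (M ^ CARD('d))"

lemma finite_grid: "finite (grid M)" and finite_centered_box: "finite (centered_box M)"
  unfolding grid_def centered_box_def by (rule finite_box, simp)+

lemma fourier_char_prod: "fourier_char m (grid_point M j) = (\<Prod>i\<in>UNIV. cis (2 * pi * of_int (m $ i) * of_int (j $ i) / M))"
proof -
  have c: "cis (\<Sum>i\<in>I. t i) = (\<Prod>i\<in>I. cis (t i))" for I and t :: "'a \<Rightarrow> real"
    by (induction I rule: infinite_finite_induct) (auto simp: cis_mult[symmetric])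
  have "2 * pi * (of_int_vec m \<bullet> grid_point M j) = (\<Sum>i\<in>UNIV. 2 * pi * of_int (m $ i) * of_int (j $ i) / M)"
    by (simp add: grid_point_def inner_vec_def of_int_vec_def sum_distrib_left sum_divide_distrib mult_ac)
  then show ?thesis unfolding fourier_char_def by (simp only: c)
qed

text \<open>The sum factorises over the coordinates into sums of roots of unity.\<close>

lemma grid_orthogonality:
  fixes j :: "int ^ 'd"
  assumes M: "M > 0"
  shows "(\<Sum>m\<in>centered_box M. fourier_char m (grid_point M j)) = (if \<forall>i. int M dvd j $ i then of_nat (M ^ CARD('d)) else 0)"
proof -
  have "(\<Sum>m\<in>centered_box M. fourier_char m (grid_point M j)) = (\<Prod>i\<in>UNIV. \<Sum>x\<in>{- (int M div 2)..<- (int M div 2) + int M}. cis (2 * pi * of_int x * of_int (j $ i) / M))"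
    unfolding centered_box_def fourier_char_prod
    by (rule sum_product_over_box[where B="\<lambda>_. {- (int M div 2)..<- (int M div 2) + int M}" and g="\<lambda>i x. cis (2 * pi * of_int x * of_int (j $ i) / M)"]) simp
  also have "\<dots> = (\<Prod>i\<in>UNIV. if int M dvd j $ i then of_nat M else 0)"
    by (simp only: sum_roots_of_unity[OF M])
  also have "\<dots> = (if \<forall>i. int M dvd j $ i then of_nat (M ^ CARD('d)) else 0)"
  proof (cases "\<forall>i. int M dvd j $ i")
    case False
    then obtain i where "\<not> int M dvd j $ i" by blast
    then have "(\<Prod>i\<in>UNIV. if int M dvd j $ i then of_nat M else (0::complex)) = 0" by (intro prod_zero) auto
    then show ?thesis using False by simp
  qed simp
  finally show ?thesis .
qed

text \<open>Periodicity: on the grid only residues modulo \<open>M\<close> matter.\<close>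

lemma torus_grid_mod:
  fixes f :: "real ^ 'd \<Rightarrow> 'b"
  assumes f: "torus_function f" and M: "M > 0" and d: "\<And>i. int M dvd j $ i - j' $ i"
  shows "f (grid_point M j) = f (grid_point M j')"
proof -
  define m :: "int ^ 'd" where "m = (\<chi> i. (j $ i - j' $ i) div int M)"
  have "grid_point M j = grid_point M j' + of_int_vec m"
  proof (subst vec_eq_iff, rule allI)
    fix i
    have "j $ i - j' $ i = int M * (m $ i)" using d[of i] by (simp add: m_def)
    then have "j $ i = j' $ i + int M * (m $ i)" by simp
    then have "(of_int (j $ i) :: real) = of_int (j' $ i) + real M * of_int (m $ i)" by simp
    then show "grid_point M j $ i = (grid_point M j' + of_int_vec m) $ i"
      using M by (simp add: grid_point_def of_int_vec_def field_simps)
  qed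
  then show ?thesis using f unfolding torus_function_def by metis
qed

lemma torus_fourier_char: "torus_function (fourier_char m)"
  unfolding torus_function_def
proof (intro allI)
  fix x and l :: "int ^ 'a"
  have "(of_int_vec m :: real ^ 'a) \<bullet> of_int_vec l = of_int (\<Sum>i\<in>UNIV. m $ i * l $ i)"
    by (simp add: inner_vec_def of_int_vec_def)
  then have "2 * pi * ((of_int_vec m :: real ^ 'a) \<bullet> (x + of_int_vec l)) = 2 * pi * (of_int_vec m \<bullet> x) + 2 * pi * of_int (\<Sum>i\<in>UNIV. m $ i * l $ i)"
    by (simp add: inner_add_right algebra_simps)
  then have "fourier_char m (x + of_int_vec l) = cis (2 * pi * (of_int_vec m \<bullet> x)) * cis (2 * pi * of_int (\<Sum>i\<in>UNIV. m $ i * l $ i))"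
    unfolding fourier_char_def cis_mult by (rule arg_cong)
  also have "cis (2 * pi * of_int (\<Sum>i\<in>UNIV. m $ i * l $ i)) = 1" by (rule cis_multiple_2pi) (rule Ints_of_int)
  finally show "fourier_char m (x + of_int_vec l) = fourier_char m x" by (simp add: fourier_char_def)
qed

lemma fourier_char_minus: "fourier_char (- m) x * fourier_char m y = fourier_char m (y - x)"
  by (simp add: fourier_char_def cis_mult of_int_vec_minus inner_diff_right algebra_simps)

lemma grid_point_diff: "grid_point M j - grid_point M j' = grid_point M (j - j')"
  by (simp add: grid_point_def of_int_vec_diff scaleR_diff_right)

theorem discrete_fourier_inversion:
  fixes f :: "real ^ 'd \<Rightarrow> real"
  assumes f: "torus_function f" and M: "M > 0"
  shows "(\<Sum>m\<in>centered_box M. discrete_fourier M f m * fourier_char m (grid_point M j)) = complex_of_real (f (grid_point M j))"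
proof -
  let ?N = "of_nat (M ^ CARD('d)) :: complex"
  have N: "?N \<noteq> 0" using M by simp
  define j0 :: "int ^ 'd" where "j0 = (\<chi> i. j $ i mod int M)"
  have j0: "j0 \<in> grid M" using M by (simp add: j0_def grid_def)
  have "(\<Sum>m\<in>centered_box M. discrete_fourier M f m * fourier_char m (grid_point M j)) 
     = (\<Sum>m\<in>centered_box M. \<Sum>l\<in>grid M. complex_of_real (f (grid_point M l)) / ?N * fourier_char m (grid_point M (j - l)))"
    unfolding discrete_fourier_def sum_divide_distrib sum_distrib_right grid_point_diff[symmetric] fourier_char_minus[symmetric]
    by (simp add: mult_ac)
  also have "\<dots> = (\<Sum>l\<in>grid M. complex_of_real (f (grid_point M l)) / ?N * (\<Sum>m\<in>centered_box M. fourier_char m (grid_point M (j - l))))"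
    by (subst sum.swap) (simp add: sum_distrib_left)
  also have "\<dots> = (\<Sum>l\<in>grid M. if l = j0 then complex_of_real (f (grid_point M l)) else 0)"
  proof (rule sum.cong[OF refl])
    fix l :: "int ^ 'd" assume l: "l \<in> grid M"
    have "(\<forall>i. int M dvd (j - l) $ i) \<longleftrightarrow> l = j0"
    proof
      assume a: "\<forall>i. int M dvd (j - l) $ i"
      show "l = j0"
      proof (subst vec_eq_iff, rule allI)
        fix i
        have "j $ i mod int M = l $ i mod int M" using a by (simp add: mod_eq_dvd_iff)
        then show "l $ i = j0 $ i" using l by (simp add: j0_def grid_def)
      qed
    next
      assume "l = j0"
      then show "\<forall>i. int M dvd (j - l) $ i" by (simp add: j0_def mod_eq_dvd_iff[symmetric])
    qed
    then show "complex_of_real (f (grid_point M l)) / ?N * (\<Sum>m\<in>centered_box M. fourier_char m (grid_point M (j - l))) = (if l = j0 then complex_of_real (f (grid_point M l)) else 0)"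
      unfolding grid_orthogonality[OF M] using N by (simp only: if_distrib) simp
  qed
  also have "\<dots> = complex_of_real (f (grid_point M j0))" by (subst sum.delta[OF finite_grid]) (use j0 in simp)
  also have "f (grid_point M j0) = f (grid_point M j)"
    by (rule torus_grid_mod[OF f M]) (simp add: j0_def mod_eq_dvd_iff[symmetric])
  finally show ?thesis .
qed

lemma sum_grid_shift:
  fixes F :: "real ^ 'd \<Rightarrow> complex"
  assumes F: "torus_function F" and M: "M > 0"
  shows "(\<Sum>j\<in>grid M. F (grid_point M j + grid_point M l)) = (\<Sum>j\<in>grid M. F (grid_point M j))"
proof -
  define red where "red j = (\<chi> i. j $ i mod int M)" for j :: "int ^ 'd"
  have red: "red j \<in> grid M" for j using M by (simp add: red_def grid_def)
  have red_id: "red j = j" if "j \<in> grid M" for j using that by (simp add: red_def grid_def vec_eq_iff)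
  have Fred: "F (grid_point M (red j)) = F (grid_point M j)" for j
    by (rule torus_grid_mod[OF F M]) (simp add: red_def mod_eq_dvd_iff[symmetric])
  have rr: "red (red (j + l) - l) = red j" "red (red (j - l) + l) = red j" for j
    by (simp_all add: red_def vec_eq_iff mod_simps)
  have "(\<Sum>j\<in>grid M. F (grid_point M (red (j + l)))) = (\<Sum>j\<in>grid M. F (grid_point M j))"
    by (rule sum.reindex_bij_witness[where i="\<lambda>j. red (j - l)" and j="\<lambda>j. red (j + l)"]) (auto simp: red rr red_id)
  moreover have "grid_point M j + grid_point M l = grid_point M (j + l)" for j
    by (simp add: grid_point_def of_int_vec_add scaleR_add_right)
  ultimately show ?thesis by (simp add: Fred)
qed

text \<open>Translation by one grid step multiplies the coefficient by a root of unity.\<close>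

lemma discrete_fourier_difference:
  fixes f :: "real ^ 'd \<Rightarrow> real"
  assumes f: "torus_function f" and M: "M > 0"
  shows "discrete_fourier M (partial_difference (1 / M) i f) m = (cis (2 * pi * of_int (m $ i) / M) - 1) * discrete_fourier M f m"
proof -
  define l :: "int ^ 'd" where "l = axis i 1"
  have l: "grid_point M l = (1 / M) *\<^sub>R axis i 1"
    by (simp add: grid_point_def l_def of_int_vec_def vec_eq_iff axis_def)
  define F where "F x = complex_of_real (f x) * fourier_char (- m) x" for x
  have F: "torus_function F" using f torus_fourier_char[of "- m"] unfolding torus_function_def F_def by metis
  have e: "fourier_char m (grid_point M l) = cis (2 * pi * of_int (m $ i) / M)"
    unfolding fourier_char_def l by (simp add: inner_axis of_int_vec_def)
  have c: "fourier_char (- m) x = fourier_char m (grid_point M l) * fourier_char (- m) (x + grid_point M l)" for x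
    unfolding fourier_char_def cis_mult by (simp add: of_int_vec_minus inner_add_right algebra_simps)
  have "complex_of_real (f (x + grid_point M l)) * fourier_char (- m) x = fourier_char m (grid_point M l) * F (x + grid_point M l)" for x
    unfolding F_def by (subst c) (simp only: mult_ac)
  then have "(\<Sum>j\<in>grid M. complex_of_real (f (grid_point M j + grid_point M l)) * fourier_char (- m) (grid_point M j)) 
     = fourier_char m (grid_point M l) * (\<Sum>j\<in>grid M. F (grid_point M j + grid_point M l))"
    by (simp add: sum_distrib_left)
  also have "\<dots> = fourier_char m (grid_point M l) * (\<Sum>j\<in>grid M. F (grid_point M j))"
    by (simp only: sum_grid_shift[OF F M])
  finally have "(\<Sum>j\<in>grid M. complex_of_real (partial_difference (1 / M) i f (grid_point M j)) * fourier_char (- m) (grid_point M j)) 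
     = (fourier_char m (grid_point M l) - 1) * (\<Sum>j\<in>grid M. F (grid_point M j))"
    unfolding partial_difference_def l[symmetric] of_real_diff left_diff_distrib sum_subtractf by (simp add: F_def)
  then show ?thesis unfolding discrete_fourier_def e by (simp add: F_def)
qed

lemma discrete_fourier_bound:
  fixes f :: "real ^ 'd \<Rightarrow> real"
  assumes f: "\<And>x. \<bar>f x\<bar> \<le> B" and M: "M > 0"
  shows "cmod (discrete_fourier M f m) \<le> B"
proof -
  have "cmod (\<Sum>j\<in>grid M. complex_of_real (f (grid_point M j)) * fourier_char (- m) (grid_point M j)) \<le> (\<Sum>j\<in>(grid M :: (int ^ 'd) set). B)"
    by (rule sum_norm_le) (use f in \<open>simp add: norm_mult fourier_char_def\<close>)
  also have "(\<Sum>j\<in>(grid M :: (int ^ 'd) set). B) = real (M ^ CARD('d)) * B"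
  proof -
    have "(\<Sum>j\<in>(grid M :: (int ^ 'd) set). \<Prod>i\<in>(UNIV :: 'd set). (1::real)) = (\<Prod>i\<in>(UNIV :: 'd set). \<Sum>x\<in>{0..<int M}. 1)"
      unfolding grid_def by (rule sum_product_over_box) simp
    then show ?thesis by simp
  qed
  finally show ?thesis
    using M unfolding discrete_fourier_def norm_divide norm_of_nat by (simp add: divide_le_eq mult.commute)
qed

section \<open>Fourier series of real-analytic functions\<close>

lemma cis_minus_one_ge:
  assumes "\<bar>x\<bar> \<le> 1 / 2"
  shows "4 * \<bar>x\<bar> \<le> cmod (cis (2 * pi * x) - 1)"
proof -
  have "cmod (cis (2 * pi * x) - 1) = 2 * \<bar>sin (pi * x)\<bar>"
    using dist_exp_i_1[of "2 * pi * x"] by (simp add: cis_conv_exp)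
  moreover have "2 * \<bar>x\<bar> \<le> sin (pi * \<bar>x\<bar>)" by (rule twice_le_sin_pi) (use assms in auto)
  moreover have "sin (pi * \<bar>x\<bar>) \<le> \<bar>sin (pi * x)\<bar>" by (cases "x \<ge> 0") auto
  ultimately show ?thesis by linarith
qed

lemma discrete_fourier_iterated_difference:
  fixes f :: "real ^ 'd \<Rightarrow> real"
  assumes "torus_function f" "M > 0"
  shows "discrete_fourier M ((partial_difference (1 / M) i ^^ k) f) m = (cis (2 * pi * of_int (m $ i) / M) - 1) ^ k * discrete_fourier M f m"
proof (induction k)
  case (Suc k)
  have "discrete_fourier M ((partial_difference (1 / M) i ^^ Suc k) f) m = (cis (2 * pi * of_int (m $ i) / M) - 1) * discrete_fourier M ((partial_difference (1 / M) i ^^ k) f) m"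
    unfolding funpow.simps o_def
    by (rule discrete_fourier_difference[OF partial_difference_torus[OF assms(1)] assms(2)])
  then show ?case by (simp add: Suc mult.assoc)
qed simp

text \<open>Taking \<open>k\<close> differences in direction \<open>i\<close> multiplies the coefficient by a factor of modulus at least
  \<open>(4 |m i| / M) ^ k\<close>, while the differences are at most \<open>A k! (R / M) ^ k\<close>. The powers of \<open>M\<close> cancel, and
  \<open>k\<close> proportional to \<open>|m i|\<close> gives exponential decay, uniformly in \<open>M\<close>. The best direction is that
  of the largest coordinate of \<open>m\<close>.\<close>

lemma discrete_fourier_decay:
  fixes f :: "real ^ 'd \<Rightarrow> real"
  assumes an: "real_analytic f" and tor: "torus_function f"
  obtains C \<gamma> where "C \<ge> 0" "\<gamma> > 0"
    "\<And>M m. M > 0 \<Longrightarrow> m \<in> centered_box M \<Longrightarrow> cmod (discrete_fourier M f m) \<le> C * (\<Prod>i\<in>UNIV. exp (- \<gamma> * \<bar>of_int (m $ i)\<bar>))"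
proof -
  obtain A R \<eta> where A: "A \<ge> 0" and R: "R > 0" and \<eta>: "\<eta> > 0"
    and diff: "\<And>i x k h. h \<ge> 0 \<Longrightarrow> real k * h \<le> \<eta> \<Longrightarrow> \<bar>(partial_difference h i ^^ k) f x\<bar> \<le> A * fact k * (R * h) ^ k"
    using real_analytic_difference_bound[OF an tor] by blast
  \<comment> \<open>With about \<open>\<beta> |m i|\<close> differences of step \<open>1 / M\<close>, their total length stays below \<open>\<eta>\<close> because \<open>2 |m i| \<le> M\<close>.\<close>
  define \<beta> where "\<beta> = min (2 * \<eta>) (1 / R)"
  have \<beta>: "\<beta> > 0" "\<beta> \<le> 2 * \<eta>" "\<beta> * R \<le> 1"
  proof -
    have "\<beta> * R \<le> 1 / R * R" using R by (intro mult_right_mono) (auto simp: \<beta>_def)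
    then show "\<beta> > 0" "\<beta> \<le> 2 * \<eta>" "\<beta> * R \<le> 1" using R \<eta> by (auto simp: \<beta>_def)
  qed
  define d where "d = real CARD('d)"
  have d: "d > 0" by (simp add: d_def)
  define \<gamma> where "\<gamma> = \<beta> / d"
  have one: "cmod (discrete_fourier M f m) \<le> A * exp (1 - \<beta> * \<bar>of_int (m $ i)\<bar>)"
    if M: "M > 0" and m: "m \<in> centered_box M" for M m i
  proof -
    define q where "q = \<bar>real_of_int (m $ i)\<bar>"
    define k where "k = nat \<lfloor>\<beta> * q\<rfloor>"
    have q0: "q \<ge> 0" by (simp add: q_def)
    have k: "real k \<le> \<beta> * q" "\<beta> * q \<le> real k + 1" using \<beta> q0 by (auto simp: k_def)
    have qM: "2 * q \<le> real M"
    proof -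
      have "m $ i \<in> {- (int M div 2)..<- (int M div 2) + int M}" using m by (simp add: centered_box_def)
      then have "2 * \<bar>m $ i\<bar> \<le> int M" by auto
      then have "real_of_int (2 * \<bar>m $ i\<bar>) \<le> real_of_int (int M)" by (simp only: of_int_le_iff)
      then show ?thesis by (simp add: q_def)
    qed
    have kM: "real k * (1 / real M) \<le> \<eta>"
    proof -
      have "2 * (\<beta> * q) \<le> \<beta> * real M" using mult_left_mono[OF qM, of \<beta>] \<beta> by simp
      also have "\<dots> \<le> 2 * \<eta> * real M" using \<beta> by (intro mult_right_mono) auto
      finally show ?thesis using k M by (simp add: field_simps)
    qed
    have "cmod (discrete_fourier M ((partial_difference (1 / M) i ^^ k) f) m) \<le> A * fact k * (R * (1 / M)) ^ k"
      by (rule discrete_fourier_bound[OF diff M]) (use kM in auto)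
    then have up: "cmod (cis (2 * pi * of_int (m $ i) / M) - 1) ^ k * cmod (discrete_fourier M f m) \<le> A * fact k * (R / M) ^ k"
      unfolding discrete_fourier_iterated_difference[OF tor M] by (simp add: norm_mult norm_power)
    have "4 * \<bar>of_int (m $ i) / real M\<bar> \<le> cmod (cis (2 * pi * (of_int (m $ i) / real M)) - 1)"
      by (rule cis_minus_one_ge) (use qM M in \<open>simp add: q_def field_simps\<close>)
    then have low: "4 * q / M \<le> cmod (cis (2 * pi * of_int (m $ i) / M) - 1)" by (simp add: q_def)
    have "cmod (discrete_fourier M f m) \<le> A * exp (- real k)"
    proof (cases "k = 0")
      case True
      then show ?thesis using up by simp
    next
      case False
      then have "q > 0" using k q0 by (cases "q = 0") auto
      then have pos: "4 * q / M > 0" using M by simp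
      have "(4 * q / M) ^ k * cmod (discrete_fourier M f m) \<le> cmod (cis (2 * pi * of_int (m $ i) / M) - 1) ^ k * cmod (discrete_fourier M f m)"
        using low pos by (intro mult_right_mono power_mono) auto
      also have "\<dots> \<le> A * fact k * (R / M) ^ k" by (rule up)
      also have "\<dots> \<le> A * (\<beta> * q) ^ k * (R / M) ^ k"
      proof (intro mult_right_mono mult_left_mono)
        have "fact k \<le> real k ^ k" using fact_le_power[of k, where 'a=real] by simp
        also have "\<dots> \<le> (\<beta> * q) ^ k" using k by (intro power_mono) auto
        finally show "fact k \<le> (\<beta> * q) ^ k" .
      qed (use A R in auto)
      also have "\<dots> = A * (\<beta> * R / 4) ^ k * (4 * q / M) ^ k"
        by (simp add: power_mult_distrib power_divide)
      finally have "(4 * q / M) ^ k * cmod (discrete_fourier M f m) \<le> (4 * q / M) ^ k * (A * (\<beta> * R / 4) ^ k)" by (simp only: mult_ac)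
      then have "cmod (discrete_fourier M f m) \<le> A * (\<beta> * R / 4) ^ k" by (rule mult_left_le_imp_le) (use pos in simp)
      also have "\<dots> \<le> A * (exp (- 1)) ^ k"
      proof (intro mult_left_mono power_mono)
        have "exp (-1::real) \<ge> 1 / 3" using exp_le by (simp add: exp_minus field_simps)
        then show "\<beta> * R / 4 \<le> exp (- 1)" using \<beta> by simp
      qed (use A \<beta> R in auto)
      also have "exp (- 1 :: real) ^ k = exp (- real k)" by (simp add: exp_of_nat_mult[symmetric])
      finally show ?thesis .
    qed
    also have "\<dots> \<le> A * exp (1 - \<beta> * q)" using k A by (intro mult_left_mono) auto
    finally show ?thesis by (simp add: q_def)
  qed
  have "cmod (discrete_fourier M f m) \<le> A * exp 1 * (\<Prod>i\<in>UNIV. exp (- \<gamma> * \<bar>of_int (m $ i)\<bar>))"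
    if M: "M > 0" and m: "m \<in> centered_box M" for M m
  proof -
    have "Max (range (\<lambda>i. \<bar>m $ i\<bar>)) \<in> range (\<lambda>i. \<bar>m $ i\<bar>)" by (rule Max_in) auto
    then obtain i where i: "Max (range (\<lambda>i. \<bar>m $ i\<bar>)) = \<bar>m $ i\<bar>" by (rule rangeE)
    have mi: "\<bar>m $ l\<bar> \<le> \<bar>m $ i\<bar>" for l unfolding i[symmetric] by (rule Max_ge) auto
    have "(\<Sum>l\<in>UNIV. \<bar>real_of_int (m $ l)\<bar>) \<le> (\<Sum>l\<in>(UNIV::'d set). \<bar>real_of_int (m $ i)\<bar>)"
      by (rule sum_mono) (use mi in \<open>simp flip: of_int_abs\<close>)
    then have "(\<Sum>l\<in>UNIV. \<bar>real_of_int (m $ l)\<bar>) \<le> d * \<bar>real_of_int (m $ i)\<bar>" by (simp add: d_def)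
    then have "\<gamma> * (\<Sum>l\<in>UNIV. \<bar>real_of_int (m $ l)\<bar>) \<le> \<gamma> * (d * \<bar>real_of_int (m $ i)\<bar>)"
      using \<beta> d by (intro mult_left_mono) (auto simp: \<gamma>_def)
    also have "\<dots> = \<beta> * \<bar>real_of_int (m $ i)\<bar>" using d by (simp add: \<gamma>_def)
    finally have "exp (1 - \<beta> * \<bar>of_int (m $ i)\<bar>) \<le> exp (1 + (\<Sum>l\<in>UNIV. - \<gamma> * \<bar>real_of_int (m $ l)\<bar>))"
      by (simp add: sum_negf sum_distrib_left)
    also have "\<dots> = exp 1 * (\<Prod>l\<in>UNIV. exp (- \<gamma> * \<bar>of_int (m $ l)\<bar>))"
      by (simp only: exp_add exp_sum finite)
    finally have "A * exp (1 - \<beta> * \<bar>of_int (m $ i)\<bar>) \<le> A * (exp 1 * (\<Prod>l\<in>UNIV. exp (- \<gamma> * \<bar>of_int (m $ l)\<bar>)))"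
      using A by (rule mult_left_mono)
    then show ?thesis using one[OF M m, of i] by (simp add: mult.assoc)
  qed
  moreover have "\<gamma> > 0" using \<beta> d by (simp add: \<gamma>_def)
  ultimately show ?thesis using that[of "A * exp 1" \<gamma>] A by simp
qed

lemma summable_exp_product:
  fixes \<gamma> :: real
  assumes \<gamma>: "\<gamma> > 0"
  shows "(\<lambda>m :: int ^ 'd. \<Prod>i\<in>UNIV. exp (- \<gamma> * \<bar>of_int (m $ i)\<bar>)) summable_on UNIV"
proof -
  define g where "g x = exp (- \<gamma> * \<bar>real_of_int x\<bar>)" for x :: int
  have geo: "(\<lambda>n. exp (- \<gamma>) ^ n) summable_on (UNIV :: nat set)"
    by (rule norm_summable_imp_summable_on) (use \<gamma> in \<open>auto intro!: summable_geometric simp: norm_power\<close>)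
  have pw: "exp (- \<gamma>) ^ n = exp (- \<gamma> * real n)" for n by (simp add: exp_of_nat_mult[symmetric] mult.commute)
  have 1: "g summable_on range int"
    by (subst summable_on_reindex) (use geo in \<open>auto simp: g_def o_def pw\<close>)
  have 2: "g summable_on range (\<lambda>n. - int n)"
    by (subst summable_on_reindex) (use geo in \<open>auto simp: g_def o_def pw inj_on_def\<close>)
  have U: "(UNIV :: int set) = range int \<union> range (\<lambda>n. - int n)"
    by (auto simp: image_iff) (metis int_cases2)
  have gs: "g summable_on UNIV" unfolding U by (rule summable_on_union[OF 1 2])
  define K where "K = infsum g UNIV"
  show ?thesis
  proof (rule nonneg_bdd_above_summable_on)
    show "bdd_above (sum (\<lambda>m :: int ^ 'd. \<Prod>i\<in>UNIV. exp (- \<gamma> * \<bar>of_int (m $ i)\<bar>)) ` {F. F \<subseteq> UNIV \<and> finite F})"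
    proof (rule bdd_aboveI2)
      fix F :: "(int ^ 'd) set" assume "F \<in> {F. F \<subseteq> UNIV \<and> finite F}"
      then have F: "finite F" by simp
      define B where "B i = (\<lambda>m. m $ i) ` F" for i :: 'd
      have B: "finite (B i)" for i using F by (simp add: B_def)
      have "(\<Sum>m\<in>F. \<Prod>i\<in>UNIV. g (m $ i)) \<le> (\<Sum>m\<in>{m. \<forall>i. m $ i \<in> B i}. \<Prod>i\<in>UNIV. g (m $ i))"
        by (rule sum_mono2[OF finite_box[OF B]]) (auto simp: B_def g_def intro: prod_nonneg)
      also have "\<dots> = (\<Prod>i\<in>UNIV. \<Sum>x\<in>B i. g x)" by (rule sum_product_over_box[OF B])
      also have "\<dots> \<le> (\<Prod>i\<in>(UNIV :: 'd set). K)"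
      proof (intro prod_mono conjI)
        fix i
        show "(\<Sum>x\<in>B i. g x) \<ge> 0" by (intro sum_nonneg) (simp add: g_def)
        show "(\<Sum>x\<in>B i. g x) \<le> K"
          unfolding K_def by (rule finite_sum_le_infsum[OF gs B]) (auto simp: g_def)
      qed
      finally show "(\<Sum>m\<in>F. \<Prod>i\<in>UNIV. exp (- \<gamma> * \<bar>of_int (m $ i)\<bar>)) \<le> (\<Prod>i\<in>(UNIV :: 'd set). K)" by (simp add: g_def)
    qed
  qed (auto intro: prod_nonneg)
qed

lemma has_sum_dominated_limit:
  fixes a :: "nat \<Rightarrow> 'i \<Rightarrow> 'b :: banach"
  assumes lim: "\<And>i. (\<lambda>l. a l i) \<longlonglongrightarrow> b i" and dom: "\<And>l i. norm (a l i) \<le> w i"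
    and w: "w summable_on UNIV" and S: "\<And>l. (a l has_sum S l) UNIV" and T: "S \<longlonglongrightarrow> T"
  shows "(b has_sum T) UNIV"
proof -
  have domb: "norm (b i) \<le> w i" for i
    by (rule LIMSEQ_le_const2[OF tendsto_norm[OF lim]]) (use dom in auto)
  have "b summable_on UNIV"
    by (rule abs_summable_summable, rule summable_on_comparison_test[OF w]) (use domb in auto)
  then have b: "(b has_sum infsum b UNIV) UNIV" by (rule has_sum_infsum)
  define W where "W = infsum w UNIV"
  have W: "(w has_sum W) UNIV" unfolding W_def by (rule has_sum_infsum[OF w])
  have "S \<longlonglongrightarrow> infsum b UNIV"
  proof (rule LIMSEQ_I)
    fix \<epsilon> :: real assume \<epsilon>: "\<epsilon> > 0"
    then have "\<epsilon> / 8 > 0" by simp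
    from has_sum_finite_approximation[OF W this]
    obtain F where F: "finite F" "dist (sum w F) W \<le> \<epsilon> / 8" by blast
    have "(\<lambda>l. \<Sum>i\<in>F. norm (a l i - b i)) \<longlonglongrightarrow> (\<Sum>i\<in>F. norm (b i - b i))" by (intro tendsto_intros lim)
    then have "(\<lambda>l. \<Sum>i\<in>F. norm (a l i - b i)) \<longlonglongrightarrow> 0" by simp
    from LIMSEQ_D[OF this, of "\<epsilon> / 2"] obtain L where L: "\<And>l. l \<ge> L \<Longrightarrow> (\<Sum>i\<in>F. norm (a l i - b i)) < \<epsilon> / 2"
      using \<epsilon> by (auto simp: sum_nonneg)
    have "norm (S l - infsum b UNIV) < \<epsilon>" if "l \<ge> L" for l
    proof -
      have s: "((\<lambda>i. a l i + - b i) has_sum S l + - infsum b UNIV) UNIV"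
        using S[of l] b by (intro has_sum_add) (simp_all add: has_sum_uminus)
      have t: "((\<lambda>i. (if i \<in> F then norm (a l i - b i) - 2 * w i else 0) + 2 * w i) has_sum (\<Sum>i\<in>F. norm (a l i - b i) - 2 * w i) + 2 * W) UNIV"
        by (intro has_sum_add has_sum_cmult_right W has_sum_finite_neutralI[OF F(1)]) auto
      have "norm (S l + - infsum b UNIV) \<le> (\<Sum>i\<in>F. norm (a l i - b i) - 2 * w i) + 2 * W"
      proof (rule norm_infsum_le[OF s t])
        fix i
        have "norm (a l i - b i) \<le> norm (a l i) + norm (b i)" by (rule norm_triangle_ineq4)
        then show "norm (a l i + - b i) \<le> (if i \<in> F then norm (a l i - b i) - 2 * w i else 0) + 2 * w i"
          using dom[of l i] domb[of i] by auto
      qed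
      also have "\<dots> = (\<Sum>i\<in>F. norm (a l i - b i)) + 2 * (W - sum w F)"
        by (simp add: sum_subtractf sum_distrib_left)
      also have "\<dots> < \<epsilon> / 2 + 2 * (\<epsilon> / 8)"
      proof (rule add_less_le_mono[OF L[OF that]])
        have "W - sum w F \<le> dist (sum w F) W"
          unfolding dist_real_def using abs_ge_minus_self[of "sum w F - W"] by simp
        also note F(2)
        finally show "2 * (W - sum w F) \<le> 2 * (\<epsilon> / 8)" by simp
      qed
      also have "\<dots> \<le> \<epsilon>" using \<epsilon> by simp
      finally show ?thesis by simp
    qed
    then show "\<exists>L. \<forall>l\<ge>L. norm (S l - infsum b UNIV) < \<epsilon>" by blast
  qed
  then have "T = infsum b UNIV" using T LIMSEQ_unique by blast
  then show ?thesis using b by simp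
qed

text \<open>The discrete coefficients on dyadic grids are bounded by one summable family, so along a
  subsequence they converge, and dominated convergence carries the finite inversion formula at grid
  points approaching \<open>x\<close> over to the limit.\<close>

theorem real_analytic_fourier_series:
  fixes f :: "real ^ 'd \<Rightarrow> real"
  assumes an: "real_analytic f" and tor: "torus_function f"
  obtains r and a :: "int ^ 'd \<Rightarrow> complex" where "r > 0"
    "(\<lambda>m. cmod (a m) * exp (r * norm (of_int_vec m :: real ^ 'd))) summable_on UNIV"
    "\<And>x. ((\<lambda>m. a m * fourier_char m x) has_sum complex_of_real (f x)) UNIV"
proof -
  obtain C \<gamma> where C: "C \<ge> 0" and \<gamma>: "\<gamma> > 0"
    and decay: "\<And>M m. M > 0 \<Longrightarrow> m \<in> centered_box M \<Longrightarrow> cmod (discrete_fourier M f m) \<le> C * (\<Prod>i\<in>UNIV. exp (- \<gamma> * \<bar>of_int (m $ i)\<bar>))"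
    using discrete_fourier_decay[OF an tor] by blast
  define w where "w m = C * (\<Prod>i\<in>UNIV. exp (- \<gamma> * \<bar>of_int (m $ i)\<bar>))" for m :: "int ^ 'd"
  have w0: "w m \<ge> 0" for m using C by (simp add: w_def prod_nonneg)
  have wC: "w m \<le> C" for m
  proof -
    have "(\<Prod>i\<in>UNIV. exp (- \<gamma> * \<bar>of_int (m $ i)\<bar>)) \<le> (1::real)" using \<gamma> by (intro prod_le_1) auto
    then have "C * (\<Prod>i\<in>UNIV. exp (- \<gamma> * \<bar>of_int (m $ i)\<bar>)) \<le> C * 1" using C by (rule mult_left_mono)
    then show ?thesis by (simp add: w_def)
  qed
  have ws: "w summable_on UNIV" unfolding w_def by (intro summable_on_cmult_right summable_exp_product \<gamma>)
  define c where "c l m = (if m \<in> centered_box (2 ^ l) then discrete_fourier (2 ^ l) f m else 0)" for l and m :: "int ^ 'd"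
  have cw: "cmod (c l m) \<le> w m" for l m
    using decay[of "2 ^ l" m] w0[of m] by (simp add: c_def w_def)
  have cC: "cmod (c l m) \<le> C" for l m using cw wC order.trans by blast
  have cS: "((\<lambda>m. c l m * fourier_char m (grid_point (2 ^ l) j)) has_sum complex_of_real (f (grid_point (2 ^ l) j))) UNIV" for l j
  proof -
    have "((\<lambda>m. c l m * fourier_char m (grid_point (2 ^ l) j)) has_sum (\<Sum>m\<in>centered_box (2 ^ l). c l m * fourier_char m (grid_point (2 ^ l) j))) UNIV"
      by (rule has_sum_finite_neutralI[OF finite_centered_box]) (auto simp: c_def)
    also have "(\<Sum>m\<in>centered_box (2 ^ l). c l m * fourier_char m (grid_point (2 ^ l) j)) = (\<Sum>m\<in>centered_box (2 ^ l). discrete_fourier (2 ^ l) f m * fourier_char m (grid_point (2 ^ l) j))"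
      by (intro sum.cong) (auto simp: c_def)
    also have "\<dots> = complex_of_real (f (grid_point (2 ^ l) j))" by (rule discrete_fourier_inversion[OF tor]) simp
    finally show ?thesis .
  qed
  obtain k where k: "strict_mono (k :: nat \<Rightarrow> nat)" and conv: "\<And>m. m \<in> UNIV \<Longrightarrow> \<exists>b. (\<lambda>l. c (k l) m) \<longlonglongrightarrow> b"
    by (rule function_convergent_subsequence[of UNIV c C]) (use cC in auto)
  from conv have "\<forall>m. \<exists>b. (\<lambda>l. c (k l) m) \<longlonglongrightarrow> b" by simp
  from choice[OF this] obtain a where a: "\<And>m. (\<lambda>l. c (k l) m) \<longlonglongrightarrow> a m" by blast
  have aw: "cmod (a m) \<le> w m" for m
    by (rule LIMSEQ_le_const2[OF tendsto_norm[OF a]]) (use cw in auto)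
  have series: "((\<lambda>m. a m * fourier_char m x) has_sum complex_of_real (f x)) UNIV" for x
  proof -
    define M where "M l = (2 ^ k l :: nat)" for l
    define j where "j l = (\<chi> i. \<lfloor>real (M l) * x $ i\<rfloor>)" for l
    define X where "X l = grid_point (M l) (j l)" for l
    have M: "M l > 0" for l by (simp add: M_def)
    have X: "X \<longlonglongrightarrow> x"
    proof (rule vec_tendstoI)
      fix i
      have "norm (X l $ i - x $ i) \<le> (1 / 2) ^ l" for l
      proof -
        have "\<bar>of_int \<lfloor>real (M l) * x $ i\<rfloor> - real (M l) * x $ i\<bar> \<le> 1" by linarith
        moreover have "X l $ i - x $ i = (of_int \<lfloor>real (M l) * x $ i\<rfloor> - real (M l) * x $ i) / real (M l)"
          using M[of l] by (simp add: X_def j_def grid_point_def of_int_vec_def field_simps)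
        ultimately have "\<bar>X l $ i - x $ i\<bar> \<le> 1 / real (M l)" using M[of l] by (simp add: divide_right_mono)
        also have "\<dots> \<le> 1 / 2 ^ l"
        proof -
          have "l \<le> k l" using k by (simp add: seq_suble)
          then have "(2::real) ^ l \<le> 2 ^ k l" by (intro power_increasing) auto
          then have "1 / (2::real) ^ k l \<le> 1 / 2 ^ l" by (intro divide_left_mono) auto
          then show ?thesis by (simp add: M_def)
        qed
        finally show ?thesis by (simp only: power_one_over real_norm_def)
      qed
      then have b: "\<forall>\<^sub>F l in sequentially. norm (X l $ i - x $ i) \<le> (1 / 2) ^ l" by (rule always_eventually[OF allI])
      have "(\<lambda>l. (1 / 2 :: real) ^ l) \<longlonglongrightarrow> 0" by (rule LIMSEQ_realpow_zero) auto
      from Lim_null_comparison[OF b this] show "(\<lambda>l. X l $ i) \<longlonglongrightarrow> x $ i" by (rule LIM_zero_cancel)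
    qed
    show ?thesis
    proof (rule has_sum_dominated_limit[where a="\<lambda>l m. c (k l) m * fourier_char m (X l)" and w=w and S="\<lambda>l. complex_of_real (f (X l))"])
      show "(\<lambda>l. c (k l) m * fourier_char m (X l)) \<longlonglongrightarrow> a m * fourier_char m x" for m
        unfolding fourier_char_def by (intro tendsto_intros a X)
      show "norm (c (k l) m * fourier_char m (X l)) \<le> w m" for l m
        using cw by (simp add: norm_mult fourier_char_def)
      show "((\<lambda>m. c (k l) m * fourier_char m (X l)) has_sum complex_of_real (f (X l))) UNIV" for l
        unfolding X_def M_def by (rule cS)
      have "(\<lambda>l. f (X l)) \<longlonglongrightarrow> f x"
      proof (rule isCont_tendsto_compose[OF _ X])
        show "isCont f x" using real_analytic_continuous[OF an] by (simp add: continuous_on_eq_continuous_at)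
      qed
      then show "(\<lambda>l. complex_of_real (f (X l))) \<longlonglongrightarrow> complex_of_real (f x)" by (rule tendsto_of_real)
    qed (rule ws)
  qed
  \<comment> \<open>Half of the decay rate is left over to make the weighted sum converge.\<close>
  define r where "r = \<gamma> / 2"
  have "(\<lambda>m. cmod (a m) * exp (r * norm (of_int_vec m :: real ^ 'd))) summable_on UNIV"
  proof (rule summable_on_comparison_test)
    show "(\<lambda>m :: int ^ 'd. C * (\<Prod>i\<in>UNIV. exp (- (\<gamma> / 2) * \<bar>of_int (m $ i)\<bar>))) summable_on UNIV"
      by (intro summable_on_cmult_right summable_exp_product) (use \<gamma> in simp)
    show "cmod (a m) * exp (r * norm (of_int_vec m :: real ^ 'd)) \<le> C * (\<Prod>i\<in>UNIV. exp (- (\<gamma> / 2) * \<bar>of_int (m $ i)\<bar>))" for m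
    proof -
      have "norm (of_int_vec m :: real ^ 'd) \<le> (\<Sum>i\<in>UNIV. \<bar>(of_int_vec m :: real ^ 'd) $ i\<bar>)" by (rule norm_le_l1_cart)
      then have "r * norm (of_int_vec m :: real ^ 'd) \<le> r * (\<Sum>i\<in>UNIV. \<bar>(of_int_vec m :: real ^ 'd) $ i\<bar>)"
        by (rule mult_left_mono) (use \<gamma> in \<open>simp add: r_def\<close>)
      also have "\<dots> = (\<Sum>i\<in>UNIV. r * \<bar>of_int (m $ i)\<bar>)" unfolding sum_distrib_left by (simp add: of_int_vec_def)
      finally have "exp (r * norm (of_int_vec m :: real ^ 'd)) \<le> exp (\<Sum>i\<in>UNIV. r * \<bar>of_int (m $ i)\<bar>)" by simp
      also have "\<dots> = (\<Prod>i\<in>UNIV. exp (r * \<bar>of_int (m $ i)\<bar>))" by (simp only: exp_sum finite)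
      finally have "cmod (a m) * exp (r * norm (of_int_vec m :: real ^ 'd)) \<le> w m * (\<Prod>i\<in>UNIV. exp (r * \<bar>of_int (m $ i)\<bar>))"
        using aw[of m] w0[of m] by (intro mult_mono) auto
      also have "\<dots> = C * (\<Prod>i\<in>UNIV. exp (- \<gamma> * \<bar>of_int (m $ i)\<bar>) * exp (r * \<bar>of_int (m $ i)\<bar>))"
        by (simp add: w_def prod.distrib)
      also have "(\<lambda>i. exp (- \<gamma> * \<bar>of_int (m $ i)\<bar>) * exp (r * \<bar>real_of_int (m $ i)\<bar>)) = (\<lambda>i. exp (- (\<gamma> / 2) * \<bar>of_int (m $ i)\<bar>))"
        by (simp add: r_def exp_add[symmetric] algebra_simps fun_eq_iff)
      finally show ?thesis .
    qed
  qed auto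
  then show ?thesis using that[of r a] series \<gamma> by (simp add: r_def)
qed

section \<open>An interval in the almost sure spectrum\<close>

lemma real_analytic_orbit_wiener:
  fixes f :: "real ^ 'd \<Rightarrow> real"
  assumes "real_analytic f" "torus_function f"
  obtains r N where "r > 0" "wiener \<alpha> r N (\<lambda>n. f (of_int n *\<^sub>R \<alpha>))"
proof -
  obtain r and a :: "int ^ 'd \<Rightarrow> complex" where r: "r > 0"
    and s: "(\<lambda>m. cmod (a m) * exp (r * norm (of_int_vec m :: real ^ 'd))) summable_on UNIV"
    and f: "\<And>x. ((\<lambda>m. a m * fourier_char m x) has_sum complex_of_real (f x)) UNIV"
    using real_analytic_fourier_series[OF assms] by blast
  have re_char: "Re (a m * fourier_char m (of_int n *\<^sub>R \<alpha>)) = cmod (a m) * cos (2 * pi * of_int n * (of_int_vec m \<bullet> \<alpha>) + Arg (a m))" for m n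
  proof -
    have "a m * fourier_char m (of_int n *\<^sub>R \<alpha>) = rcis (cmod (a m)) (Arg (a m)) * rcis 1 (2 * pi * (of_int_vec m \<bullet> (of_int n *\<^sub>R \<alpha>)))"
      unfolding rcis_cmod_Arg fourier_char_def cis_rcis_eq ..
    also have "\<dots> = rcis (cmod (a m)) (2 * pi * of_int n * (of_int_vec m \<bullet> \<alpha>) + Arg (a m))"
      unfolding rcis_mult by (simp add: algebra_simps)
    finally show ?thesis by simp
  qed
  have "wiener \<alpha> r (infsum (\<lambda>m. cmod (a m) * exp (r * norm (of_int_vec m :: real ^ 'd))) UNIV) (\<lambda>n. f (of_int n *\<^sub>R \<alpha>))"
  proof (rule wienerI[where a="\<lambda>m. cmod (a m)" and m="\<lambda>m. m" and \<phi>="\<lambda>m. Arg (a m)"])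
    show "((\<lambda>m. \<bar>cmod (a m)\<bar> * exp (r * norm (of_int_vec m :: real ^ 'd))) has_sum infsum (\<lambda>m. cmod (a m) * exp (r * norm (of_int_vec m :: real ^ 'd))) UNIV) UNIV"
      using has_sum_infsum[OF s] by simp
    show "((\<lambda>m. cmod (a m) * cos (2 * pi * of_int n * (of_int_vec m \<bullet> \<alpha>) + Arg (a m))) has_sum f (of_int n *\<^sub>R \<alpha>)) UNIV" for n
      using has_sum_Re[OF f[of "of_int n *\<^sub>R \<alpha>"]] unfolding re_char by simp
  qed simp
  then show ?thesis using that r by blast
qed

text \<open>Every energy in this interval is \<open>E + e + \<epsilon>\<close> with \<open>l / 3 \<le> \<epsilon> \<le> 2 l / 3\<close>, so it has a controlled
  solution for a potential with the two values \<open>e\<close> and \<open>e + l\<close>.\<close>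

lemma interval_in_hull_spectrum:
  fixes f :: "real ^ 'd \<Rightarrow> real"
  assumes P: "\<And>n. 1 / 2 \<le> P n" "\<And>n. P n \<le> 2"
    and ground: "\<And>n. P (n + 1) + P (n - 1) + c * f (of_int n *\<^sub>R \<alpha>) * P n = E * P n"
    and f: "\<And>x. \<bar>f x\<bar> \<le> F" and e: "e \<in> A" "e + l \<in> A" and l: "0 < l" "96 * l * 2 ^ 8 \<le> 1"
  shows "{E + e + l / 3..E + e + 2 * l / 3} \<subseteq> hull_spectrum c f \<alpha> A"
proof
  fix E' assume E': "E' \<in> {E + e + l / 3..E + e + 2 * l / 3}"
  define \<epsilon> where "\<epsilon> = E' - E - e"
  have \<epsilon>: "l / 3 \<le> \<epsilon>" "\<epsilon> \<le> 2 * l / 3" using E' by (auto simp: \<epsilon>_def)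
  have two: "(1::real) \<le> 2" by simp
  obtain \<omega> u :: "int \<Rightarrow> real" where \<omega>: "range \<omega> \<subseteq> {0, l}"
    and u: "\<And>n. n \<ge> 0 \<Longrightarrow> 1 / (2 * 2) \<le> u n \<and> u n \<le> 2 * 2"
    and eq: "\<And>n. n \<ge> 1 \<Longrightarrow> u (n + 1) + u (n - 1) + (c * f (of_int n *\<^sub>R \<alpha>) + \<omega> n) * u n = (E + \<epsilon>) * u n"
    by (rule controlled_half_line_solution[where C=2 and P=P and V="\<lambda>n. c * f (of_int n *\<^sub>R \<alpha>)", OF two P ground l \<epsilon>]) blast
  define \<omega>' where "\<omega>' n = e + \<omega> n" for n
  have \<omega>': "range \<omega>' \<subseteq> {e, e + l}" using \<omega> by (auto simp: \<omega>'_def)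
  let ?V = "potential c f \<alpha> 0 \<omega>'"
  have "quasimode ?V E' \<delta>" if \<delta>: "\<delta> > 0" for \<delta>
  proof (rule half_line_solution_quasimode[OF _ u _ _ \<delta>])
    show "(0::real) < 1 / (2 * 2)" by simp
    show "u (n + 1) + u (n - 1) + ?V n * u n = E' * u n" if "n \<ge> 1" for n
      using eq[OF that] by (simp add: potential_def \<omega>'_def \<epsilon>_def algebra_simps)
    have b: "\<bar>?V n\<bar> \<le> \<bar>c\<bar> * F + (\<bar>e\<bar> + l)" for n
      by (rule potential_bound[OF f _ \<omega>']) (use l in auto)
    show "\<bar>?V n - E'\<bar> \<le> \<bar>c\<bar> * F + (\<bar>e\<bar> + l) + \<bar>E'\<bar>" for n
      using b[of n] by linarith
  qed
  moreover have "range \<omega>' \<subseteq> A" using \<omega>' e by auto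
  ultimately show "E' \<in> hull_spectrum c f \<alpha> A"
    unfolding hull_spectrum_def by (intro CollectI allI impI exI[of _ 0] exI[of _ \<omega>'] conjI)
qed

lemma close_support_points:
  fixes S :: "real set"
  assumes "finite S \<longrightarrow> card S \<ge> 2" and "Inf {\<bar>E - E'\<bar> | E E'. E \<in> S \<and> E' \<in> S \<and> E \<noteq> E'} < \<epsilon>"
  obtains e l where "e \<in> S" "e + l \<in> S" "0 < l" "l < \<epsilon>"
proof -
  let ?D = "{\<bar>E - E'\<bar> | E E'. E \<in> S \<and> E' \<in> S \<and> E \<noteq> E'}"
  have "\<exists>x y. x \<in> S \<and> y \<in> S \<and> x \<noteq> y"
  proof (rule ccontr)
    assume "\<not> ?thesis"
    then have one: "\<And>x y. x \<in> S \<Longrightarrow> y \<in> S \<Longrightarrow> x = y" by blast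
    then have "finite S" by (metis finite.emptyI finite_insert finite_subset insertI1 subsetI)
    moreover from this have "card S \<le> 1" using one by (simp add: card_le_Suc0_iff_eq)
    ultimately show False using assms(1) by simp
  qed
  then have "?D \<noteq> {}" by blast
  then obtain z where "z \<in> ?D" "z < \<epsilon>" using cInf_lessD[OF _ assms(2)] by blast
  then obtain x y where xy: "x \<in> S" "y \<in> S" "x \<noteq> y" "\<bar>x - y\<bar> < \<epsilon>" by blast
  show ?thesis
  proof (cases "x < y")
    case True
    then show ?thesis using xy by (intro that[of x "y - x"]) auto
  next
    case False
    then show ?thesis using xy by (intro that[of y "x - y"]) auto
  qed
qed

theorem theorem1p3:
  fixes f :: "real ^ 'd \<Rightarrow> real" and \<alpha> :: "real ^ 'd"
  assumes "torus_function f" and "real_analytic f" and "diophantine \<alpha>"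
  shows "\<exists>c1>0. \<forall>c::real. 0 \<le> c \<and> c < c1 \<longrightarrow>
    (\<exists>lambda0>0. \<forall>\<nu> :: real measure.
       real_distribution \<nu> \<and>
       compact (topological_support \<nu>) \<and>
       (finite (topological_support \<nu>) \<longrightarrow> card (topological_support \<nu>) \<ge> 2) \<and>
       Inf {\<bar>E - E'\<bar> | E E'. E \<in> topological_support \<nu> \<and> E' \<in> topological_support \<nu> \<and> E \<noteq> E'} < lambda0
       \<longrightarrow> (\<exists>a b. a < b \<and> {a..b} \<subseteq> almost_sure_spectrum c f \<alpha> \<nu>))"
proof -
  have cont: "continuous_on UNIV f" by (rule real_analytic_continuous[OF assms(2)])
  obtain F where F: "\<And>x. \<bar>f x\<bar> \<le> F" using torus_bounded[OF assms(1) cont] by blast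
  obtain p G where sd: "small_divisors \<alpha> p G" using diophantine_small_divisors[OF assms(3)] by blast
  obtain r N where r: "r > 0" and W: "wiener \<alpha> r N (\<lambda>n. f (of_int n *\<^sub>R \<alpha>))"
    using real_analytic_orbit_wiener[OF assms(2,1)] by blast
  have N: "N \<ge> 0" using wiener_nonneg[OF W] r by simp
  obtain \<kappa> where \<kappa>: "\<kappa> > 0" and ground: "\<And>V. wiener \<alpha> r \<kappa> V \<Longrightarrow> \<exists>E P. \<forall>n. \<bar>P n - 1\<bar> \<le> 1 / 16 \<and> P (n + 1) + P (n - 1) + V n * P n = E * P n"
    by (rule quasiperiodic_ground_state[OF sd r]) blast
  show ?thesis
  proof (rule exI[of _ "\<kappa> / (N + 1)"], intro conjI allI impI)
    show "0 < \<kappa> / (N + 1)" using \<kappa> N by simp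
    fix c :: real assume c: "0 \<le> c \<and> c < \<kappa> / (N + 1)"
    have "c * (N + 1) \<le> \<kappa>" using c N by (simp add: field_simps)
    then have "\<bar>c\<bar> * N \<le> \<kappa>" using c by (simp add: algebra_simps)
    then have "wiener \<alpha> r \<kappa> (\<lambda>n. c * f (of_int n *\<^sub>R \<alpha>))"
      using wiener_mono[OF wiener_cmult[OF W, of c]] by blast
    then obtain E P where P: "\<And>n. \<bar>P n - 1\<bar> \<le> 1 / 16" "\<And>n. P (n + 1) + P (n - 1) + c * f (of_int n *\<^sub>R \<alpha>) * P n = E * P n"
      using ground by blast
    have P2: "1 / 2 \<le> P n" "P n \<le> 2" for n using P(1)[of n] by linarith+
    show "\<exists>lambda0>0. \<forall>\<nu> :: real measure.
       real_distribution \<nu> \<and>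
       compact (topological_support \<nu>) \<and>
       (finite (topological_support \<nu>) \<longrightarrow> card (topological_support \<nu>) \<ge> 2) \<and>
       Inf {\<bar>E - E'\<bar> | E E'. E \<in> topological_support \<nu> \<and> E' \<in> topological_support \<nu> \<and> E \<noteq> E'} < lambda0
       \<longrightarrow> (\<exists>a b. a < b \<and> {a..b} \<subseteq> almost_sure_spectrum c f \<alpha> \<nu>)"
    proof (rule exI[of _ "1 / (96 * 2 ^ 8)"], intro conjI allI impI)
      fix \<nu> :: "real measure"
      assume \<nu>: "real_distribution \<nu> \<and>
       compact (topological_support \<nu>) \<and>
       (finite (topological_support \<nu>) \<longrightarrow> card (topological_support \<nu>) \<ge> 2) \<and>
       Inf {\<bar>E - E'\<bar> | E E'. E \<in> topological_support \<nu> \<and> E' \<in> topological_support \<nu> \<and> E \<noteq> E'} < 1 / (96 * 2 ^ 8)"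
      obtain e l where e: "e \<in> topological_support \<nu>" "e + l \<in> topological_support \<nu>" and l: "0 < l" "l < 1 / (96 * 2 ^ 8)"
        by (rule close_support_points[of "topological_support \<nu>" "1 / (96 * 2 ^ 8)"]) (use \<nu> in auto)
      have "almost_sure_spectrum c f \<alpha> \<nu> = hull_spectrum c f \<alpha> (topological_support \<nu>)"
        using \<nu> by (intro almost_sure_spectrum_eq_hull_spectrum assms cont inner_of_int_vec_not_int) auto
      moreover have "{E + e + l / 3..E + e + 2 * l / 3} \<subseteq> hull_spectrum c f \<alpha> (topological_support \<nu>)"
        by (rule interval_in_hull_spectrum[OF P2 P(2) F e l(1)]) (use l(2) in simp)
      ultimately show "\<exists>a b. a < b \<and> {a..b} \<subseteq> almost_sure_spectrum c f \<alpha> \<nu>"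
        using l(1) by (intro exI[of _ "E + e + l / 3"] exI[of _ "E + e + 2 * l / 3"]) auto
    qed simp
  qed
qed

end
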